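(* Let $P$ be a minimal $n$-dimensional Gorenstein polytope of degree $2$. Then $\mathrm{Vol}_{\mathbb{N}}(P)\le 4$.
   Context: Let $M\cong\mathbb{Z}^n$ be a lattice, $N=\mathrm{Hom}(M,\mathbb{Z})$, $M_{\mathbb{R}}=M\otimes\mathbb{R}$. A lattice polytope is the convex hull of finitely many points of $M$. For an $n$-dimensional lattice polytope $P$: $\mathrm{Vol}_{\mathbb{N}}(P)=n!\cdot\mathrm{vol}(P)$; $h^*_P(t):=(1-t)^{n+1}\sum_{k\ge 0}|kP\cap M|t^k$ is a polynomial, and $\deg P:=\deg h^*_P$. An $n$-dimensional lattice polytope $\Delta$ with $0$ in its interior is reflexive if $\{y\in N_{\mathbb{R}}:\langle x,y\rangle\ge -1\ \forall x\in\Delta\}$ is a lattice polytope; it is reflexive with respect to an interior lattice point $m$ if $\Delta-m$ is reflexive. $P$ is Gorenstein of index $r\ge1$ if $rP$ is reflexive with respect to some interior lattice point; then $\deg P=n+1-r$. An $n$-dimensional Gorenstein polytope $P\subset M_{\mathbb{R}}$ of degree $2$ is called minimal if there is no $n$-dimensional lattice polytope $P'\subsetneq P$ (with vertices in $M$) which is a Gorenstein polytope of degree $2$. *)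

theory Defs
  imports "HOL-Analysis.Analysis" "HOL-Computational_Algebra.Computational_Algebra"
begin

text \<open>
  A basis of the lattice \<open>M\<close> is fixed, so that \<open>M\<close> is the set of integral vectors of
  \<open>real ^ 'n\<close> with \<open>n = CARD('n)\<close>. The dual space is identified with \<open>real ^ 'n\<close> through
  the inner product, which makes \<open>N\<close> the set of integral vectors as well.
\<close>

definition lattice_points :: "(real ^ 'n) set" where
  "lattice_points = {x. \<forall>i. x $ i \<in> \<int>}"

definition lattice_polytope :: "(real ^ 'n) set \<Rightarrow> bool" where
  "lattice_polytope P \<longleftrightarrow> (\<exists>V. finite V \<and> V \<subseteq> lattice_points \<and> P = convex hull V)"

definition full_lattice_polytope :: "(real ^ 'n) set \<Rightarrow> bool" where
  "full_lattice_polytope P \<longleftrightarrow> lattice_polytope P \<and> aff_dim P = int CARD('n)"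

definition dilate :: "nat \<Rightarrow> (real ^ 'n) set \<Rightarrow> (real ^ 'n) set" where
  "dilate k P = (\<lambda>x. real k *\<^sub>R x) ` P"

definition normalized_volume :: "(real ^ 'n) set \<Rightarrow> real" where
  "normalized_volume P = fact CARD('n) * measure lebesgue P"

definition ehrhart_series :: "(real ^ 'n) set \<Rightarrow> int fps" where
  "ehrhart_series P = Abs_fps (\<lambda>k. int (card (dilate k P \<inter> lattice_points)))"

text \<open>The exponent is the right one for polytopes of full dimension \<open>CARD('n)\<close> only.\<close>

definition hstar_series :: "(real ^ 'n) set \<Rightarrow> int fps" where
  "hstar_series P = (1 - fps_X) ^ (CARD('n) + 1) * ehrhart_series P"

text \<open>
  By Ehrhart's theorem, \<open>hstar_series P\<close> is a polynomial for every full-dimensional lattice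
  polytope \<open>P\<close>, so such a \<open>P\<close> satisfies \<open>has_degree P d\<close> for exactly one \<open>d\<close>.
\<close>

definition has_degree :: "(real ^ 'n) set \<Rightarrow> nat \<Rightarrow> bool" where
  "has_degree P d \<longleftrightarrow> (\<exists>h :: int poly. fps_of_poly h = hstar_series P \<and> degree h = d)"

definition dual_polytope :: "(real ^ 'n) set \<Rightarrow> (real ^ 'n) set" where
  "dual_polytope D = {y. \<forall>x\<in>D. x \<bullet> y \<ge> -1}"

definition reflexive :: "(real ^ 'n) set \<Rightarrow> bool" where
  "reflexive D \<longleftrightarrow>
     full_lattice_polytope D \<and> 0 \<in> interior D \<and> lattice_polytope (dual_polytope D)"

definition reflexive_wrt :: "(real ^ 'n) set \<Rightarrow> real ^ 'n \<Rightarrow> bool" where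
  "reflexive_wrt D m \<longleftrightarrow>
     m \<in> lattice_points \<and> m \<in> interior D \<and> reflexive ((\<lambda>x. x - m) ` D)"

definition gorenstein_of_index :: "(real ^ 'n) set \<Rightarrow> nat \<Rightarrow> bool" where
  "gorenstein_of_index P r \<longleftrightarrow>
     full_lattice_polytope P \<and> r \<ge> 1 \<and> (\<exists>m. reflexive_wrt (dilate r P) m)"

definition gorenstein :: "(real ^ 'n) set \<Rightarrow> bool" where
  "gorenstein P \<longleftrightarrow> (\<exists>r. gorenstein_of_index P r)"

definition minimal_gorenstein_degree_2 :: "(real ^ 'n) set \<Rightarrow> bool" where
  "minimal_gorenstein_degree_2 P \<longleftrightarrow>
     gorenstein P \<and> has_degree P 2 \<and>
     \<not> (\<exists>P'. P' \<subset> P \<and> full_lattice_polytope P' \<and> gorenstein P' \<and> has_degree P' 2)"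

end

theory Submission
  imports Defs
begin

text \<open>
  Homogenise: work in \<open>real ^ 'n \<times> real\<close> with the lattice \<open>\<int>\<^sup>n \<times> \<int>\<close> graded by the last coordinate,
  and let \<open>u = (m, r)\<close> be the interior point of the cone over \<open>P\<close> given by the Gorenstein property.
  Decomposing the cone over a lattice polytope into half-open simplicial cones gives the polynomiality
  of \<open>h\<^sup>*\<close> and the reciprocity between the cone and its interior. Since the interior lattice points
  are \<open>u\<close> plus the lattice points of the cone, degree 2 forces \<open>r = n - 1\<close>, \<open>h\<^sup>* = 1 + h\<^sub>1 t + t\<^sup>2\<close> and
  normalized volume \<open>card Q - n + 1\<close>, where \<open>Q\<close> is the set of lattice points of \<open>P\<close>. The same
  computation shows that the hull of any spanning subset of \<open>Q\<close> with \<open>u\<close> in the interior of its cone is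
  again Gorenstein of degree 2. Hence, for a minimal \<open>P\<close>, each such subset contains the vertex set \<open>V\<close>.
  It remains to show \<open>card Q \<le> n + 3\<close>. Steinitz's theorem bounds \<open>card V\<close>. Box points have height at
  most 2, so all but at most one of the other points of \<open>Q\<close> lie on segments between two vertices;
  exchanging points along such a segment shows that they are midpoints, and that there are few of them.
\<close>

section \<open>Nonnegative and positive combinations\<close>

text \<open>With \<open>DIM('a) = n + 1\<close>, degree 2 puts \<open>u\<close> at height
  \<open>DIM('a) - 2\<close>, and this number drives the counting. In a representation of
  \<open>u\<close> by points of \<open>Q\<close>, a coefficient above 1 at q would place
  \<open>u - q\<close> in the interior of the cone, below the lowest interior lattice point. So all
  coefficients are at most 1 and every support has at least \<open>DIM('a) - 2\<close> points.
  Steinitz's theorem, started from an independent support X, leaves at most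
  \<open>2 * DIM('a) - card X\<close> vertices, hence at most \<open>DIM('a) + 2\<close>. The
  obstacle is that vertices and further points of \<open>Q\<close> have to be bounded together by
  this same number. What couples them is exchange: a further point that could replace a vertex, with
  \<open>u\<close> still inside and the span still full, contradicts minimality. So if
  \<open>V\<close> is dependent, one further point already forces
  \<open>card V = DIM('a) + 1\<close> and is the only one; if \<open>V\<close> is a basis, the
  coefficients of \<open>u\<close> are unique and leave room for two. Exchange is available because
  membership in the class needs no facet condition for a subset: the absence of interior points
  below \<open>u\<close> fixes h-star up to its linear coefficient, and the symmetry of h-star gives
  the Gorenstein property back by counting.\<close>

abbreviation lincomb :: "('a::real_vector \<Rightarrow> real) \<Rightarrow> 'a set \<Rightarrow> 'a" where
  "lincomb c A \<equiv> \<Sum>a\<in>A. c a *\<^sub>R a"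

definition nonneg_comb :: "'a::real_vector set \<Rightarrow> 'a set" where
  "nonneg_comb A = {x. \<exists>c. (\<forall>a\<in>A. 0 \<le> c a) \<and> x = lincomb c A}"

text \<open>For finite \<open>A\<close> this is the relative interior of the cone
  \<open>nonneg_comb A\<close>, with positive weights also on redundant generators. For infinite
  \<open>A\<close> the sums are 0 and both sets are {0}.\<close>

definition pos_comb :: "'a::real_vector set \<Rightarrow> 'a set" where
  "pos_comb A = {x. \<exists>c. (\<forall>a\<in>A. 0 < c a) \<and> x = lincomb c A}"

lemma nonneg_combI: "\<lbrakk>\<And>a. a \<in> A \<Longrightarrow> 0 \<le> c a; x = lincomb c A\<rbrakk> \<Longrightarrow> x \<in> nonneg_comb A"
  unfolding nonneg_comb_def by blast

lemma pos_combI: "\<lbrakk>\<And>a. a \<in> A \<Longrightarrow> 0 < c a; x = lincomb c A\<rbrakk> \<Longrightarrow> x \<in> pos_comb A"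
  unfolding pos_comb_def by blast

lemma nonneg_combE:
  assumes "x \<in> nonneg_comb A"
  obtains c where "\<And>a. a \<in> A \<Longrightarrow> 0 \<le> c a" "x = lincomb c A"
  using assms unfolding nonneg_comb_def by blast

lemma pos_combE:
  assumes "x \<in> pos_comb A"
  obtains c where "\<And>a. a \<in> A \<Longrightarrow> 0 < c a" "x = lincomb c A"
  using assms unfolding pos_comb_def by blast

lemma zero_in_nonneg_comb [simp]: "0 \<in> nonneg_comb A"
  by (rule nonneg_combI[where c = "\<lambda>_. 0"]) auto

lemma nonneg_comb_add: "x \<in> nonneg_comb A \<Longrightarrow> y \<in> nonneg_comb A \<Longrightarrow> x + y \<in> nonneg_comb A"
  by (elim nonneg_combE, rule nonneg_combI[where c = "\<lambda>a. _ a + _ a"])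
     (auto simp: scaleR_left_distrib sum.distrib)

lemma pos_comb_add_nonneg: "x \<in> pos_comb A \<Longrightarrow> y \<in> nonneg_comb A \<Longrightarrow> x + y \<in> pos_comb A"
  by (elim nonneg_combE pos_combE, rule pos_combI[where c = "\<lambda>a. _ a + _ a"])
     (auto simp: scaleR_left_distrib sum.distrib add_pos_nonneg)

lemma nonneg_comb_scale: "x \<in> nonneg_comb A \<Longrightarrow> 0 \<le> t \<Longrightarrow> t *\<^sub>R x \<in> nonneg_comb A"
  by (elim nonneg_combE, rule nonneg_combI[where c = "\<lambda>a. t * _ a"])
     (auto simp: scaleR_sum_right)

lemma pos_comb_scale: "x \<in> pos_comb A \<Longrightarrow> 0 < t \<Longrightarrow> t *\<^sub>R x \<in> pos_comb A"
  by (elim pos_combE, rule pos_combI[where c = "\<lambda>a. t * _ a"])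
     (auto simp: scaleR_sum_right)

lemma nonneg_comb_sum: "(\<And>i. i \<in> I \<Longrightarrow> f i \<in> nonneg_comb A) \<Longrightarrow> sum f I \<in> nonneg_comb A"
  by (induction I rule: infinite_finite_induct) (auto intro: nonneg_comb_add)

lemma pos_comb_imp_nonneg:
  assumes "x \<in> pos_comb A" shows "x \<in> nonneg_comb A"
proof -
  obtain c where c: "\<And>a. a \<in> A \<Longrightarrow> 0 < c a" "x = lincomb c A" using assms unfolding pos_comb_def by blast
  show ?thesis using c(1) by (intro nonneg_combI[OF _ c(2)]) (auto intro: less_imp_le)
qed

lemma nonneg_comb_base:
  assumes "finite A" "a \<in> A" shows "a \<in> nonneg_comb A"
proof (rule nonneg_combI)
  have "(\<Sum>b\<in>A. (if b = a then 1 else 0) *\<^sub>R b) = (\<Sum>b\<in>A. if b = a then b else 0)"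
    by (rule sum.cong) auto
  then show "a = (\<Sum>b\<in>A. (if b = a then 1 else 0) *\<^sub>R b)" using assms by simp
qed auto

lemma nonneg_comb_trans:
  assumes "\<And>a. a \<in> A \<Longrightarrow> a \<in> nonneg_comb B" shows "nonneg_comb A \<subseteq> nonneg_comb B"
proof
  fix x assume "x \<in> nonneg_comb A"
  then obtain c where c: "\<And>a. a \<in> A \<Longrightarrow> 0 \<le> c a" "x = lincomb c A" unfolding nonneg_comb_def by blast
  show "x \<in> nonneg_comb B" unfolding c(2) using assms c(1) by (auto intro!: nonneg_comb_sum nonneg_comb_scale)
qed

lemma nonneg_comb_mono: "finite B \<Longrightarrow> A \<subseteq> B \<Longrightarrow> nonneg_comb A \<subseteq> nonneg_comb B"
  by (rule nonneg_comb_trans) (auto intro: nonneg_comb_base)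

lemma nonneg_comb_in_span: "x \<in> nonneg_comb A \<Longrightarrow> x \<in> span A"
  by (elim nonneg_combE, simp, intro span_sum span_scale span_base)

lemma pos_comb_in_span: "x \<in> pos_comb A \<Longrightarrow> x \<in> span A"
  by (rule nonneg_comb_in_span[OF pos_comb_imp_nonneg])

lemma pos_comb_singleton: "0 < t \<Longrightarrow> t *\<^sub>R a \<in> pos_comb {a}"
  by (rule pos_combI[where c = "\<lambda>_. t"]) auto

lemma sum_in_pos_comb: "(\<Sum>a\<in>A. a) \<in> pos_comb A"
  by (rule pos_combI[where c = "\<lambda>_. 1"]) auto

lemma pos_comb_Un:
  assumes "finite A" "finite B" "x \<in> pos_comb A" "y \<in> pos_comb B"
  shows "x + y \<in> pos_comb (A \<union> B)"
proof -
  obtain c where c: "\<And>a. a \<in> A \<Longrightarrow> 0 < c a" "x = lincomb c A" using assms(3) unfolding pos_comb_def by blast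
  obtain d where d: "\<And>a. a \<in> B \<Longrightarrow> 0 < d a" "y = lincomb d B" using assms(4) unfolding pos_comb_def by blast
  define e where "e a = (if a \<in> A then c a else 0) + (if a \<in> B then d a else 0)" for a
  have x: "x = (\<Sum>a\<in>A \<union> B. (if a \<in> A then c a else 0) *\<^sub>R a)"
    unfolding c(2) using assms by (intro sum.mono_neutral_cong_left) auto
  have y: "y = (\<Sum>a\<in>A \<union> B. (if a \<in> B then d a else 0) *\<^sub>R a)"
    unfolding d(2) using assms by (intro sum.mono_neutral_cong_left) auto
  show ?thesis
  proof (rule pos_combI)
    show "0 < e a" if "a \<in> A \<union> B" for a
      using that c(1)[of a] d(1)[of a] by (auto simp: e_def)
    show "x + y = (\<Sum>a\<in>A \<union> B. e a *\<^sub>R a)"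
      unfolding x y e_def by (simp add: scaleR_left_distrib sum.distrib)
  qed
qed

text \<open>Finitely many inequalities that are strict at t = 0 survive on a common interval. This
  serves for positive weights in a cone and for the inactive inequalities at a vertex of the dual
  polytope.\<close>

lemma finite_uniform_bound:
  fixes c d :: "'b \<Rightarrow> real"
  assumes "finite A" "\<And>a. a \<in> A \<Longrightarrow> 0 < c a"
  shows "\<exists>e>0. \<forall>a\<in>A. \<forall>t. \<bar>t\<bar> \<le> e \<longrightarrow> 0 < c a + t * d a"
  using assms
proof (induction A rule: finite_induct)
  case empty then show ?case by (intro exI[of _ 1]) auto
next
  case (insert b A)
  then obtain e where e: "e > 0" "\<forall>a\<in>A. \<forall>t. \<bar>t\<bar> \<le> e \<longrightarrow> 0 < c a + t * d a" by auto
  \<comment> \<open>The summand 1 keeps the quotient meaningful for \<open>d b = 0\<close> and makes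
    the estimate below strict.\<close>
  define e' where "e' = c b / (\<bar>d b\<bar> + 1)"
  have cb: "c b > 0" using insert by auto
  have "0 < c b + t * d b" if "\<bar>t\<bar> \<le> e'" for t
  proof -
    have "\<bar>t * d b\<bar> \<le> e' * \<bar>d b\<bar>" unfolding abs_mult using that by (intro mult_right_mono) auto
    also have "\<dots> < c b" unfolding e'_def using cb by (simp add: field_simps)
    finally show ?thesis by linarith
  qed
  moreover have "e' > 0" using cb by (auto simp: e'_def)
  ultimately show ?case using e by (intro exI[of _ "min e e'"]) auto
qed

lemma pos_comb_absorb:
  assumes "finite A" "x \<in> pos_comb A" "w \<in> span A"
  obtains e where "e > 0" "\<And>t. \<bar>t\<bar> \<le> e \<Longrightarrow> x + t *\<^sub>R w \<in> pos_comb A"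
proof -
  obtain c where c: "\<And>a. a \<in> A \<Longrightarrow> 0 < c a" "x = lincomb c A" using assms(2) unfolding pos_comb_def by blast
  obtain d where d: "w = lincomb d A" using assms(1,3) by (auto simp: span_finite)
  obtain e where e: "e > 0" "\<forall>a\<in>A. \<forall>t. \<bar>t\<bar> \<le> e \<longrightarrow> 0 < c a + t * d a"
    using finite_uniform_bound[OF assms(1), of c d] c(1) by blast
  show ?thesis
  proof (rule that[OF e(1)])
    fix t :: real assume "\<bar>t\<bar> \<le> e"
    then show "x + t *\<^sub>R w \<in> pos_comb A" using e(2)
      by (intro pos_combI[where c = "\<lambda>a. c a + t * d a"])
         (auto simp: c(2) d scaleR_left_distrib sum.distrib scaleR_sum_right)
  qed
qed

lemma pos_comb_absorb_minus:
  assumes "finite A" "x \<in> pos_comb A" "w \<in> span A"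
  obtains e where "e > 0" "x - e *\<^sub>R w \<in> pos_comb A"
proof -
  obtain e where e: "e > 0" "\<And>t. \<bar>t\<bar> \<le> e \<Longrightarrow> x + t *\<^sub>R w \<in> pos_comb A"
    using pos_comb_absorb[OF assms] by blast
  have "x + (- e) *\<^sub>R w \<in> pos_comb A" using e by (intro e(2)) auto
  with e(1) that show ?thesis by simp
qed

text \<open>One common point u suffices: y keeps positive weights after a small multiple of u is
  removed, and that multiple is put back with positive weights on all of \<open>B\<close>.\<close>

lemma pos_comb_mono_cross:
  assumes "finite B" "A \<subseteq> B" "u \<in> pos_comb A" "u \<in> pos_comb B"
  shows "pos_comb A \<subseteq> pos_comb B"
proof
  fix y assume y: "y \<in> pos_comb A"
  have "finite A" using assms finite_subset by blast
  then obtain e where e: "e > 0" "y - e *\<^sub>R u \<in> pos_comb A"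
    using pos_comb_absorb_minus[OF _ y, of u] pos_comb_in_span[OF assms(3)] by blast
  then have "y - e *\<^sub>R u \<in> nonneg_comb B" using nonneg_comb_mono[OF assms(1,2)] pos_comb_imp_nonneg by blast
  then have "e *\<^sub>R u + (y - e *\<^sub>R u) \<in> pos_comb B"
    using assms e by (intro pos_comb_add_nonneg pos_comb_scale)
  then show "y \<in> pos_comb B" by simp
qed

text \<open>A small multiple of y can be removed from x inside the relative interior and put back
  through the generators in \<open>S\<close>. This is how a support of u is enlarged in Steinitz's
  theorem.\<close>

lemma pos_comb_insert_span:
  assumes "finite A" "x \<in> pos_comb A" "finite S" "y \<in> pos_comb S" "y \<in> span A"
  shows "x \<in> pos_comb (A \<union> S)"
proof -
  obtain e where e: "e > 0" "x - e *\<^sub>R y \<in> pos_comb A"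
    using pos_comb_absorb_minus[OF assms(1,2,5)] .
  have "(x - e *\<^sub>R y) + e *\<^sub>R y \<in> pos_comb (A \<union> S)"
    using assms e by (intro pos_comb_Un pos_comb_scale)
  then show ?thesis by simp
qed

section \<open>Caratheodory and Steinitz theorems for cones\<close>

lemma nonneg_comb_drop_zeros:
  fixes X :: "'a::real_vector set"
  assumes "finite X" "\<And>x. x \<in> X \<Longrightarrow> 0 \<le> c x"
  shows "lincomb c X = (\<Sum>x\<in>{x\<in>X. 0 < c x}. c x *\<^sub>R x)"
proof (rule sum.mono_neutral_right)
  show "\<forall>i\<in>X - {x \<in> X. 0 < c x}. c i *\<^sub>R i = 0"
  proof
    fix i assume "i \<in> X - {x \<in> X. 0 < c x}"
    then have "c i = 0" using assms(2)[of i] by simp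
    then show "c i *\<^sub>R i = 0" by simp
  qed
qed (use assms(1) in auto)

text \<open>The ratio test of the simplex method: t is the least quotient c x / d x over the
  positive entries of d. It also serves as the pivot rule in
  \<open>optimal_basis_exists\<close>.\<close>

lemma caratheodory_step:
  fixes c d :: "'a::real_vector \<Rightarrow> real"
  assumes "finite X" "\<And>x. x \<in> X \<Longrightarrow> 0 < c x" "x0 \<in> X" "0 < d x0"
  obtains t where "\<And>x. x \<in> X \<Longrightarrow> 0 \<le> c x - t * d x" "\<exists>x\<in>X. c x - t * d x = 0" "0 < t"
proof -
  let ?R = "(\<lambda>x. c x / d x) ` {x\<in>X. 0 < d x}"
  define t where "t = Min ?R"
  have R: "finite ?R" "?R \<noteq> {}" using assms by auto
  have "t \<in> ?R" unfolding t_def using R by (rule Min_in)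
  then obtain y where y: "y \<in> X" "0 < d y" "t = c y / d y" by auto
  have t: "0 < t" using y assms(2)[of y] by auto
  show ?thesis
  proof (rule that)
    fix x assume x: "x \<in> X"
    show "0 \<le> c x - t * d x"
    proof (cases "0 < d x")
      case True
      then have "t \<le> c x / d x" unfolding t_def using R(1) x by (intro Min_le) auto
      then show ?thesis using True by (simp add: field_simps)
    next
      case False
      then have "t * d x \<le> 0" using t by (simp add: mult_nonneg_nonpos)
      then show ?thesis using assms(2)[OF x] by linarith
    qed
  next
    show "\<exists>x\<in>X. c x - t * d x = 0" using y by (intro bexI[of _ y]) auto
  qed (rule t)
qed

text \<open>Caratheodory's theorem in the quotient by \<open>W\<close>; the last conjunct is
  independence of \<open>S\<close> modulo \<open>W\<close>. The choice \<open>W = {0}\<close> is the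
  usual cone version, and \<open>W = span X\<close> is what a step of Steinitz's theorem
  needs.\<close>

lemma caratheodory_modulo:
  assumes "finite X" "subspace W" "\<And>x. x \<in> X \<Longrightarrow> 0 < c x" "w - lincomb c X \<in> W"
  shows "\<exists>S c'. S \<subseteq> X \<and> (\<forall>x\<in>S. 0 < c' x) \<and> w - lincomb c' S \<in> W \<and>
           (\<forall>d. lincomb d S \<in> W \<longrightarrow> (\<forall>x\<in>S. d x = 0))"
  using assms(1,3,4)
proof (induction X arbitrary: c rule: finite_psubset_induct)
  case (psubset X)
  show ?case
  proof (cases "\<forall>d. lincomb d X \<in> W \<longrightarrow> (\<forall>x\<in>X. d x = 0)")
    case True
    then show ?thesis using psubset.prems by (intro exI[of _ X] exI[of _ c]) auto
  next
    case False
    then obtain d0 where d0: "lincomb d0 X \<in> W" "\<exists>x\<in>X. d0 x \<noteq> 0" by blast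
    \<comment> \<open>The ratio test needs a positive entry; if the relation has none, its negative
      does.\<close>
    have "\<exists>d. lincomb d X \<in> W \<and> (\<exists>x\<in>X. 0 < d x)"
    proof (cases "\<exists>x\<in>X. 0 < d0 x")
      case True then show ?thesis using d0 by blast
    next
      case False
      then have "\<exists>x\<in>X. 0 < - d0 x" using d0(2) by (metis neg_0_less_iff_less linorder_neqE_linordered_idom)
      moreover have "(\<Sum>x\<in>X. (- d0 x) *\<^sub>R x) \<in> W"
        using subspace_neg[OF assms(2) d0(1)] by (simp add: sum_negf)
      ultimately show ?thesis by (intro exI[of _ "\<lambda>x. - d0 x"] conjI)
    qed
    then obtain d x0 where d: "lincomb d X \<in> W" "x0 \<in> X" "0 < d x0" by blast
    obtain t where t: "\<And>x. x \<in> X \<Longrightarrow> 0 \<le> c x - t * d x" "\<exists>x\<in>X. c x - t * d x = 0" "0 < t"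
      using caratheodory_step[of X c x0 d, OF psubset.hyps(1) psubset.prems(1) d(2,3)] by blast
    define c' where "c' x = c x - t * d x" for x
    define Y where "Y = {x\<in>X. 0 < c' x}"
    obtain x1 where "x1 \<in> X" "c' x1 = 0" using t(2) by (auto simp: c'_def)
    then have "x1 \<in> X - Y" by (simp add: Y_def)
    then have YX: "Y \<subset> X" by (auto simp: Y_def)
    have "w - lincomb c' Y = w - lincomb c' X"
      unfolding Y_def using nonneg_comb_drop_zeros[OF psubset.hyps(1), of c'] t(1) by (simp add: c'_def)
    also have "\<dots> = (w - lincomb c X) + t *\<^sub>R (lincomb d X)"
      by (simp add: c'_def scaleR_left_diff_distrib sum_subtractf scaleR_sum_right)
    also have "\<dots> \<in> W" by (intro subspace_add[OF assms(2)] subspace_scale[OF assms(2)] d psubset.prems)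
    finally have "w - lincomb c' Y \<in> W" .
    then obtain S c'' where "S \<subseteq> Y" "\<forall>x\<in>S. 0 < c'' x" "w - lincomb c'' S \<in> W"
      "\<forall>d. lincomb d S \<in> W \<longrightarrow> (\<forall>x\<in>S. d x = 0)"
      using psubset.IH[OF YX, of c'] unfolding Y_def by auto
    then show ?thesis using YX by (intro exI[of _ S] exI[of _ c'']) auto
  qed
qed

lemma caratheodory_cone:
  assumes "finite X" "x \<in> nonneg_comb X"
  obtains S where "S \<subseteq> X" "independent S" "x \<in> pos_comb S"
proof -
  obtain c where c: "\<And>a. a \<in> X \<Longrightarrow> 0 \<le> c a" "x = lincomb c X" using assms(2) unfolding nonneg_comb_def by blast
  define Y where "Y = {a\<in>X. 0 < c a}"
  have "finite Y" "Y \<subseteq> X" using assms by (auto simp: Y_def)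
  moreover have "x = lincomb c Y" unfolding c(2) Y_def by (rule nonneg_comb_drop_zeros[OF assms(1) c(1)])
  ultimately have "x - lincomb c Y \<in> {0}" by simp
  moreover have "\<And>a. a \<in> Y \<Longrightarrow> 0 < c a" by (simp add: Y_def)
  ultimately obtain S c' where S: "S \<subseteq> Y" "\<forall>a\<in>S. 0 < c' a" "x - lincomb c' S \<in> {0}"
    "\<forall>d. lincomb d S \<in> {0} \<longrightarrow> (\<forall>a\<in>S. d a = 0)"
    using caratheodory_modulo[of Y "{0}" c x] \<open>finite Y\<close> subspace_single_0 by blast
  have "finite S" using S(1) \<open>finite Y\<close> finite_subset by blast
  then have "independent S" using S(4) by (auto simp: dependent_finite)
  then show ?thesis using S \<open>Y \<subseteq> X\<close> by (intro that[of S] pos_combI[of S c']) auto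
qed

lemma dim_Un_independent_modulo:
  fixes X S :: "'a::euclidean_space set"
  assumes "finite S" "\<And>d. lincomb d S \<in> span X \<Longrightarrow> \<forall>x\<in>S. d x = 0"
  shows "dim X + card S \<le> dim (X \<union> S)"
proof -
  obtain B where B: "B \<subseteq> X" "independent B" "X \<subseteq> span B" "card B = dim X"
    using basis_exists[of X] by blast
  have fB: "finite B" using B(2) independent_imp_finite by blast
  have spanB: "span B = span X" using B span_mono[OF B(1)] span_minimal[OF B(3) subspace_span] by blast
  have disj: "B \<inter> S = {}"
  proof (rule ccontr)
    assume "B \<inter> S \<noteq> {}"
    then obtain s where s: "s \<in> B" "s \<in> S" by blast
    have "(\<Sum>x\<in>S. (if x = s then 1 else 0) *\<^sub>R x) = (\<Sum>x\<in>S. if x = s then x else 0)"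
      by (rule sum.cong) auto
    also have "\<dots> = s" using assms(1) s by simp
    finally have "(\<Sum>x\<in>S. (if x = s then 1 else 0) *\<^sub>R x) \<in> span X" using s(1) B(1) by (auto intro: span_base)
    then show False using assms(2)[of "\<lambda>x. if x = s then 1 else 0"] s by auto
  qed
  have "independent (B \<union> S)"
  proof -
    have "\<forall>v\<in>B \<union> S. d v = 0" if d: "(\<Sum>v\<in>B \<union> S. d v *\<^sub>R v) = 0" for d
    proof -
      have sm: "lincomb d B + lincomb d S = 0"
        using d sum.union_disjoint[OF fB assms(1) disj, of "\<lambda>v. d v *\<^sub>R v"] by simp
      have "lincomb d B \<in> span X" using B(1) by (intro span_sum span_scale span_base) auto
      then have "- lincomb d B \<in> span X" by (rule span_neg)
      moreover have "- lincomb d B = lincomb d S" using sm by (simp only: neg_eq_iff_add_eq_0)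
      ultimately have "lincomb d S \<in> span X" by (simp only:)
      then have dS: "\<forall>v\<in>S. d v = 0" by (rule assms(2))
      then have "lincomb d B = 0" using sm by simp
      then have "\<forall>v\<in>B. d v = 0" using B(2) fB by (auto simp: dependent_finite)
      with dS show ?thesis by blast
    qed
    then show ?thesis using fB assms(1) by (auto simp: dependent_finite)
  qed
  then have "card (B \<union> S) = dim (B \<union> S)" by (simp add: dim_eq_card_independent)
  also have "\<dots> \<le> dim (X \<union> S)" using B(1) by (intro dim_subset) auto
  finally show ?thesis using card_Un_disjoint[OF fB assms(1) disj] B(4) by simp
qed

text \<open>Modulo \<open>span X\<close> the vector u vanishes, so for p outside
  \<open>span X\<close> the vector \<open>- (c p *\<^sub>R p)\<close> is a positive combination of
  \<open>V - {p}\<close>. A support \<open>S\<close> independent modulo \<open>span X\<close> yields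
  a point y of \<open>span X\<close> interior to the cone over \<open>{p} \<union> S\<close>, which
  can be absorbed. At most \<open>card S + 1\<close> new points gain at least \<open>card S\<close>
  dimensions; as \<open>S\<close> is nonempty, the price is at most two points per
  dimension.\<close>

lemma steinitz_step:
  fixes V X :: "'a::euclidean_space set"
  assumes "finite V" "X \<subseteq> V" "u \<in> pos_comb V" "u \<in> pos_comb X" "span V = UNIV" "span X \<noteq> UNIV"
  obtains Y where "X \<subseteq> Y" "Y \<subseteq> V" "u \<in> pos_comb Y" "dim X < dim Y" "card Y + 2 * dim X \<le> card X + 2 * dim Y"
proof -
  have fX: "finite X" using assms(1,2) finite_subset by blast
  obtain p where p: "p \<in> V" "p \<notin> span X"
  proof (rule ccontr)
    assume "\<not> thesis"
    then have "V \<subseteq> span X" using that by blast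
    then have "span V \<subseteq> span X" by (simp add: span_minimal)
    with assms show False by auto
  qed
  obtain c where c: "\<And>a. a \<in> V \<Longrightarrow> 0 < c a" "u = lincomb c V" using assms(3) unfolding pos_comb_def by blast
  have u: "u = c p *\<^sub>R p + lincomb c (V - {p})"
    unfolding c(2) using assms(1) p(1) by (rule sum.remove)
  have "u \<in> span X" using assms(4) by (rule pos_comb_in_span)
  then have "- u \<in> span X" by (rule span_neg)
  then have "- (c p *\<^sub>R p) - lincomb c (V - {p}) \<in> span X"
    unfolding u by simp
  then obtain S c' where S: "S \<subseteq> V - {p}" "\<forall>x\<in>S. 0 < c' x"
      "- (c p *\<^sub>R p) - lincomb c' S \<in> span X"
      "\<forall>d. lincomb d S \<in> span X \<longrightarrow> (\<forall>x\<in>S. d x = 0)"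
    using caratheodory_modulo[of "V - {p}" "span X" c "- (c p *\<^sub>R p)"] assms(1) c(1) by (auto simp: subspace_span)
  have fS: "finite S" using S(1) assms(1) by (meson finite_Diff finite_subset)
  have S0: "S \<noteq> {}"
  proof
    assume "S = {}"
    then have "- (c p *\<^sub>R p) \<in> span X" using S(3) by simp
    then have "(- 1 / c p) *\<^sub>R (- (c p *\<^sub>R p)) \<in> span X" by (rule span_scale)
    then show False using p c(1)[of p] by simp
  qed
  define y where "y = c p *\<^sub>R p + lincomb c' S"
  have y1: "y \<in> pos_comb ({p} \<union> S)"
    unfolding y_def using fS S(2) c(1)[OF p(1)] by (intro pos_comb_Un pos_comb_singleton pos_combI[of S c']) auto
  have "- (- (c p *\<^sub>R p) - lincomb c' S) \<in> span X" using S(3) by (rule span_neg)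
  then have y2: "y \<in> span X" by (simp add: y_def add.commute)
  define Y where "Y = X \<union> ({p} \<union> S)"
  have "u \<in> pos_comb Y" unfolding Y_def using fS
    by (intro pos_comb_insert_span[OF fX assms(4) _ y1 y2]) auto
  moreover have "dim X + card S \<le> dim (X \<union> S)" using fS S(4) by (intro dim_Un_independent_modulo) auto
  moreover have "dim (X \<union> S) \<le> dim Y" unfolding Y_def by (intro dim_subset) auto
  moreover have "card Y \<le> card X + (1 + card S)"
    unfolding Y_def by (rule order.trans[OF card_Un_le]) (use card_Un_le[of "{p}" S] in auto)
  moreover have "card S \<ge> 1" using S0 fS by (simp add: Suc_leI card_gt_0_iff)
  ultimately show ?thesis using p(1) S(1) assms(2)
    by (intro that[of Y]) (auto simp: Y_def)
qed

text \<open>For independent \<open>X\<close> the bound reads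
  \<open>card Y \<le> 2 * DIM('a) - card X\<close>, so every point of the initial support saves one
  over the classical factor two.\<close>

lemma steinitz:
  fixes V X :: "'a::euclidean_space set"
  assumes "finite V" "X \<subseteq> V" "u \<in> pos_comb V" "u \<in> pos_comb X" "span V = UNIV"
  shows "\<exists>Y. X \<subseteq> Y \<and> Y \<subseteq> V \<and> u \<in> pos_comb Y \<and> span Y = UNIV \<and> card Y + 2 * dim X \<le> card X + 2 * DIM('a)"
  using assms(2,4)
proof (induction "DIM('a) - dim X" arbitrary: X rule: less_induct)
  case less
  show ?case
  proof (cases "span X = UNIV")
    case True
    then have "dim X = DIM('a)" by (metis dim_UNIV dim_span)
    then show ?thesis using less.prems True by auto
  next
    case False
    obtain Y where Y: "X \<subseteq> Y" "Y \<subseteq> V" "u \<in> pos_comb Y" "dim X < dim Y" "card Y + 2 * dim X \<le> card X + 2 * dim Y"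
      using steinitz_step[OF assms(1) less.prems(1) assms(3) less.prems(2) assms(5) False] .
    have "dim Y \<le> DIM('a)" by (rule dim_subset_UNIV)
    then have "DIM('a) - dim Y < DIM('a) - dim X" using Y(4) by linarith
    from less.hyps[OF this Y(2,3)] obtain Z where "Y \<subseteq> Z" "Z \<subseteq> V" "u \<in> pos_comb Z" "span Z = UNIV"
      "card Z + 2 * dim Y \<le> card Y + 2 * DIM('a)" by blast
    then show ?thesis using Y by (intro exI[of _ Z]) auto
  qed
qed

section \<open>Minimal frames in a graded lattice\<close>

lemma pos_comb_mono_span:
  assumes "finite B" "A \<subseteq> B" "B \<subseteq> span A"
  shows "pos_comb A \<subseteq> pos_comb B"
proof
  fix x assume x: "x \<in> pos_comb A"
  have "x \<in> pos_comb (A \<union> B)"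
  proof (rule pos_comb_insert_span[OF _ x assms(1) sum_in_pos_comb])
    show "finite A" using assms finite_subset by blast
    show "(\<Sum>a\<in>B. a) \<in> span A" using assms(3) by (intro span_sum) auto
  qed
  moreover have "A \<union> B = B" using assms(2) by blast
  ultimately show "x \<in> pos_comb B" by simp
qed

lemma span_eq_UNIV_if: "span V = UNIV \<Longrightarrow> V \<subseteq> span A \<Longrightarrow> span A = UNIV"
  by (metis span_minimal subspace_span top.extremum_uniqueI)

lemma independent_coeffs_unique:
  fixes B :: "'a::real_vector set"
  assumes "independent B" "finite B" "lincomb c B = lincomb d B" "b \<in> B"
  shows "c b = d b"
proof -
  have "(\<Sum>b\<in>B. (c b - d b) *\<^sub>R b) = 0"
    using assms(3) by (simp add: scaleR_left_diff_distrib sum_subtractf)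
  then have "c b - d b = 0" by (rule independentD[OF assms(1,2) subset_refl _ assms(4)])
  then show ?thesis by simp
qed

lemma independent_spanning_card:
  fixes B :: "'a::euclidean_space set"
  assumes "independent B" "span B = UNIV" shows "card B = DIM('a)"
  by (metis assms dim_UNIV dim_eq_card_independent dim_span)

lemma independent_card_DIM_spanning:
  fixes B :: "'a::euclidean_space set"
  assumes "independent B" "card B = DIM('a)" shows "span B = UNIV"
  by (metis assms dim_eq_card_independent dim_eq_full)

lemma dependent_spanning_card:
  fixes V :: "'a::euclidean_space set"
  assumes "finite V" "span V = UNIV" "dependent V" shows "DIM('a) < card V"
proof -
  have "dim V = DIM('a)" using assms(2) dim_eq_full by blast
  then have "DIM('a) \<le> card V" using dim_le_card'[OF assms(1)] by simp
  moreover have "card V \<noteq> DIM('a)"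
    using card_le_dim_spanning[of V UNIV] assms by auto
  ultimately show ?thesis by simp
qed

text \<open>An abstract form of Z^n x Z with its last coordinate: a subgroup that is discrete by
  \<open>finite_L_bounded\<close>, with a linear degree that is integral on it.\<close>

locale graded_lattice =
  fixes L :: "'a::euclidean_space set" and ht :: "'a \<Rightarrow> real"
  assumes zero_L: "0 \<in> L"
    and add_L: "x \<in> L \<Longrightarrow> y \<in> L \<Longrightarrow> x + y \<in> L"
    and minus_L: "x \<in> L \<Longrightarrow> - x \<in> L"
    and linear_ht: "linear ht"
    and ht_Ints: "x \<in> L \<Longrightarrow> ht x \<in> \<int>"
    and finite_L_bounded: "bounded S \<Longrightarrow> finite (L \<inter> S)"
begin

lemma diff_L: "x \<in> L \<Longrightarrow> y \<in> L \<Longrightarrow> x - y \<in> L"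
  using add_L[of x "- y"] minus_L by simp

lemma sum_L: "(\<And>i. i \<in> I \<Longrightarrow> f i \<in> L) \<Longrightarrow> sum f I \<in> L"
  by (induction I rule: infinite_finite_induct) (auto intro: add_L zero_L)

lemma ht_simps [simp]: "ht (x + y) = ht x + ht y" "ht (x - y) = ht x - ht y" "ht 0 = 0" "ht (- x) = - ht x"
  "ht (t *\<^sub>R x) = t * ht x" "ht (sum f I) = (\<Sum>i\<in>I. ht (f i))"
  using linear_ht by (simp_all add: linear_add linear_diff linear_0 linear_neg linear_cmul linear_sum)

lemma ht_nonneg_comb:
  assumes "\<And>a. a \<in> A \<Longrightarrow> ht a = 1" "x \<in> nonneg_comb A" shows "0 \<le> ht x"
proof -
  obtain c where c: "\<And>a. a \<in> A \<Longrightarrow> 0 \<le> c a" "x = lincomb c A" using assms(2) unfolding nonneg_comb_def by blast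
  show ?thesis unfolding c(2) using c(1) assms(1) by (simp add: sum_nonneg)
qed

lemma ht_0_nonneg_comb:
  assumes "\<And>a. a \<in> A \<Longrightarrow> ht a = 1" "x \<in> nonneg_comb A" "ht x = 0" "finite A" shows "x = 0"
proof -
  obtain c where c: "\<And>a. a \<in> A \<Longrightarrow> 0 \<le> c a" "x = lincomb c A" using assms(2) unfolding nonneg_comb_def by blast
  have "sum c A = 0" using assms(3) unfolding c(2) using assms(1) by simp
  then have "\<forall>a\<in>A. c a = 0" using c(1) assms(4) by (simp add: sum_nonneg_eq_0_iff)
  then show ?thesis unfolding c(2) by simp
qed

text \<open>To keep y in the support, the linear relation is oriented so that its entry at y is not
  positive; the weight of y then never decreases. As all heights are 1, the entries of a relation
  sum to 0, so a positive entry remains for the ratio test.\<close>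

lemma caratheodory_through:
  assumes "finite X" "\<And>x. x \<in> X \<Longrightarrow> ht x = 1" "y \<in> X" "u \<in> pos_comb X"
  shows "\<exists>S\<subseteq>X. y \<in> S \<and> independent S \<and> u \<in> pos_comb S"
  using assms
proof (induction X rule: finite_psubset_induct)
  case (psubset X)
  show ?case
  proof (cases "independent X")
    case True then show ?thesis using psubset.prems by blast
  next
    case False
    then obtain d0 v0 where d0: "lincomb d0 X = 0" "v0 \<in> X" "d0 v0 \<noteq> 0"
      using dependent_finite[OF psubset.hyps(1)] by blast
    define d where "d = (if d0 y \<le> 0 then d0 else (\<lambda>x. - d0 x))"
    have d: "lincomb d X = 0" "d v0 \<noteq> 0" "d y \<le> 0"
      using d0 by (auto simp: d_def sum_negf)
    have "sum d X = ht (lincomb d X)" using psubset.prems(1) by simp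
    then have sd: "sum d X = 0" using d(1) by simp
    have "\<exists>x\<in>X. 0 < d x"
    proof (rule ccontr)
      assume "\<not> ?thesis"
      then have "\<And>x. x \<in> X \<Longrightarrow> 0 \<le> - d x" by (simp add: not_less)
      moreover have "(\<Sum>x\<in>X. - d x) = 0" using sd by (simp add: sum_negf)
      ultimately have "\<forall>x\<in>X. - d x = 0" using psubset.hyps(1) sum_nonneg_eq_0_iff[of X "\<lambda>x. - d x"] by blast
      then show False using d(2) d0(2) by auto
    qed
    then obtain x0 where x0: "x0 \<in> X" "0 < d x0" by blast
    obtain c where c: "\<And>a. a \<in> X \<Longrightarrow> 0 < c a" "u = lincomb c X" using psubset.prems(3) unfolding pos_comb_def by blast
    obtain t where t: "\<And>x. x \<in> X \<Longrightarrow> 0 \<le> c x - t * d x" "\<exists>x\<in>X. c x - t * d x = 0" "0 < t"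
      using caratheodory_step[of X c x0 d, OF psubset.hyps(1) c(1) x0] by blast
    define c' where "c' x = c x - t * d x" for x
    define Y where "Y = {x\<in>X. 0 < c' x}"
    obtain x1 where "x1 \<in> X" "c' x1 = 0" using t(2) by (auto simp: c'_def)
    then have "x1 \<in> X - Y" by (simp add: Y_def)
    then have YX: "Y \<subset> X" by (auto simp: Y_def)
    have "t * d y \<le> 0" using t(3) d(3) by (simp add: mult_nonneg_nonpos)
    then have "0 < c' y" using c(1)[OF psubset.prems(2)] by (simp add: c'_def)
    then have yY: "y \<in> Y" using psubset.prems(2) by (simp add: Y_def)
    have "u = u - t *\<^sub>R (lincomb d X)" using d(1) by simp
    also have "\<dots> = lincomb c' X"
      unfolding c(2) by (simp add: c'_def scaleR_left_diff_distrib sum_subtractf scaleR_sum_right)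
    also have "\<dots> = lincomb c' Y"
      unfolding Y_def using t(1) by (intro nonneg_comb_drop_zeros psubset.hyps) (auto simp: c'_def)
    finally have "u \<in> pos_comb Y" by (intro pos_combI[of Y c']) (auto simp: Y_def)
    then obtain S where "S \<subseteq> Y" "y \<in> S" "independent S" "u \<in> pos_comb S"
      using psubset.IH[OF YX] psubset.prems(1) yY YX by blast
    then show ?thesis using YX by blast
  qed
qed

end

text \<open>The cone over a minimal Gorenstein polytope of degree 2: \<open>Q\<close> its lattice
  points and \<open>V\<close> its vertices, all at height 1. Since \<open>DIM('a)\<close> is n + 1,
  \<open>ht_u\<close> says r = n - 1; \<open>shift\<close> is the Gorenstein property, and
  \<open>minimal\<close> is the form in which minimality enters.\<close>

locale minimal_frame = graded_lattice +
  fixes Q V :: "'a::euclidean_space set" and u :: 'a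
  assumes finite_Q: "finite Q" and Q_L: "Q \<subseteq> L" and ht_Q: "q \<in> Q \<Longrightarrow> ht q = 1"
    and Q_all: "x \<in> L \<Longrightarrow> x \<in> nonneg_comb Q \<Longrightarrow> ht x = 1 \<Longrightarrow> x \<in> Q"
    and u_Q: "u \<in> pos_comb Q" and u_L: "u \<in> L" and ht_u: "ht u = real DIM('a) - 2"
    and shift: "x \<in> L \<Longrightarrow> x \<in> pos_comb Q \<Longrightarrow> x - u \<in> nonneg_comb Q"
    and V_Q: "V \<subseteq> Q" and u_V: "u \<in> pos_comb V" and span_V: "span V = UNIV"
    and Q_V: "Q \<subseteq> nonneg_comb V"
    and minimal: "A \<subseteq> Q \<Longrightarrow> u \<in> pos_comb A \<Longrightarrow> span A = UNIV \<Longrightarrow> V \<subseteq> A"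
begin

section \<open>Coefficients of the interior point \<open>u\<close>\<close>

lemma finite_V: "finite V" using V_Q finite_Q finite_subset by blast

lemma exchange: "A \<subseteq> Q \<Longrightarrow> u \<in> pos_comb A \<Longrightarrow> V \<subseteq> span A \<Longrightarrow> V \<subseteq> A"
  using minimal span_eq_UNIV_if span_V by blast

text \<open>For t > 1 the point \<open>u - q\<close> is a convex combination of u and
  \<open>u - t *\<^sub>R q\<close> with positive weight on u, hence an interior lattice point lower
  than u, against \<open>shift\<close>.\<close>

lemma coeff_le_1:
  assumes "q \<in> Q" "u - t *\<^sub>R q \<in> nonneg_comb Q" shows "t \<le> 1"
proof (rule ccontr)
  assume "\<not> t \<le> 1"
  then have t: "t > 1" by simp
  have "(1 - 1/t) *\<^sub>R u + (1/t) *\<^sub>R (u - t *\<^sub>R q) \<in> pos_comb Q"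
    using t u_Q assms(2) by (intro pos_comb_add_nonneg pos_comb_scale nonneg_comb_scale) auto
  moreover have "(1 - 1/t) *\<^sub>R u + (1/t) *\<^sub>R (u - t *\<^sub>R q) = u - q"
    using t by (simp add: algebra_simps)
  ultimately have "u - q - u \<in> nonneg_comb Q" using assms(1) Q_L u_L by (intro shift diff_L) auto
  then have "0 \<le> ht (u - q - u)" using ht_nonneg_comb ht_Q by blast
  then show False using ht_Q[OF assms(1)] by simp
qed

lemma coeff_le_1':
  assumes "X \<subseteq> Q" "\<And>x. x \<in> X \<Longrightarrow> 0 \<le> c x" "u = lincomb c X" "x \<in> X"
  shows "c x \<le> 1"
proof (rule coeff_le_1)
  have fX: "finite X" using assms(1) finite_Q finite_subset by blast
  show "x \<in> Q" using assms by blast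
  have "u - c x *\<^sub>R x = lincomb c (X - {x})"
    unfolding assms(3) using sum.remove[OF fX assms(4), of "\<lambda>x. c x *\<^sub>R x"] by simp
  also have "\<dots> \<in> nonneg_comb Q"
    using assms(1,2) finite_Q by (intro nonneg_comb_sum nonneg_comb_scale nonneg_comb_base) auto
  finally show "u - c x *\<^sub>R x \<in> nonneg_comb Q" .
qed

text \<open>The coefficients of u sum to its height \<open>DIM('a) - 2\<close>, and none exceeds
  1.\<close>

lemma card_ge:
  assumes "X \<subseteq> Q" "u \<in> pos_comb X" shows "DIM('a) \<le> card X + 2"
proof -
  obtain c where c: "\<And>a. a \<in> X \<Longrightarrow> 0 < c a" "u = lincomb c X" using assms(2) unfolding pos_comb_def by blast
  have "real DIM('a) - 2 = sum c X" using ht_u assms(1) ht_Q unfolding c(2) by (simp add: subset_iff)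
  also have "\<dots> \<le> (\<Sum>x\<in>X. 1)" using coeff_le_1'[OF assms(1) _ c(2)] c(1) by (intro sum_mono) (auto intro: less_imp_le)
  finally show ?thesis by simp
qed

text \<open>Steinitz's theorem started at \<open>X\<close> returns a spanning subset of
  \<open>V\<close> with u in its interior cone, and minimality makes that subset all of
  \<open>V\<close>.\<close>

lemma card_V_le:
  assumes "X \<subseteq> V" "independent X" "u \<in> pos_comb X" shows "card V + card X \<le> 2 * DIM('a)"
proof -
  obtain Y where Y: "X \<subseteq> Y" "Y \<subseteq> V" "u \<in> pos_comb Y" "span Y = UNIV" "card Y + 2 * dim X \<le> card X + 2 * DIM('a)"
    using steinitz[OF finite_V assms(1) u_V assms(3) span_V] by blast
  then have "V = Y" using minimal[of Y] V_Q by blast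
  then show ?thesis using Y(5) dim_eq_card_independent[OF assms(2)] by simp
qed

section \<open>Lattice points of height 1 that are not vertices\<close>

lemma lattice_pos_zero:
  assumes "w \<in> L" "w \<in> pos_comb Q" "ht w = real DIM('a) - 2" shows "w = u"
proof -
  have "w - u \<in> nonneg_comb Q" using assms by (intro shift)
  then have "w - u = 0" using ht_0_nonneg_comb[of Q "w - u", OF ht_Q] assms(3) ht_u finite_Q by simp
  then show ?thesis by simp
qed

text \<open>The exceptional position of z: on a lattice triangle with vertex set \<open>S\<close>,
  and completed to u by the remaining vertices. The bound \<open>f b < 1\<close> makes
  \<open>S\<close> recoverable when \<open>V\<close> is independent, as the set of vertices where
  the coefficient of u is not 1.\<close>

definition special :: "'a set \<Rightarrow> ('a \<Rightarrow> real) \<Rightarrow> 'a \<Rightarrow> bool" where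
  "special S f z \<longleftrightarrow> S \<subseteq> V \<and> card S = 3 \<and> (\<forall>b\<in>S. f b < 1) \<and> z = lincomb f S \<and> u = z + (\<Sum>b\<in>V - S. b)"

text \<open>Let z have the independent support S, extended to a basis B inside \<open>V\<close>.
  Adding the elements of \<open>B - S\<close> to z gives an interior lattice point w of height
  \<open>1 + DIM('a) - card S\<close>, and no such point lies below \<open>DIM('a) - 2\<close>;
  hence \<open>card S \<le> 3\<close>. Equality makes w equal to u, and then minimality makes B
  equal to \<open>V\<close>.\<close>

lemma edge_or_special:
  assumes "z \<in> Q" "z \<notin> V"
  shows "(\<exists>y\<in>V. \<exists>y'\<in>V. \<exists>f. y \<noteq> y' \<and> 0 < f \<and> f < 1 \<and> z = f *\<^sub>R y + (1 - f) *\<^sub>R y') \<or>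
    (independent V \<and> (\<exists>S f. special S f z))"
proof -
  have "z \<in> nonneg_comb V" using assms Q_V by blast
  then obtain S where S: "S \<subseteq> V" "independent S" "z \<in> pos_comb S" using caratheodory_cone[OF finite_V] by blast
  have fS: "finite S" using S(1) finite_V finite_subset by blast
  obtain f where f: "\<And>a. a \<in> S \<Longrightarrow> 0 < f a" "z = lincomb f S" using S(3) unfolding pos_comb_def by blast
  have htS: "\<And>a. a \<in> S \<Longrightarrow> ht a = 1" using S(1) V_Q ht_Q by blast
  have "sum f S = ht z" unfolding f(2) using htS by simp
  then have sf: "sum f S = 1" using ht_Q assms by simp
  have f1: "f b < 1" if b: "b \<in> S" for b
  proof (rule ccontr)
    assume "\<not> f b < 1"
    moreover have s: "sum f S = f b + sum f (S - {b})" by (rule sum.remove[OF fS b])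
    moreover have "0 \<le> sum f (S - {b})" using f(1) by (intro sum_nonneg) (auto intro: less_imp_le)
    ultimately have s0: "sum f (S - {b}) = 0" "f b = 1" using sf by linarith+
    have "S - {b} = {}"
    proof (rule ccontr)
      assume "S - {b} \<noteq> {}"
      then have "0 < sum f (S - {b})" using f(1) fS by (intro sum_pos) auto
      then show False using s0 by simp
    qed
    then have "S = {b}" using b by blast
    then have "z = b" using f(2) s0(2) by simp
    then show False using b S(1) assms(2) by blast
  qed
  obtain B where B: "S \<subseteq> B" "B \<subseteq> V" "independent B" "V \<subseteq> span B"
    using maximal_independent_subset_extend[OF S(1,2)] by blast
  have spB: "span B = UNIV" using span_eq_UNIV_if[OF span_V B(4)] .
  have fB: "finite B" using B(2) finite_V finite_subset by blast
  have cB: "card B = DIM('a)" by (rule independent_spanning_card[OF B(3) spB])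
  define w where "w = z + (\<Sum>b\<in>B - S. b)"
  have wB: "w \<in> pos_comb B"
  proof -
    have "w \<in> pos_comb (S \<union> (B - S))" unfolding w_def using fS fB S(3) sum_in_pos_comb by (intro pos_comb_Un) auto
    moreover have "S \<union> (B - S) = B" using B(1) by blast
    ultimately show ?thesis by simp
  qed
  then have wQ: "w \<in> pos_comb Q" using pos_comb_mono_span[OF finite_Q, of B] B(2) V_Q spB by auto
  have wL: "w \<in> L" unfolding w_def using assms Q_L V_Q B(2) by (intro add_L sum_L) auto
  have htB: "\<And>a. a \<in> B \<Longrightarrow> ht a = 1" using B(2) V_Q ht_Q by blast
  have cS: "card S \<le> card B" using B(1) fB by (simp add: card_mono)
  have "card (B - S) = card B - card S" using B(1) fS by (simp add: card_Diff_subset)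
  then have htw: "ht w = 1 + real DIM('a) - real (card S)"
    unfolding w_def using htB ht_Q[OF assms(1)] cB cS by (simp add: of_nat_diff)
  have "0 \<le> ht (w - u)" using shift[OF wL wQ] ht_nonneg_comb ht_Q by blast
  then have c3: "card S \<le> 3" using htw ht_u by simp
  have "S \<noteq> {}" using sf by auto
  moreover have "card S \<noteq> 1"
  proof
    assume "card S = 1"
    then obtain b where "S = {b}" using card_1_singletonE by blast
    then show False using sf f1 by auto
  qed
  moreover have "card S \<noteq> 0" using \<open>S \<noteq> {}\<close> fS by simp
  ultimately have "card S = 2 \<or> card S = 3" using c3 by linarith
  then show ?thesis
  proof
    assume "card S = 2"
    then obtain y y' where y: "S = {y, y'}" "y \<noteq> y'" by (auto simp: card_2_iff)
    have "f y' = 1 - f y" using sf y by simp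
    then have "z = f y *\<^sub>R y + (1 - f y) *\<^sub>R y'" using f(2) y by simp
    moreover have "0 < f y" "f y < 1" using f(1) f1 y by auto
    ultimately show ?thesis using y S(1) by blast
  next
    assume c3: "card S = 3"
    then have wu: "w = u" using htw wL wQ by (intro lattice_pos_zero) auto
    then have "u \<in> pos_comb B" using wB by simp
    then have BV: "B = V" using minimal[of B] B(2) V_Q spB by blast
    have "special S f z" unfolding special_def using S(1) c3 f1 f(2) wu BV by (auto simp: w_def)
    then show ?thesis using B(3) BV by blast
  qed
qed

text \<open>Reflection of z in the middle of the edge gives a second lattice point z' with
  \<open>z + z' = y + y'\<close>. The smaller weight \<open>\<nu> y\<close> moves from y and y' to z
  and z', so that y leaves the support. For \<open>f \<noteq> 1/2\<close> the points z and z' still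
  span the edge, and minimality is violated.\<close>

lemma edge_midpoint_aux:
  assumes "y \<in> V" "y' \<in> V" "y \<noteq> y'" "0 < f" "f < 1" "f *\<^sub>R y + (1 - f) *\<^sub>R y' \<in> Q" "f \<noteq> 1/2"
    and \<nu>: "\<And>v. v \<in> V \<Longrightarrow> 0 < \<nu> v" "u = lincomb \<nu> V" "\<nu> y \<le> \<nu> y'"
  shows False
proof -
  define z where "z = f *\<^sub>R y + (1 - f) *\<^sub>R y'"
  define z' where "z' = (1 - f) *\<^sub>R y + f *\<^sub>R y'"
  have zz: "z + z' = y + y'" unfolding z_def z'_def by (simp add: algebra_simps)
  have yQ: "y \<in> Q" "y' \<in> Q" using assms V_Q by auto
  have zQ: "z \<in> Q" using assms(6) by (simp add: z_def)
  have z'Q: "z' \<in> Q"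
  proof (rule Q_all)
    have "z' = y + y' - z" using zz by (simp add: algebra_simps)
    moreover have "y \<in> L" "y' \<in> L" "z \<in> L" using yQ zQ Q_L by auto
    ultimately show "z' \<in> L" using add_L diff_L by simp
    show "z' \<in> nonneg_comb Q" unfolding z'_def using assms(4,5) yQ finite_Q
      by (intro nonneg_comb_add nonneg_comb_scale nonneg_comb_base) auto
    show "ht z' = 1" unfolding z'_def using ht_Q yQ by simp
  qed
  define R where "R = V - {y, y'}"
  have VR: "V = insert y (insert y' R)" "y \<notin> insert y' R" "y' \<notin> R" using assms by (auto simp: R_def)
  have fR: "finite R" using finite_V by (simp add: R_def)
  have "u = \<nu> y *\<^sub>R y + (\<nu> y' *\<^sub>R y' + lincomb \<nu> R)"
    unfolding \<nu>(2) using VR fR by (simp add: VR(1))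
  also have "\<dots> = lincomb \<nu> R + \<nu> y *\<^sub>R (y + y') + (\<nu> y' - \<nu> y) *\<^sub>R y'" by (simp add: algebra_simps)
  also have "\<dots> = lincomb \<nu> R + \<nu> y *\<^sub>R z + \<nu> y *\<^sub>R z' + (\<nu> y' - \<nu> y) *\<^sub>R y'" by (simp add: algebra_simps flip: zz)
  finally have u: "u = lincomb \<nu> R + \<nu> y *\<^sub>R z + \<nu> y *\<^sub>R z' + (\<nu> y' - \<nu> y) *\<^sub>R y'" .
  let ?A = "R \<union> {z} \<union> {z'}"
  have pA: "lincomb \<nu> R + \<nu> y *\<^sub>R z + \<nu> y *\<^sub>R z' \<in> pos_comb ?A"
    using fR \<nu>(1) assms(1) by (intro pos_comb_Un pos_comb_singleton pos_combI[of R \<nu>]) (auto simp: R_def)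
  have spany: "y \<in> span ?A"
  proof -
    have g: "2 * f - 1 \<noteq> 0" using assms(7) by simp
    \<comment> \<open>The combination of z and z' in which y' cancels; its factor is nonzero exactly
      because z is not the midpoint.\<close>
    have "(2 * f - 1) *\<^sub>R y = f *\<^sub>R y + f *\<^sub>R y - y"
      by (simp only: mult_2 scaleR_left_distrib scaleR_left_diff_distrib scaleR_one)
    also have "\<dots> = f *\<^sub>R z - (1 - f) *\<^sub>R z'" unfolding z_def z'_def by (simp add: algebra_simps)
    also have "\<dots> \<in> span ?A" by (intro span_diff span_scale span_base) auto
    finally have "(1 / (2 * f - 1)) *\<^sub>R ((2 * f - 1) *\<^sub>R y) \<in> span ?A" by (rule span_scale)
    then show ?thesis using g by simp
  qed
  have spany': "y' \<in> span ?A"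
  proof -
    have "z + z' - y \<in> span ?A" by (rule span_diff[OF _ spany], intro span_add span_base) auto
    then show ?thesis by (simp add: zz)
  qed
  have VA: "V \<subseteq> span ?A" using spany spany' by (auto simp: VR(1) intro: span_base)
  have AQ: "?A \<subseteq> Q" using V_Q zQ z'Q by (auto simp: R_def)
  have yz: "y \<noteq> z" "y \<noteq> z'"
  proof -
    have "y - z = (1 - f) *\<^sub>R (y - y')" "y - z' = f *\<^sub>R (y - y')" unfolding z_def z'_def by (simp_all add: algebra_simps)
    then show "y \<noteq> z" "y \<noteq> z'" using assms(3-5) by auto
  qed
  show False
  proof (cases "\<nu> y = \<nu> y'")
    case True
    then have "u \<in> pos_comb ?A" using pA u by simp
    then have "V \<subseteq> ?A" using exchange AQ VA by blast
    then show False using assms(1) yz by (auto simp: R_def)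
  next
    case False
    then have "u \<in> pos_comb (?A \<union> {y'})" unfolding u using fR \<nu>(3)
      by (intro pos_comb_Un[OF _ _ pA] pos_comb_singleton) auto
    then have "V \<subseteq> ?A \<union> {y'}" using exchange[of "?A \<union> {y'}"] AQ VA yQ span_mono[of ?A "?A \<union> {y'}"] by blast
    then show False using assms(1,3) yz by (auto simp: R_def)
  qed
qed

lemma edge_midpoint:
  assumes "y \<in> V" "y' \<in> V" "y \<noteq> y'" "0 < f" "f < 1" "f *\<^sub>R y + (1 - f) *\<^sub>R y' \<in> Q"
  shows "f = 1/2"
proof (rule ccontr)
  assume nf: "f \<noteq> 1/2"
  obtain \<nu> where \<nu>: "\<And>v. v \<in> V \<Longrightarrow> 0 < \<nu> v" "u = lincomb \<nu> V" using u_V unfolding pos_comb_def by blast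
  show False
  proof (cases "\<nu> y \<le> \<nu> y'")
    case True
    then show False using edge_midpoint_aux[OF assms nf \<nu>] by simp
  next
    case False
    have "(1 - f) *\<^sub>R y' + (1 - (1 - f)) *\<^sub>R y \<in> Q" using assms(6) by (simp add: add.commute)
    then show False using edge_midpoint_aux[of y' y "1 - f" \<nu>] assms nf \<nu> False by auto
  qed
qed

section \<open>Midpoints of two vertices\<close>

definition midpoint_of :: "'a \<Rightarrow> 'a \<Rightarrow> 'a \<Rightarrow> bool" where
  "midpoint_of y y' z \<longleftrightarrow> y \<in> V \<and> y' \<in> V \<and> y \<noteq> y' \<and> z = (1/2) *\<^sub>R (y + y') \<and> z \<in> Q"

lemma midpoint_or_special:
  assumes "z \<in> Q" "z \<notin> V"
  shows "(\<exists>y y'. midpoint_of y y' z) \<or> (independent V \<and> (\<exists>S f. special S f z))"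
  using edge_or_special[OF assms]
proof
  assume "\<exists>y\<in>V. \<exists>y'\<in>V. \<exists>f. y \<noteq> y' \<and> 0 < f \<and> f < 1 \<and> z = f *\<^sub>R y + (1 - f) *\<^sub>R y'"
  then obtain y y' f where y: "y \<in> V" "y' \<in> V" "y \<noteq> y'" "0 < f" "f < 1" "z = f *\<^sub>R y + (1 - f) *\<^sub>R y'" by blast
  then have f: "f = 1/2" using edge_midpoint[of y y' f] assms by blast
  have "z = (1/2) *\<^sub>R (y + y')" using y(6) unfolding f by (simp add: scaleR_right_distrib)
  then show ?thesis unfolding midpoint_of_def using y assms by blast
qed blast

text \<open>If y had the smaller weight, the midpoint z could take over all of it, with y' keeping
  the excess. Then y leaves the support, although \<open>2 *\<^sub>R z - y'\<close> still recovers
  it in the span.\<close>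

lemma midpoint_coeff_aux:
  assumes "y \<in> V" "y' \<in> V" "y \<noteq> y'" "(1/2) *\<^sub>R (y + y') \<in> Q"
    and \<nu>: "\<And>v. v \<in> V \<Longrightarrow> 0 < \<nu> v" "u = lincomb \<nu> V"
  shows "\<nu> y' \<le> \<nu> y"
proof (rule ccontr)
  assume less: "\<not> \<nu> y' \<le> \<nu> y"
  define z where "z = (1/2) *\<^sub>R (y + y')"
  have zz: "2 *\<^sub>R z = y + y'" unfolding z_def by simp
  have zQ: "z \<in> Q" using assms(4) by (simp add: z_def)
  define R where "R = V - {y, y'}"
  have VR: "V = insert y (insert y' R)" "y \<notin> insert y' R" "y' \<notin> R" using assms by (auto simp: R_def)
  have fR: "finite R" using finite_V by (simp add: R_def)
  have "u = \<nu> y *\<^sub>R y + (\<nu> y' *\<^sub>R y' + lincomb \<nu> R)"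
    unfolding \<nu>(2) using VR fR by (simp add: VR(1))
  also have "\<dots> = lincomb \<nu> R + \<nu> y *\<^sub>R (y + y') + (\<nu> y' - \<nu> y) *\<^sub>R y'" by (simp add: algebra_simps)
  finally have u: "u = lincomb \<nu> R + (\<nu> y * 2) *\<^sub>R z + (\<nu> y' - \<nu> y) *\<^sub>R y'" by (simp flip: zz)
  let ?A = "R \<union> {z} \<union> {y'}"
  have pA: "u \<in> pos_comb ?A"
    unfolding u using fR \<nu>(1) assms(1) less by (intro pos_comb_Un pos_comb_singleton pos_combI[of R \<nu>]) (auto simp: R_def)
  have spany: "y \<in> span ?A"
  proof -
    have "2 *\<^sub>R z - y' \<in> span ?A" by (intro span_diff span_scale span_base) auto
    then show ?thesis by (simp add: zz)
  qed
  have VA: "V \<subseteq> span ?A" using spany by (auto simp: VR(1) intro: span_base)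
  have AQ: "?A \<subseteq> Q" using V_Q zQ assms(2) by (auto simp: R_def)
  have "y \<noteq> z"
  proof
    assume "y = z"
    then have "2 *\<^sub>R y = y + y'" using zz by simp
    then show False using assms(3) by (simp add: scaleR_2)
  qed
  then show False using exchange[OF AQ pA VA] assms(1,3) by (auto simp: R_def)
qed

text \<open>Weights may vanish here, as they do outside a Caratheodory support. The average with a
  strictly positive representation is strictly positive; equality for that representation and for
  the average gives equality for \<nu>.\<close>

lemma midpoint_coeff:
  assumes "y \<in> V" "y' \<in> V" "y \<noteq> y'" "(1/2) *\<^sub>R (y + y') \<in> Q"
    and \<nu>: "\<And>v. v \<in> V \<Longrightarrow> 0 \<le> \<nu> v" "u = lincomb \<nu> V"
  shows "\<nu> y = \<nu> y'"
proof -
  have pos: "\<mu> y = \<mu> y'" if "\<And>v. v \<in> V \<Longrightarrow> 0 < \<mu> v" "u = lincomb \<mu> V" for \<mu>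
    using midpoint_coeff_aux[OF assms(1-4) that] midpoint_coeff_aux[of y' y, OF _ _ _ _ that] assms(1-4)
    by (simp add: add.commute)
  obtain \<mu> where \<mu>: "\<And>v. v \<in> V \<Longrightarrow> 0 < \<mu> v" "u = lincomb \<mu> V" using u_V unfolding pos_comb_def by blast
  have "u = (1/2) *\<^sub>R u + (1/2) *\<^sub>R u" by (simp flip: scaleR_left_distrib)
  also have "\<dots> = (1/2) *\<^sub>R (lincomb \<mu> V) + (1/2) *\<^sub>R (lincomb \<nu> V)" using \<mu>(2) \<nu>(2) by simp
  also have "\<dots> = (\<Sum>v\<in>V. (\<mu> v / 2 + \<nu> v / 2) *\<^sub>R v)"
    by (simp add: scaleR_left_distrib sum.distrib scaleR_sum_right)
  finally have "\<mu> y / 2 + \<nu> y / 2 = \<mu> y' / 2 + \<nu> y' / 2"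
    using \<mu>(1) \<nu>(1) by (intro pos[of "\<lambda>v. \<mu> v / 2 + \<nu> v / 2"]) (auto intro: add_pos_nonneg)
  moreover have "\<mu> y = \<mu> y'" using pos[OF \<mu>] by simp
  ultimately show ?thesis by simp
qed

text \<open>An independent support X of u through y also contains y', with the same weight. It is
  not a basis, since minimality would place the dependent set \<open>V\<close> inside it, so
  \<open>card X \<le> DIM('a) - 1\<close>. The total weight \<open>DIM('a) - 2\<close> then forces
  every coefficient bound to be attained: weight 1 at the midpoint and at each remaining point of X.
  Steinitz's bound from X finally fixes \<open>card V\<close>.\<close>

lemma midpoint_half:
  assumes "dependent V" "y \<in> V" "y' \<in> V" "y \<noteq> y'" "(1/2) *\<^sub>R (y + y') \<in> Q"
  shows "\<exists>X\<subseteq>V. y \<in> X \<and> y' \<in> X \<and> card X + 1 = DIM('a) \<and> card V = DIM('a) + 1 \<and>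
    u = (1/2) *\<^sub>R (y + y') + (\<Sum>x\<in>X - {y, y'}. x)"
proof -
  obtain X where X: "X \<subseteq> V" "y \<in> X" "independent X" "u \<in> pos_comb X"
    using caratheodory_through[OF finite_V ht_Q assms(2) u_V] V_Q by blast
  have fX: "finite X" using X(1) finite_V finite_subset by blast
  obtain c where c: "\<And>a. a \<in> X \<Longrightarrow> 0 < c a" "u = lincomb c X" using X(4) unfolding pos_comb_def by blast
  define \<nu> where "\<nu> v = (if v \<in> X then c v else 0)" for v
  have "u = lincomb \<nu> V"
    unfolding c(2) \<nu>_def using X(1) finite_V by (intro sum.mono_neutral_cong_left) auto
  moreover have "0 \<le> \<nu> v" if "v \<in> V" for v using c(1)[of v] by (auto simp: \<nu>_def)
  ultimately have "\<nu> y = \<nu> y'" by (intro midpoint_coeff[OF assms(2-5)]) auto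
  then have y'X: "y' \<in> X" and cy: "c y' = c y" using c(1)[OF X(2)] X(2) by (auto simp: \<nu>_def split: if_splits)
  define R where "R = X - {y, y'}"
  have XR: "X = insert y (insert y' R)" "y \<notin> insert y' R" "y' \<notin> R" using X(2) y'X assms(4) by (auto simp: R_def)
  have fR: "finite R" using fX by (simp add: R_def)
  have RQ: "R \<subseteq> Q" "X \<subseteq> Q" using X(1) V_Q by (auto simp: R_def)
  have u: "u = c y *\<^sub>R (y + y') + lincomb c R"
    unfolding c(2) using XR fR by (simp add: XR(1) cy algebra_simps)
  have "u - (2 * c y) *\<^sub>R ((1/2) *\<^sub>R (y + y')) = lincomb c R"
    unfolding u by simp
  also have "\<dots> \<in> nonneg_comb Q" using RQ finite_Q c(1)
    by (intro nonneg_comb_sum nonneg_comb_scale nonneg_comb_base) (auto simp: R_def intro: less_imp_le)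
  finally have half: "2 * c y \<le> 1" by (rule coeff_le_1[OF assms(5)])
  have c1: "c x \<le> 1" if "x \<in> R" for x
    using coeff_le_1'[OF RQ(2) less_imp_le[OF c(1)] c(2), of x] that by (auto simp: R_def)
  have "ht u = 2 * c y + sum c R" using RQ ht_Q V_Q assms(2,3) unfolding u by (simp add: subset_iff)
  then have eq: "real DIM('a) - 2 = 2 * c y + sum c R" using ht_u by simp
  have cX: "card X = card R + 2" using XR fR by simp
  have "card X \<noteq> DIM('a)"
  proof
    assume "card X = DIM('a)"
    then have "span X = UNIV" by (rule independent_card_DIM_spanning[OF X(3)])
    then have "V \<subseteq> X" using minimal[OF RQ(2) X(4)] by blast
    then show False using X(1,3) assms(1) by auto
  qed
  moreover have "card X \<le> DIM('a)" using independent_bound_general[OF X(3)] dim_subset_UNIV[of X]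
    dim_eq_card_independent[OF X(3)] by simp
  ultimately have "card R + 3 \<le> DIM('a)" using cX by simp
  moreover have sR: "(\<Sum>x\<in>R. 1 - c x) = real (card R) - sum c R" by (simp add: sum_subtractf)
  moreover have s0: "0 \<le> (\<Sum>x\<in>R. 1 - c x)" using c1 by (intro sum_nonneg) auto
  ultimately have e: "card R + 3 = DIM('a)" "2 * c y = 1" "(\<Sum>x\<in>R. 1 - c x) = 0" using eq half by linarith+
  have "\<forall>x\<in>R. 1 - c x = 0" using e(3) c1 fR by (subst (asm) sum_nonneg_eq_0_iff) auto
  then have "lincomb c R = (\<Sum>x\<in>R. x)" by (intro sum.cong) auto
  then have "u = (1/2) *\<^sub>R (y + y') + (\<Sum>x\<in>R. x)" using u e(2) by simp
  moreover have "card V = DIM('a) + 1"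
    using card_V_le[OF X(1,3,4)] dependent_spanning_card[OF finite_V span_V assms(1)] cX e(1) by linarith
  ultimately show ?thesis using X(1,2) y'X cX e(1) by (intro exI[of _ X]) (auto simp: R_def)
qed

text \<open>If \<open>Q = V\<close>, this is Steinitz's bound together with \<open>card_ge\<close>.
  Otherwise every further point is a midpoint and \<open>card V = DIM('a) + 1\<close>; comparing the
  representations of u that two midpoints provide shows that the midpoints coincide.\<close>

lemma card_Q_dependent:
  assumes "dependent V" shows "card Q \<le> DIM('a) + 2"
proof (cases "Q = V")
  case True
  obtain X where X: "X \<subseteq> V" "independent X" "u \<in> pos_comb X"
    using caratheodory_cone[OF finite_V pos_comb_imp_nonneg[OF u_V]] .
  have "DIM('a) \<le> card X + 2" using card_ge X V_Q by blast
  then show ?thesis using card_V_le[OF X] True by simp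
next
  case False
  have mid: "\<exists>y\<in>V. \<exists>y'\<in>V. y \<noteq> y' \<and> z = (1/2) *\<^sub>R (y + y')" if "z \<in> Q - V" for z
    using midpoint_or_special[of z] that assms unfolding midpoint_of_def by blast
  obtain z where z: "z \<in> Q - V" using False V_Q by blast
  obtain y y' where y: "y \<in> V" "y' \<in> V" "y \<noteq> y'" "z = (1/2) *\<^sub>R (y + y')" using mid[OF z] by blast
  obtain X where X: "X \<subseteq> V" "y \<in> X" "y' \<in> X" "card X + 1 = DIM('a)" "card V = DIM('a) + 1"
    "u = z + (\<Sum>x\<in>X - {y, y'}. x)" using midpoint_half[OF assms y(1-3)] z y(4) by auto
  have "z2 = z" if z2: "z2 \<in> Q - V" for z2
  proof -
    obtain w w' where w: "w \<in> V" "w' \<in> V" "w \<noteq> w'" "z2 = (1/2) *\<^sub>R (w + w')" using mid[OF z2] by blast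
    obtain Y where Y: "Y \<subseteq> V" "w \<in> Y" "w' \<in> Y" "card Y + 1 = DIM('a)"
      "u = z2 + (\<Sum>x\<in>Y - {w, w'}. x)" using midpoint_half[OF assms w(1-3)] z2 w(4) by auto
    \<comment> \<open>In the representation with weight 1/2 at y, y' and 1 on the rest of X, the
      points w and w' have equal weight. Weight 1 would give their midpoint weight 2, against
      \<open>coeff_le_1\<close>; weight 1/2 means that the edges agree; only 0 remains.\<close>
    have coeffs: "{y, y'} = {w, w'} \<or> (w \<notin> X \<and> w' \<notin> X)"
      if h: "X \<subseteq> V" "y \<in> X" "y' \<in> X" "y \<in> V" "y' \<in> V" "y \<noteq> y'" "u = (1/2) *\<^sub>R (y + y') + (\<Sum>x\<in>X - {y, y'}. x)"
        "w \<in> V" "w' \<in> V" "w \<noteq> w'" "(1/2) *\<^sub>R (w + w') \<in> Q" for X y y' w w'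
    proof -
      define \<nu> where "\<nu> v = (if v \<in> {y, y'} then 1/2 else if v \<in> X then 1 else 0 :: real)" for v
      have fX: "finite X" using h(1) finite_V finite_subset by blast
      have "lincomb \<nu> V = lincomb \<nu> X"
        using h finite_V by (intro sum.mono_neutral_right) (auto simp: \<nu>_def)
      also have "\<dots> = lincomb \<nu> (X - {y, y'}) + (\<Sum>v\<in>{y, y'}. \<nu> v *\<^sub>R v)"
        using h fX by (intro sum.subset_diff) auto
      also have "(\<Sum>v\<in>{y, y'}. \<nu> v *\<^sub>R v) = (1/2) *\<^sub>R (y + y')" using h(6) by (simp add: \<nu>_def scaleR_right_distrib)
      also have "lincomb \<nu> (X - {y, y'}) = (\<Sum>v\<in>X - {y, y'}. v)" by (intro sum.cong) (auto simp: \<nu>_def)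
      finally have u: "u = lincomb \<nu> V" using h(7) by (simp add: add.commute)
      have \<nu>0: "\<And>v. 0 \<le> \<nu> v" by (simp add: \<nu>_def)
      have ww: "\<nu> w = \<nu> w'" using midpoint_coeff[OF h(8-11) \<nu>0 u] .
      have "\<nu> w \<noteq> 1"
      proof
        assume w1: "\<nu> w = 1"
        have "u = \<nu> w *\<^sub>R w + (\<nu> w' *\<^sub>R w' + lincomb \<nu> (V - {w, w'}))"
        proof -
          have "V = insert w (insert w' (V - {w, w'}))" using h by blast
          moreover have "w \<notin> insert w' (V - {w, w'})" "w' \<notin> V - {w, w'}" using h by auto
          ultimately show ?thesis using u finite_V by (metis (no_types, lifting) finite_Diff finite_insert sum.insert)
        qed
        then have "u - 2 *\<^sub>R ((1/2) *\<^sub>R (w + w')) = lincomb \<nu> (V - {w, w'})"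
          using w1 ww by (simp add: algebra_simps)
        also have "\<dots> \<in> nonneg_comb Q" using V_Q finite_Q \<nu>0
          by (intro nonneg_comb_sum nonneg_comb_scale nonneg_comb_base) auto
        finally have "2 \<le> (1::real)" by (rule coeff_le_1[OF h(11)])
        then show False by simp
      qed
      then show ?thesis using ww h(10) by (auto simp: \<nu>_def split: if_splits)
    qed
    show ?thesis
    proof (cases "{y, y'} = {w, w'}")
      case True
      then have "y + y' = w + w'" by (auto simp: doubleton_eq_iff add.commute)
      then show ?thesis using y(4) w(4) by simp
    next
      case False
      have wX: "w \<notin> X" "w' \<notin> X" using coeffs[of X y y' w w'] X y w z2 False by auto
      have yY: "y \<notin> Y" "y' \<notin> Y" using coeffs[of Y w w' y y'] Y y w z False by auto
      have fXY: "finite X" "finite Y" using X(1) Y(1) finite_V finite_subset by auto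
      \<comment> \<open>\<open>V\<close> has two elements more than X, so X and the edge of z2
        exhaust it, and likewise Y and the edge of z. The remainders of X and Y therefore agree, and
        cancelling them from u identifies the midpoints.\<close>
      have "insert w (insert w' X) = V" using wX w(1-3) X finite_V fXY
        by (intro card_subset_eq) auto
      moreover have "insert y (insert y' Y) = V" using yY y(1-3) X(5) Y finite_V fXY
        by (intro card_subset_eq) auto
      ultimately have "X - {y, y'} = Y - {w, w'}" using wX yY X Y by blast
      then show ?thesis using X(6) Y(5) by simp
    qed
  qed
  then have "Q \<subseteq> insert z V" by blast
  then have "card Q \<le> card (insert z V)" using finite_V by (intro card_mono) auto
  also have "\<dots> \<le> DIM('a) + 2" using X(5) finite_V by (simp add: card_insert_if)
  finally show ?thesis .
qed

lemma midpoint_of_commute: "midpoint_of y y' z \<Longrightarrow> midpoint_of y' y z"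
  by (auto simp: midpoint_of_def add.commute)

text \<open>Two midpoints on edges at i make the midpoint \<open>z3\<close> of j and l a lattice
  point as well, and \<open>i + j + l = z1 + z2 + z3\<close>. The three vertices have equal weight
  in u, so all of them could be exchanged for the three midpoints, which span them.\<close>

lemma midpoints_not_adjacent:
  assumes "independent V" "midpoint_of i j z1" "midpoint_of i l z2" shows "j = l"
proof (rule ccontr)
  assume jl: "j \<noteq> l"
  note m = assms(2,3)[unfolded midpoint_of_def]
  define z3 where "z3 = (1/2) *\<^sub>R (j + l)"
  have zs: "z1 + z2 - z3 = i" "z1 + z3 - z2 = j" "z2 + z3 - z1 = l"
    using m by (simp_all add: z3_def scaleR_right_distrib flip: scaleR_left_distrib)
  have dist: "i \<in> V" "j \<in> V" "l \<in> V" "i \<noteq> j" "i \<noteq> l" using m by auto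
  have VQ: "i \<in> Q" "j \<in> Q" "l \<in> Q" using dist V_Q by auto
  have z3Q: "z3 \<in> Q"
  proof (rule Q_all)
    have "z3 = z1 + z2 - i" using zs(1) by (simp add: algebra_simps)
    moreover have "z1 \<in> L" "z2 \<in> L" "i \<in> L" using m VQ Q_L by auto
    ultimately show "z3 \<in> L" using add_L diff_L by simp
    show "z3 \<in> nonneg_comb Q" unfolding z3_def using VQ finite_Q
      by (intro nonneg_comb_add nonneg_comb_scale nonneg_comb_base) auto
    show "ht z3 = 1" unfolding z3_def using VQ ht_Q by simp
  qed
  obtain \<nu> where \<nu>: "\<And>v. v \<in> V \<Longrightarrow> 0 < \<nu> v" "u = lincomb \<nu> V" using u_V unfolding pos_comb_def by blast
  have "\<nu> i = \<nu> j" "\<nu> i = \<nu> l" using midpoint_coeff[OF _ _ _ _ less_imp_le[OF \<nu>(1)] \<nu>(2)] m by auto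
  moreover define R where "R = V - {i, j, l}"
  have VR: "V = insert i (insert j (insert l R))" "i \<notin> insert j (insert l R)" "j \<notin> insert l R" "l \<notin> R"
    using dist jl by (auto simp: R_def)
  have fR: "finite R" using finite_V by (simp add: R_def)
  have "u = \<nu> i *\<^sub>R i + (\<nu> j *\<^sub>R j + (\<nu> l *\<^sub>R l + lincomb \<nu> R))"
    unfolding \<nu>(2) using VR fR by (simp add: VR(1))
  ultimately have "u = lincomb \<nu> R + \<nu> i *\<^sub>R (i + j + l)" by (simp add: algebra_simps)
  also have "i + j + l = z1 + z2 + z3" using zs by (metis (no_types, lifting) add.assoc add.commute add_diff_cancel_left' diff_add_cancel)
  finally have u: "u = lincomb \<nu> R + \<nu> i *\<^sub>R z1 + \<nu> i *\<^sub>R z2 + \<nu> i *\<^sub>R z3" by (simp add: algebra_simps)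
  let ?A = "R \<union> {z1} \<union> {z2} \<union> {z3}"
  have pA: "u \<in> pos_comb ?A"
    unfolding u using fR \<nu>(1) dist by (intro pos_comb_Un pos_comb_singleton pos_combI[of R \<nu>]) (auto simp: R_def)
  have "z1 + z2 - z3 \<in> span ?A" "z1 + z3 - z2 \<in> span ?A" "z2 + z3 - z1 \<in> span ?A"
    by (intro span_diff span_add span_base; simp)+
  then have VA: "V \<subseteq> span ?A" unfolding zs by (auto simp: VR(1) intro: span_base)
  have AQ: "?A \<subseteq> Q" using V_Q z3Q m by (auto simp: R_def)
  have "i \<in> ?A" using exchange[OF AQ pA VA] dist by blast
  moreover have "2 *\<^sub>R z1 = i + j" "2 *\<^sub>R z2 = i + l" using m by simp_all
  then have "i \<noteq> z1" "i \<noteq> z2" using dist by (auto simp: scaleR_2)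
  moreover have "i \<noteq> z3"
  proof
    assume "i = z3"
    moreover have "z3 \<in> span (V - {i})" unfolding z3_def using dist
      by (intro span_scale span_add span_base) auto
    ultimately show False using assms(1) dist(1) unfolding dependent_def by blast
  qed
  ultimately show False by (auto simp: R_def)
qed

text \<open>The edges are disjoint because midpoints are never adjacent. The two midpoints and the
  vertices off both edges add up to an interior lattice point of height
  \<open>2 + (DIM('a) - 4)\<close>, and only u has this height.\<close>

lemma midpoints_sum:
  assumes "independent V" "midpoint_of y y' z1" "midpoint_of k k' z2" "z1 \<noteq> z2"
  shows "{y, y'} \<inter> {k, k'} = {}" "u = z1 + z2 + (\<Sum>v\<in>V - {y, y', k, k'}. v)"
proof -
  note m = assms(2,3)[unfolded midpoint_of_def]
  have adj: "b = d" if "midpoint_of a b z1" "midpoint_of a d z2" for a b d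
    using midpoints_not_adjacent[OF assms(1) that] .
  show dj: "{y, y'} \<inter> {k, k'} = {}"
  proof (rule ccontr)
    assume "\<not> ?thesis"
    then consider "y = k" | "y = k'" | "y' = k" | "y' = k'" by blast
    then have "y + y' = k + k'"
    proof cases
      case 1 then show ?thesis using adj[OF assms(2)] assms(3) by blast
    next
      case 2 then show ?thesis using adj[OF assms(2)] midpoint_of_commute[OF assms(3)] by (simp add: add.commute)
    next
      case 3 then show ?thesis using adj[OF midpoint_of_commute[OF assms(2)]] assms(3) by (simp add: add.commute)
    next
      case 4 then show ?thesis using adj[OF midpoint_of_commute[OF assms(2)]] midpoint_of_commute[OF assms(3)] by simp
    qed
    then show False using m assms(4) by simp
  qed
  then have dn: "y \<noteq> k" "y \<noteq> k'" "y' \<noteq> k" "y' \<noteq> k'" by auto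
  let ?F = "{y, y', k, k'}"
  have F: "?F \<subseteq> V" "card ?F = 4" using m dj by auto
  define w where "w = z1 + z2 + (\<Sum>v\<in>V - ?F. v)"
  have w: "w = (\<Sum>v\<in>V - ?F. v) + (\<Sum>v\<in>?F. (1/2) *\<^sub>R v)"
    using m dn by (simp add: w_def scaleR_right_distrib add.assoc add.left_commute)
  have "w \<in> pos_comb ((V - ?F) \<union> ?F)" unfolding w using finite_V
    by (intro pos_comb_Un sum_in_pos_comb pos_combI[of ?F "\<lambda>_. 1/2"]) auto
  moreover have "(V - ?F) \<union> ?F = V" using F(1) by blast
  ultimately have "w \<in> pos_comb V" by simp
  then have "w \<in> pos_comb Q" using pos_comb_mono_span[OF finite_Q V_Q] span_V by auto
  moreover have "w \<in> L" unfolding w_def using m Q_L V_Q by (intro add_L sum_L) auto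
  moreover have "ht w = real DIM('a) - 2"
  proof -
    have "card (V - ?F) = card V - 4" using F finite_V by (simp add: card_Diff_subset)
    moreover have "4 \<le> card V" using F card_mono[OF finite_V F(1)] by simp
    moreover have "card V = DIM('a)" by (rule independent_spanning_card[OF assms(1) span_V])
    moreover have "ht w = 2 + real (card (V - ?F))" unfolding w_def using m ht_Q V_Q by (simp add: subset_iff)
    ultimately show ?thesis by (simp add: of_nat_diff)
  qed
  ultimately have "w = u" by (intro lattice_pos_zero)
  then show "u = z1 + z2 + (\<Sum>v\<in>V - ?F. v)" by (simp add: w_def)
qed

text \<open>Now \<open>V\<close> is a basis and the coefficients of u are unique. A special point
  means that exactly three of them differ from 1, two midpoints mean that exactly four do; so these
  cannot coexist, and a special point is determined by u. Any two midpoints sum to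
  \<open>(\<Sum>v\<in>V. v) - u\<close>, which excludes a third.\<close>

lemma card_Q_independent:
  assumes "independent V" shows "card Q \<le> DIM('a) + 2"
proof (rule ccontr)
  assume "\<not> ?thesis"
  moreover have cV: "card V = DIM('a)" by (rule independent_spanning_card[OF assms span_V])
  moreover have "card (Q - V) = card Q - card V" using V_Q finite_V by (simp add: card_Diff_subset)
  ultimately have "3 \<le> card (Q - V)" by simp
  then obtain Z where Z: "Z \<subseteq> Q - V" "card Z = 3" by (meson obtain_subset_with_card_n)
  then obtain a b c where abc: "Z = {a, b, c}" "a \<noteq> b" "a \<noteq> c" "b \<noteq> c" by (auto simp: card_3_iff)
  have types: "(\<exists>y y'. midpoint_of y y' z) \<or> (\<exists>S f. special S f z)" if "z \<in> {a, b, c}" for z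
    using midpoint_or_special[of z] that Z abc by blast
  have special_coeffs: "u = (\<Sum>v\<in>V. (if v \<in> S then f v else 1) *\<^sub>R v)" if "special S f z" for S f z
  proof -
    have S: "S \<subseteq> V" "z = lincomb f S" "u = z + (\<Sum>b\<in>V - S. b)" using that unfolding special_def by blast+
    have "(\<Sum>v\<in>V. (if v \<in> S then f v else 1) *\<^sub>R v) = (\<Sum>v\<in>V - S. (if v \<in> S then f v else 1) *\<^sub>R v) + (\<Sum>v\<in>S. (if v \<in> S then f v else 1) *\<^sub>R v)"
      using S(1) finite_V by (rule sum.subset_diff)
    also have "(\<Sum>v\<in>V - S. (if v \<in> S then f v else 1) *\<^sub>R v) = (\<Sum>v\<in>V - S. v)" by (intro sum.cong) auto
    also have "(\<Sum>v\<in>S. (if v \<in> S then f v else 1) *\<^sub>R v) = z" unfolding S(2) by (intro sum.cong) auto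
    finally show ?thesis using S(3) by (simp add: add.commute)
  qed
  have special_unique: "z = z'" if s: "special S f z" "special S' f' z'" for S f z S' f' z'
  proof -
    have eq: "(if v \<in> S then f v else 1) = (if v \<in> S' then f' v else 1)" if "v \<in> V" for v
      by (rule independent_coeffs_unique[OF assms finite_V trans[OF sym[OF special_coeffs[OF s(1)]] special_coeffs[OF s(2)]] that])
    have "S = S'"
    proof (rule set_eqI)
      fix v show "v \<in> S \<longleftrightarrow> v \<in> S'"
      proof (cases "v \<in> V")
        case True
        then show ?thesis using eq[OF True] s unfolding special_def by (metis less_irrefl)
      next
        case False
        moreover have "S \<subseteq> V" "S' \<subseteq> V" using s unfolding special_def by blast+
        ultimately show ?thesis by blast
      qed
    qed
    then show ?thesis using s unfolding special_def by (metis add_right_cancel)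
  qed
  have mid_special: False if s: "special S f z" and m: "midpoint_of y y' z1" "midpoint_of k k' z2" "z1 \<noteq> z2" for S f z y y' z1 k k' z2
  proof -
    note ms = midpoints_sum[OF assms m]
    let ?F = "{y, y', k, k'}"
    have F: "?F \<subseteq> V" "card ?F = 4" using m ms(1) by (auto simp: midpoint_of_def)
    have "(\<Sum>v\<in>V. (if v \<in> ?F then 1/2 else 1) *\<^sub>R v) = (\<Sum>v\<in>V - ?F. (if v \<in> ?F then 1/2 else 1) *\<^sub>R v) + (\<Sum>v\<in>?F. (if v \<in> ?F then 1/2 else 1) *\<^sub>R v)"
      using F(1) finite_V by (rule sum.subset_diff)
    also have "(\<Sum>v\<in>V - ?F. (if v \<in> ?F then 1/2 else 1) *\<^sub>R v) = (\<Sum>v\<in>V - ?F. v)" by (intro sum.cong) auto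
    also have "(\<Sum>v\<in>?F. (if v \<in> ?F then 1/2 else 1 :: real) *\<^sub>R v) = z1 + z2"
      using m ms(1) by (auto simp: midpoint_of_def scaleR_right_distrib)
    finally have u: "u = (\<Sum>v\<in>V. (if v \<in> ?F then 1/2 else 1) *\<^sub>R v)" using ms(2) by (simp add: add.commute)
    have eq: "(if v \<in> S then f v else 1) = (if v \<in> ?F then 1/2 else 1)" if "v \<in> V" for v
      by (rule independent_coeffs_unique[OF assms finite_V trans[OF sym[OF special_coeffs[OF s]] u] that])
    have "S = ?F"
    proof (rule set_eqI)
      fix v show "v \<in> S \<longleftrightarrow> v \<in> ?F"
      proof (cases "v \<in> V")
        case True
        show ?thesis
        proof
          assume v: "v \<in> S"
          then have "f v < 1" using s by (simp add: special_def)
          then show "v \<in> ?F" using eq[OF True] v by (metis less_irrefl)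
        next
          assume v: "v \<in> ?F"
          show "v \<in> S"
          proof (rule ccontr)
            assume "v \<notin> S"
            with eq[OF True] v have "1 = (1/2::real)" by presburger
            then show False by simp
          qed
        qed
      qed (use s F in \<open>auto simp: special_def\<close>)
    qed
    then show False using s F unfolding special_def by simp
  qed
  have two: "u = z1 + z2 + (\<Sum>v\<in>V - {y, y', k, k'}. v)" "{y, y'} \<inter> {k, k'} = {}"
    if "midpoint_of y y' z1" "midpoint_of k k' z2" "z1 \<noteq> z2" for y y' k k' z1 z2
    using midpoints_sum[OF assms that] by blast+
  have tot: "z1 + z2 = (\<Sum>v\<in>V. v) - u"
    if m: "midpoint_of y y' z1" "midpoint_of k k' z2" "z1 \<noteq> z2" for y y' k k' z1 z2
  proof -
    let ?F = "{y, y', k, k'}"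
    have F: "?F \<subseteq> V" using m by (auto simp: midpoint_of_def)
    have "(\<Sum>v\<in>V. v) = (\<Sum>v\<in>V - ?F. v) + (\<Sum>v\<in>?F. v)" using F finite_V by (rule sum.subset_diff)
    also have "(\<Sum>v\<in>?F. v) = 2 *\<^sub>R (z1 + z2)"
      using m two(2)[OF m] by (auto simp: midpoint_of_def scaleR_right_distrib add.assoc)
    finally show ?thesis using two(1)[OF m] by (simp add: scaleR_2 algebra_simps)
  qed
  consider (sp2) z z' where "z \<noteq> z'" "\<exists>S f. special S f z" "\<exists>S f. special S f z'"
    | (sp1) z1 z2 z where "z1 \<noteq> z2" "\<exists>y y'. midpoint_of y y' z1" "\<exists>y y'. midpoint_of y y' z2" "\<exists>S f. special S f z"
    | (sp0) "\<exists>y y'. midpoint_of y y' a" "\<exists>y y'. midpoint_of y y' b" "\<exists>y y'. midpoint_of y y' c"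
  proof -
    let ?m = "\<lambda>z. \<exists>y y'. midpoint_of y y' z" and ?s = "\<lambda>z. \<exists>S f. special S f z"
    have "?m a \<or> ?s a" "?m b \<or> ?s b" "?m c \<or> ?s c" using types by auto
    then consider "?m a" "?m b" "?m c" | "?s a" "?s b" | "?s a" "?s c" | "?s b" "?s c"
      | "?s a" "?m b" "?m c" | "?m a" "?s b" "?m c" | "?m a" "?m b" "?s c" by argo
    then show thesis
      by cases (use sp0 sp1 sp2 abc in metis)+
  qed
  then show False
  proof cases
    case sp2 then show ?thesis using special_unique by blast
  next
    case sp1 then show ?thesis using mid_special by blast
  next
    case sp0
    then have "a + b = (\<Sum>v\<in>V. v) - u" "a + c = (\<Sum>v\<in>V. v) - u" using tot abc by blast+
    then show ?thesis using abc by (metis add_left_cancel)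
  qed
qed

theorem card_Q_le: "card Q \<le> DIM('a) + 2"
  using card_Q_dependent card_Q_independent by blast

end

section \<open>Half-open decompositions and reciprocity\<close>

definition bases_in :: "'a::euclidean_space set \<Rightarrow> 'a set set" where
  "bases_in A = {B. B \<subseteq> A \<and> independent B \<and> span B = UNIV}"

text \<open>The point x lies on no wall: with respect to a basis contained in \<open>A\<close> it
  has no zero coordinate.\<close>

definition generic :: "'a::euclidean_space set \<Rightarrow> 'a \<Rightarrow> bool" where
  "generic A x \<longleftrightarrow> (\<forall>S\<subseteq>A. x \<in> span S \<longrightarrow> span S = UNIV)"

text \<open>For a basis \<open>B\<close>, the value at x of the linear form that agrees with
  \<omega> on \<open>B\<close>. In linear programming terms this is the dual solution attached to
  \<open>B\<close> and also the cost of the basic solution.\<close>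

definition basis_value :: "('a::euclidean_space \<Rightarrow> real) \<Rightarrow> 'a set \<Rightarrow> 'a \<Rightarrow> real" where
  "basis_value \<omega> B x = (\<Sum>b\<in>B. representation B x b * \<omega> b)"

text \<open>For a basis \<open>B\<close>, the cone over \<open>B\<close> without its facets opposite
  to the elements of \<open>J\<close>.\<close>

definition half_open_cone :: "'a::euclidean_space set \<Rightarrow> 'a set \<Rightarrow> 'a set" where
  "half_open_cone B J = {x. \<forall>b\<in>B. 0 \<le> representation B x b \<and> (b \<in> J \<longrightarrow> 0 < representation B x b)}"

locale vector_basis =
  fixes B :: "'a::euclidean_space set"
  assumes indep: "independent B" and spanning: "span B = UNIV"
begin

lemma finite_B: "finite B" using indep independent_imp_finite by blast

lemma rep_sum: "(\<Sum>b\<in>B. representation B x b *\<^sub>R b) = x"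
  using sum_representation_eq[OF indep _ finite_B subset_refl, of x] spanning by simp

lemma rep_unique: "b \<in> B \<Longrightarrow> x = lincomb c B \<Longrightarrow> representation B x b = c b"
  using independent_coeffs_unique[OF indep finite_B, of "representation B x" c b] rep_sum[of x] by simp

lemma rep_add: "representation B (x + y) b = representation B x b + representation B y b"
  using representation_add[OF indep, of y x] spanning by (simp add: fun_eq_iff add.commute)

lemma rep_scale: "representation B (t *\<^sub>R x) b = t * representation B x b"
  using representation_scale[OF indep, of x t] spanning by (simp add: fun_eq_iff)

lemma rep_diff: "representation B (x - y) b = representation B x b - representation B y b"
  using rep_add[of x "(-1) *\<^sub>R y" b] rep_scale[of "-1" y b] by simp

lemma rep_basis: "b \<in> B \<Longrightarrow> representation B b b' = (if b' = b then 1 else 0)"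
  using representation_basis[OF indep, of b] by simp

lemma nonneg_comb_iff: "x \<in> nonneg_comb B \<longleftrightarrow> (\<forall>b\<in>B. 0 \<le> representation B x b)"
proof
  assume "x \<in> nonneg_comb B"
  then obtain c where "\<And>a. a \<in> B \<Longrightarrow> 0 \<le> c a" "x = lincomb c B" unfolding nonneg_comb_def by blast
  then show "\<forall>b\<in>B. 0 \<le> representation B x b" using rep_unique by metis
next
  assume "\<forall>b\<in>B. 0 \<le> representation B x b"
  then show "x \<in> nonneg_comb B" using rep_sum[of x] by (intro nonneg_combI[of B "representation B x"]) auto
qed

lemma generic_coord_nonzero:
  assumes "generic A x" "B \<subseteq> A" "b \<in> B" shows "representation B x b \<noteq> 0"
proof
  assume 0: "representation B x b = 0"
  have "x = (\<Sum>a\<in>B - {b}. representation B x a *\<^sub>R a)"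
    using rep_sum[of x] sum.remove[OF finite_B assms(3), of "\<lambda>a. representation B x a *\<^sub>R a"] 0 by simp
  also have "\<dots> \<in> span (B - {b})" by (intro span_sum span_scale span_base)
  finally have "x \<in> span (B - {b})" .
  moreover have "B - {b} \<subseteq> A" using assms(2) by blast
  ultimately have "span (B - {b}) = UNIV" using assms(1) unfolding generic_def by blast
  then show False using indep assms(3) unfolding dependent_def by blast
qed

lemma basis_value_eq: "x = lincomb c B \<Longrightarrow> basis_value \<omega> B x = (\<Sum>b\<in>B. c b * \<omega> b)"
  unfolding basis_value_def using rep_unique by (intro sum.cong) auto

lemma linear_basis_value: "linear (basis_value \<omega> B)"
  by (intro linearI) (auto simp: basis_value_def rep_add rep_scale algebra_simps sum.distrib sum_distrib_left)

lemma basis_value_base: "b \<in> B \<Longrightarrow> basis_value \<omega> B b = \<omega> b"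
  unfolding basis_value_def using finite_B by (simp add: rep_basis if_distrib[of "\<lambda>t. t * _"] cong: if_cong)

end

lemma bases_inD: "B \<in> bases_in A \<Longrightarrow> vector_basis B \<and> B \<subseteq> A"
  unfolding bases_in_def vector_basis_def by blast

section \<open>Generic weights and generic directions\<close>

lemma common_nonroot:
  fixes F :: "real poly set"
  assumes "finite F" "0 \<notin> F"
  obtains s where "s > 0" "\<forall>p\<in>F. poly p s \<noteq> 0"
proof -
  have "finite (\<Union>p\<in>F. {s. poly p s = 0})" using assms by (auto intro: poly_roots_finite)
  then have "infinite ({0<..} - (\<Union>p\<in>F. {s. poly p s = 0}))"
    using infinite_Ioi[of "0::real"] Diff_infinite_finite by blast
  then obtain s where "s \<in> {0<..} - (\<Union>p\<in>F. {s. poly p s = 0})" using infinite_imp_nonempty by blast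
  then show ?thesis using that by auto
qed

lemma poly_sum_monom: "poly (\<Sum>a\<in>A. monom (c a) (i a)) s = (\<Sum>a\<in>A. c a * s ^ i a)"
  for c :: "'b \<Rightarrow> real"
  by (simp add: poly_sum poly_monom)

lemma sum_monom_nonzero:
  assumes "finite A" "inj_on i A" "a \<in> A" "c a \<noteq> (0::real)"
  shows "(\<Sum>b\<in>A. monom (c b) (i b)) \<noteq> 0"
proof -
  have "coeff (\<Sum>b\<in>A. monom (c b) (i b)) (i a) = (\<Sum>b\<in>A. if b = a then c b else 0)"
    unfolding coeff_sum using assms(2,3) by (intro sum.cong) (auto simp: inj_on_def)
  also have "\<dots> = c a" using assms by simp
  finally show ?thesis using assms(4) by auto
qed

text \<open>The weights are powers of one parameter s with distinct exponents. Each forbidden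
  equality is a polynomial equation in s, nontrivial because its coefficient at exponent
  \<open>i a\<close> is -1; only finitely many s are excluded.\<close>

lemma exists_generic_weights:
  fixes A :: "'a::euclidean_space set"
  assumes "finite A"
  obtains \<omega> where "\<And>B a. B \<in> bases_in A \<Longrightarrow> a \<in> A - B \<Longrightarrow> basis_value \<omega> B a \<noteq> \<omega> a"
proof -
  obtain i :: "'a \<Rightarrow> nat" where i: "inj_on i A" using finite_imp_inj_to_nat_seg[OF assms] by blast
  define c where "c B a b = (if b = a then - 1 else if b \<in> B then representation B a b else 0)" for B :: "'a set" and a b
  define p where "p B a = (\<Sum>b\<in>A. monom (c B a b) (i b))" for B a
  let ?F = "(\<lambda>(B, a). p B a) ` (bases_in A \<times> A)"
  have "finite (bases_in A)" unfolding bases_in_def using assms by (auto intro: finite_subset[OF _ finite_Pow_iff[THEN iffD2]])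
  then have "finite ?F" using assms by blast
  moreover have "0 \<notin> ?F"
  proof -
    have "p B a \<noteq> 0" if "a \<in> A" for B a
      unfolding p_def by (rule sum_monom_nonzero[OF assms i that]) (simp add: c_def)
    then show ?thesis by fastforce
  qed
  ultimately obtain s where s: "s > 0" "\<forall>p\<in>?F. poly p s \<noteq> 0" by (rule common_nonroot)
  show ?thesis
  proof (rule that[of "\<lambda>a. s ^ i a"])
    fix B a assume B: "B \<in> bases_in A" and a: "a \<in> A - B"
    have BA: "B \<subseteq> A" using B by (simp add: bases_in_def)
    have "(\<Sum>b\<in>A. c B a b * s ^ i b) = c B a a * s ^ i a + (\<Sum>b\<in>A - {a}. c B a b * s ^ i b)"
      using a assms by (intro sum.remove) auto
    also have "(\<Sum>b\<in>A - {a}. c B a b * s ^ i b) = (\<Sum>b\<in>B. representation B a b * s ^ i b)"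
      using a BA assms by (intro sum.mono_neutral_cong_right) (auto simp: c_def)
    finally have "poly (p B a) s = basis_value (\<lambda>a. s ^ i a) B a - s ^ i a"
      unfolding p_def poly_sum_monom basis_value_def by (simp add: c_def)
    moreover have "poly (p B a) s \<noteq> 0" using s(2) B a by force
    ultimately show "basis_value (\<lambda>a. s ^ i a) B a \<noteq> s ^ i a" by simp
  qed
qed

text \<open>The same one-parameter choice: a proper span has a normal vector g, and the product of g
  with \<xi> is a polynomial in s, nonzero because g cannot be orthogonal to the spanning set
  \<open>A\<close>.\<close>

lemma exists_generic_pos:
  fixes A :: "'a::euclidean_space set"
  assumes "finite A" "span A = UNIV"
  obtains \<xi> where "\<xi> \<in> pos_comb A" "generic A \<xi>"
proof -
  obtain i :: "'a \<Rightarrow> nat" where i: "inj_on i A" using finite_imp_inj_to_nat_seg[OF assms(1)] by blast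
  define F where "F = {S. S \<subseteq> A \<and> span S \<noteq> UNIV}"
  have "\<forall>S\<in>F. \<exists>g. g \<noteq> 0 \<and> (\<forall>x\<in>span S. g \<bullet> x = 0)"
    unfolding F_def using span_not_UNIV_orthogonal by blast
  then obtain g where g: "\<And>S. S \<in> F \<Longrightarrow> g S \<noteq> 0" "\<And>S x. S \<in> F \<Longrightarrow> x \<in> span S \<Longrightarrow> g S \<bullet> x = 0" by metis
  define p where "p S = (\<Sum>a\<in>A. monom (g S \<bullet> a) (i a))" for S
  have "finite F" unfolding F_def using assms(1) by simp
  then have "finite (p ` F)" by blast
  moreover have "0 \<notin> p ` F"
  proof
    assume "0 \<in> p ` F"
    then obtain S where S: "S \<in> F" "p S = 0" by auto
    have "g S \<bullet> a = 0" if "a \<in> A" for a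
      using sum_monom_nonzero[OF assms(1) i that, of "\<lambda>a. g S \<bullet> a"] S(2) unfolding p_def by blast
    then have "A \<subseteq> {x. g S \<bullet> x = 0}" by blast
    then have "span A \<subseteq> {x. g S \<bullet> x = 0}" using subspace_hyperplane by (rule span_minimal)
    then have "g S \<bullet> g S = 0" using assms(2) by blast
    then show False using g(1)[OF S(1)] by simp
  qed
  ultimately obtain s where s: "s > 0" "\<forall>q\<in>p ` F. poly q s \<noteq> 0" by (rule common_nonroot)
  define \<xi> where "\<xi> = (\<Sum>a\<in>A. s ^ i a *\<^sub>R a)"
  have "\<xi> \<in> pos_comb A" unfolding \<xi>_def using s(1) by (intro pos_combI[of A "\<lambda>a. s ^ i a"]) auto
  moreover have "generic A \<xi>" unfolding generic_def
  proof (intro allI impI, rule ccontr)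
    fix S assume "S \<subseteq> A" and sp: "\<xi> \<in> span S" and "span S \<noteq> UNIV"
    then have S: "S \<in> F" by (simp add: F_def)
    have "poly (p S) s = g S \<bullet> \<xi>" unfolding p_def poly_sum_monom \<xi>_def inner_sum_right by (simp add: mult.commute)
    then show False using s(2) S g(2)[OF S sp] by auto
  qed
  ultimately show ?thesis by (rule that)
qed

text \<open>As \<xi> lies in no proper span of a subset of \<open>A\<close>, the ray from x in
  direction \<xi> meets each of these finitely many subspaces at most once.\<close>

lemma eventually_generic:
  fixes A :: "'a::euclidean_space set"
  assumes "finite A" "generic A \<xi>"
  shows "\<forall>\<^sub>F e in at_right (0::real). generic A (x + e *\<^sub>R \<xi>)"
proof -
  have "\<forall>\<^sub>F e in at_right (0::real). x + e *\<^sub>R \<xi> \<in> span S \<longrightarrow> span S = UNIV" if S: "S \<subseteq> A" for S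
  proof (cases "span S = UNIV \<or> (\<forall>e>0. x + e *\<^sub>R \<xi> \<notin> span S)")
    case True
    then have "\<forall>e>0. x + e *\<^sub>R \<xi> \<in> span S \<longrightarrow> span S = UNIV" by blast
    then show ?thesis unfolding eventually_at_right_field by (intro exI[of _ 1]) auto
  next
    case False
    then obtain e0 where e0: "e0 > 0" "x + e0 *\<^sub>R \<xi> \<in> span S" and ns: "span S \<noteq> UNIV" by blast
    have "x + e *\<^sub>R \<xi> \<notin> span S" if e: "e < e0" for e
    proof
      assume "x + e *\<^sub>R \<xi> \<in> span S"
      with e0(2) have "(x + e0 *\<^sub>R \<xi>) - (x + e *\<^sub>R \<xi>) \<in> span S" by (rule span_diff)
      then have "(e0 - e) *\<^sub>R \<xi> \<in> span S" by (simp add: algebra_simps)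
      then have "(1 / (e0 - e)) *\<^sub>R ((e0 - e) *\<^sub>R \<xi>) \<in> span S" by (rule span_scale)
      then have "\<xi> \<in> span S" using e by simp
      then show False using assms(2) S ns unfolding generic_def by blast
    qed
    then show ?thesis using e0(1) unfolding eventually_at_right_field by (intro exI[of _ e0]) auto
  qed
  then have "\<forall>\<^sub>F e in at_right (0::real). \<forall>S\<in>Pow A. x + e *\<^sub>R \<xi> \<in> span S \<longrightarrow> span S = UNIV"
    using assms(1) by (intro eventually_ball_finite) auto
  then show ?thesis by (rule eventually_mono) (auto simp: generic_def)
qed

lemma eventually_sign:
  fixes l k :: real
  assumes "k \<noteq> 0"
  shows "\<forall>\<^sub>F e in at_right 0. (0 \<le> l + e * k) = (0 \<le> l \<and> (k < 0 \<longrightarrow> 0 < l))"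
proof (cases "l = 0")
  case True
  then show ?thesis using assms
    by (auto simp: eventually_at_right_field zero_le_mult_iff intro!: exI[of _ 1])
next
  case False
  have "0 < \<bar>l\<bar> / \<bar>k\<bar>" using False assms by simp
  moreover have "(0 \<le> l + e * k) = (0 \<le> l \<and> (k < 0 \<longrightarrow> 0 < l))" if "0 < e" "e < \<bar>l\<bar> / \<bar>k\<bar>" for e
  proof -
    have "\<bar>e * k\<bar> < \<bar>l\<bar>" using that assms by (simp add: abs_mult field_simps)
    then show ?thesis using False by linarith
  qed
  ultimately show ?thesis by (auto simp: eventually_at_right_field intro!: exI[of _ "\<bar>l\<bar> / \<bar>k\<bar>"])
qed

text \<open>For small e the sign of a coordinate of the shifted point is that of x, with ties
  decided by \<xi>. Closed cones tested at shifted points are thus half-open cones tested at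
  x.\<close>

lemma eventually_half_open:
  fixes B :: "'a::euclidean_space set"
  assumes "B \<in> bases_in A" "generic A \<xi>"
  shows "\<forall>\<^sub>F e in at_right 0. (x + e *\<^sub>R \<xi> \<in> nonneg_comb B) = (x \<in> half_open_cone B {b. representation B \<xi> b < 0})"
proof -
  interpret vector_basis B using bases_inD[OF assms(1)] by blast
  have "\<forall>\<^sub>F e in at_right 0. \<forall>b\<in>B. (0 \<le> representation B x b + e * representation B \<xi> b) =
      (0 \<le> representation B x b \<and> (representation B \<xi> b < 0 \<longrightarrow> 0 < representation B x b))"
    using generic_coord_nonzero[OF assms(2)] bases_inD[OF assms(1)] finite_B
    by (intro eventually_ball_finite ballI eventually_sign) auto
  then show ?thesis
    by (rule eventually_mono) (auto simp: nonneg_comb_iff half_open_cone_def rep_add rep_scale)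
qed

lemma generic_uminus: "generic A \<xi> \<Longrightarrow> generic A (- \<xi>)"
  unfolding generic_def by (metis span_neg minus_minus)

context graded_lattice
begin

text \<open>
  The chosen bases are the dual feasible ones of the linear program minimising \<open>\<Sum>a. c a * \<omega> a\<close> over
  all nonnegative representations \<open>x = \<Sum>a. c a *\<^sub>R a\<close>; genericity of \<open>\<omega>\<close> and \<open>x\<close> makes the optimal
  basis unique. This replaces a triangulation.
\<close>

definition optimal_bases :: "('a \<Rightarrow> real) \<Rightarrow> 'a set \<Rightarrow> 'a set set" where
  "optimal_bases \<omega> A = {B \<in> bases_in A. \<forall>a\<in>A. basis_value \<omega> B a \<le> \<omega> a}"

text \<open>Weak duality: the form belonging to \<open>B\<close> is at most \<omega> on
  \<open>A\<close>, so it prices x no higher than \<open>B'\<close> does, and by symmetry both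
  prices agree. By complementary slackness, as x has positive coordinates in \<open>B'\<close>, the
  form equals \<omega> on \<open>B'\<close>; genericity of \<omega> permits this only inside
  \<open>B\<close>.\<close>

lemma optimal_basis_unique:
  assumes gen: "\<And>B a. B \<in> bases_in A \<Longrightarrow> a \<in> A - B \<Longrightarrow> basis_value \<omega> B a \<noteq> \<omega> a"
    and x: "generic A x" and B: "B \<in> optimal_bases \<omega> A" "x \<in> nonneg_comb B"
    and B': "B' \<in> optimal_bases \<omega> A" "x \<in> nonneg_comb B'"
  shows "B' \<subseteq> B"
proof -
  have le: "basis_value \<omega> B x \<le> basis_value \<omega> B' x"
    if "B \<in> optimal_bases \<omega> A" "B' \<in> optimal_bases \<omega> A" "x \<in> nonneg_comb B'" for B B'
  proof -
    interpret b: vector_basis B using that bases_inD unfolding optimal_bases_def by blast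
    interpret b': vector_basis B' using that bases_inD unfolding optimal_bases_def by blast
    have sub: "B' \<subseteq> A" using that bases_inD unfolding optimal_bases_def by blast
    have "basis_value \<omega> B x = basis_value \<omega> B (\<Sum>a\<in>B'. representation B' x a *\<^sub>R a)" by (simp add: b'.rep_sum)
    also have "\<dots> = (\<Sum>a\<in>B'. representation B' x a * basis_value \<omega> B a)"
      using b.linear_basis_value by (simp add: linear_sum linear_cmul)
    also have "\<dots> \<le> (\<Sum>a\<in>B'. representation B' x a * \<omega> a)"
      using that sub b'.nonneg_comb_iff by (intro sum_mono mult_left_mono) (auto simp: optimal_bases_def)
    finally show ?thesis by (simp add: basis_value_def)
  qed
  have eq: "basis_value \<omega> B x = basis_value \<omega> B' x" using le[OF B(1) B'] le[OF B'(1) B] by simp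
  have bB: "B \<in> bases_in A" "B' \<in> bases_in A" using B B' unfolding optimal_bases_def by blast+
  interpret b: vector_basis B using bB bases_inD by blast
  interpret b': vector_basis B' using bB bases_inD by blast
  have sub: "B' \<subseteq> A" using bB bases_inD by blast
  have "basis_value \<omega> B x = basis_value \<omega> B (\<Sum>a\<in>B'. representation B' x a *\<^sub>R a)" by (simp add: b'.rep_sum)
  also have "\<dots> = (\<Sum>a\<in>B'. representation B' x a * basis_value \<omega> B a)"
    using b.linear_basis_value by (simp add: linear_sum linear_cmul)
  finally have "(\<Sum>a\<in>B'. representation B' x a * (\<omega> a - basis_value \<omega> B a)) = 0"
    using eq unfolding basis_value_def[of \<omega> B' x] by (simp add: algebra_simps sum_subtractf)
  then have "\<forall>a\<in>B'. representation B' x a * (\<omega> a - basis_value \<omega> B a) = 0"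
    using B B' sub b'.nonneg_comb_iff b'.finite_B
    by (subst (asm) sum_nonneg_eq_0_iff) (auto simp: optimal_bases_def subset_iff)
  then have "\<forall>a\<in>B'. basis_value \<omega> B a = \<omega> a" using b'.generic_coord_nonzero[OF x sub] by auto
  then show ?thesis using gen[OF bB(1)] sub by blast
qed

text \<open>A cheapest basis with x in its cone is dual feasible, since a violating a could enter by
  a pivot that lowers the cost. The coordinates of a sum to its height 1, so one of them is positive
  and the ratio test applies.\<close>

lemma optimal_basis_exists:
  assumes "finite A" "\<And>a. a \<in> A \<Longrightarrow> ht a = 1" "generic A x" "x \<in> nonneg_comb A"
  shows "\<exists>B\<in>optimal_bases \<omega> A. x \<in> nonneg_comb B"
proof -
  define F where "F = {B \<in> bases_in A. x \<in> nonneg_comb B}"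
  have "finite F" unfolding F_def bases_in_def using assms(1) by simp
  moreover have "F \<noteq> {}"
  proof -
    obtain S where S: "S \<subseteq> A" "independent S" "x \<in> pos_comb S" using caratheodory_cone[OF assms(1,4)] .
    then have "span S = UNIV" using assms(3) pos_comb_in_span unfolding generic_def by blast
    then show ?thesis using S pos_comb_imp_nonneg unfolding F_def bases_in_def by blast
  qed
  ultimately obtain B where B: "B \<in> F" "\<And>B'. B' \<in> F \<Longrightarrow> basis_value \<omega> B x \<le> basis_value \<omega> B' x"
    using arg_min_if_finite[of F "\<lambda>B. basis_value \<omega> B x"] by (metis not_less)
  have bB: "B \<in> bases_in A" "B \<subseteq> A" "x \<in> nonneg_comb B" using B(1) bases_inD unfolding F_def by blast+
  interpret vector_basis B using bB(1) bases_inD by blast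
  have "basis_value \<omega> B a \<le> \<omega> a" if a: "a \<in> A" for a
  proof (rule ccontr)
    assume less: "\<not> basis_value \<omega> B a \<le> \<omega> a"
    let ?\<alpha> = "representation B a" and ?l = "representation B x"
    have lpos: "0 < ?l b" if "b \<in> B" for b
      using generic_coord_nonzero[OF assms(3) bB(2) that] nonneg_comb_iff bB(3) that by force
    have "sum ?\<alpha> B = ht (\<Sum>b\<in>B. ?\<alpha> b *\<^sub>R b)" using bB(2) assms(2) by (simp add: subset_iff)
    also have "\<dots> = 1" using rep_sum assms(2) a by simp
    finally have "\<not> sum ?\<alpha> B \<le> 0" by simp
    then obtain b1 where b1: "b1 \<in> B" "0 < ?\<alpha> b1" using sum_nonpos[of B ?\<alpha>] by force
    obtain t where t: "\<And>b. b \<in> B \<Longrightarrow> 0 \<le> ?l b - t * ?\<alpha> b" "\<exists>b\<in>B. ?l b - t * ?\<alpha> b = 0" "0 < t"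
      using caratheodory_step[of B ?l b1 ?\<alpha>, OF finite_B lpos b1] by blast
    then obtain b0 where b0: "b0 \<in> B" "?l b0 - t * ?\<alpha> b0 = 0" by blast
    have aB: "a \<notin> B" using basis_value_base less by force
    define B' where "B' = insert a (B - {b0})"
    define c where "c b = (if b = a then t else ?l b - t * ?\<alpha> b)" for b
    \<comment> \<open>A general f lets the same computation give the vector x, with f the identity,
      and its cost, with f = \<omega>.\<close>
    have sumc: "(\<Sum>b\<in>B'. c b *\<^sub>R f b) = t *\<^sub>R f a + (\<Sum>b\<in>B. (?l b - t * ?\<alpha> b) *\<^sub>R f b)" for f :: "'a \<Rightarrow> 'c::real_vector"
    proof -
      have "(\<Sum>b\<in>B'. c b *\<^sub>R f b) = c a *\<^sub>R f a + (\<Sum>b\<in>B - {b0}. c b *\<^sub>R f b)"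
        unfolding B'_def using finite_B aB by (intro sum.insert) auto
      also have "(\<Sum>b\<in>B - {b0}. c b *\<^sub>R f b) = (\<Sum>b\<in>B - {b0}. (?l b - t * ?\<alpha> b) *\<^sub>R f b)"
        using aB by (intro sum.cong) (auto simp: c_def)
      also have "\<dots> = (\<Sum>b\<in>B. (?l b - t * ?\<alpha> b) *\<^sub>R f b)"
        using b0 finite_B by (intro sum.mono_neutral_left) auto
      finally show ?thesis by (simp add: c_def)
    qed
    have "(\<Sum>b\<in>B. (?l b - t * ?\<alpha> b) *\<^sub>R b) = (\<Sum>b\<in>B. ?l b *\<^sub>R b) - t *\<^sub>R (\<Sum>b\<in>B. ?\<alpha> b *\<^sub>R b)"
      by (simp add: scaleR_left_diff_distrib sum_subtractf scaleR_sum_right)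
    then have x: "x = lincomb c B'" unfolding sumc rep_sum by simp
    have c0: "0 \<le> c b" if "b \<in> B'" for b using t that by (auto simp: c_def B'_def)
    have xB': "x \<in> nonneg_comb B'" using c0 x by (intro nonneg_combI)
    have B'A: "B' \<subseteq> A" using a bB(2) by (auto simp: B'_def)
    have fB': "finite B'" using finite_B by (simp add: B'_def)
    \<comment> \<open>Genericity of x yields the span at once, and the unchanged cardinality then
      makes the pivoted set a basis.\<close>
    have sp: "span B' = UNIV" using assms(3) nonneg_comb_in_span[OF xB'] B'A unfolding generic_def by blast
    have "card B' = card B" unfolding B'_def using aB b0(1) finite_B
      by (simp add: card_insert_if card_Diff_singleton) (metis Suc_pred card_gt_0_iff empty_iff)
    then have "card B' = DIM('a)" using independent_spanning_card[OF indep spanning] by simp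
    then have "independent B'" using dependent_spanning_card[OF fB' sp] by fastforce
    then have B'F: "B' \<in> F" using sp B'A xB' unfolding F_def bases_in_def by blast
    then interpret b': vector_basis B' using bases_inD unfolding F_def by blast
    have "basis_value \<omega> B' x = (\<Sum>b\<in>B'. c b * \<omega> b)" by (rule b'.basis_value_eq[OF x])
    also have "\<dots> = t * \<omega> a + (\<Sum>b\<in>B. (?l b - t * ?\<alpha> b) * \<omega> b)" using sumc[of \<omega>] by simp
    also have "\<dots> = basis_value \<omega> B x + t * (\<omega> a - basis_value \<omega> B a)"
      unfolding basis_value_def by (simp add: algebra_simps sum_subtractf sum_distrib_left)
    also have "\<dots> < basis_value \<omega> B x" using less t(3) by (simp add: mult_less_0_iff)
    finally show False using B(2)[OF B'F] by simp
  qed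
  then show ?thesis using bB unfolding optimal_bases_def by blast
qed

text \<open>One generic interior direction \<xi> serves both halves: x is in the cone iff its shift
  by a small positive multiple of \<xi> is, and x is in the interior iff the opposite shift is in
  the cone. Shifted points are generic, so exactly one optimal cone contains them. Replacing \<xi>
  by its negative complements \<open>J B\<close> in \<open>B\<close>, which is the source of
  reciprocity.\<close>

lemma half_open_decomposition:
  assumes "finite A" "\<And>a. a \<in> A \<Longrightarrow> ht a = 1" "span A = UNIV"
  obtains T J where "T \<subseteq> bases_in A"
    "\<And>x B. B \<in> T \<Longrightarrow> x \<in> half_open_cone B (J B) \<Longrightarrow> x \<in> nonneg_comb A"
    "\<And>x. x \<in> nonneg_comb A \<Longrightarrow> \<exists>!B. B \<in> T \<and> x \<in> half_open_cone B (J B)"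
    "\<And>x B. B \<in> T \<Longrightarrow> x \<in> half_open_cone B (B - J B) \<Longrightarrow> x \<in> pos_comb A"
    "\<And>x. x \<in> pos_comb A \<Longrightarrow> \<exists>!B. B \<in> T \<and> x \<in> half_open_cone B (B - J B)"
proof -
  obtain \<omega> where \<omega>: "\<And>B a. B \<in> bases_in A \<Longrightarrow> a \<in> A - B \<Longrightarrow> basis_value \<omega> B a \<noteq> \<omega> a"
    using exists_generic_weights[OF assms(1)] by blast
  obtain \<xi> where \<xi>: "\<xi> \<in> pos_comb A" "generic A \<xi>" using exists_generic_pos[OF assms(1,3)] .
  define T where "T = optimal_bases \<omega> A"
  define J where "J B = {b. representation B \<xi> b < 0}" for B
  have Tb: "T \<subseteq> bases_in A" unfolding T_def optimal_bases_def by blast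
  have fT: "finite T" using Tb assms(1) unfolding bases_in_def by (auto intro: finite_subset[OF _ finite_Pow_iff[THEN iffD2]])
  have uniq: "\<exists>!B. B \<in> T \<and> x \<in> nonneg_comb B" if "generic A x" "x \<in> nonneg_comb A" for x
    using optimal_basis_exists[OF assms(1,2) that, of \<omega>] optimal_basis_unique[OF \<omega> that(1)]
    unfolding T_def by (metis subset_antisym)
  have Jc: "half_open_cone B (B - J B) = half_open_cone B {b. representation B (- \<xi>) b < 0}" if B: "B \<in> T" for B
  proof -
    interpret vector_basis B using B Tb bases_inD by blast
    have nz: "representation B \<xi> b \<noteq> 0" if "b \<in> B" for b
      using generic_coord_nonzero[OF \<xi>(2) _ that] B Tb bases_inD by blast
    have "(b \<in> B - J B) = (representation B (- \<xi>) b < 0)" if "b \<in> B" for b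
      using rep_scale[of "-1" \<xi> b] nz[OF that] that by (auto simp: J_def)
    then show ?thesis unfolding half_open_cone_def by auto
  qed
  have ev: "\<forall>\<^sub>F e in at_right 0. generic A (x + e *\<^sub>R \<eta>) \<and>
      (\<forall>B\<in>T. (x + e *\<^sub>R \<eta> \<in> nonneg_comb B) = (x \<in> half_open_cone B {b. representation B \<eta> b < 0})) \<and> 0 < e"
    if "generic A \<eta>" for x \<eta>
    using eventually_generic[OF assms(1) that] eventually_half_open[OF _ that] Tb fT eventually_at_right_less[of "0::real"]
    by (intro eventually_conj eventually_ball_finite) auto
  have nontriv: "at_right (0::real) \<noteq> bot" by simp
  show ?thesis
  proof (rule that[OF Tb, of J])
    fix x B assume B: "B \<in> T" and x: "x \<in> half_open_cone B (J B)"
    interpret vector_basis B using B Tb bases_inD by blast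
    have "x \<in> nonneg_comb B" using x unfolding nonneg_comb_iff half_open_cone_def by blast
    then show "x \<in> nonneg_comb A" using nonneg_comb_mono[OF assms(1)] B Tb bases_inD by blast
  next
    fix x assume x: "x \<in> nonneg_comb A"
    obtain e where e: "generic A (x + e *\<^sub>R \<xi>)" "0 < e"
      "\<forall>B\<in>T. (x + e *\<^sub>R \<xi> \<in> nonneg_comb B) = (x \<in> half_open_cone B {b. representation B \<xi> b < 0})"
      using eventually_happens'[OF nontriv ev[OF \<xi>(2), of x]] by blast
    have "x + e *\<^sub>R \<xi> \<in> nonneg_comb A" using e(2)
      by (intro nonneg_comb_add[OF x] nonneg_comb_scale pos_comb_imp_nonneg[OF \<xi>(1)]) auto
    moreover have "(B \<in> T \<and> x + e *\<^sub>R \<xi> \<in> nonneg_comb B) = (B \<in> T \<and> x \<in> half_open_cone B (J B))" for B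
      using e(3) unfolding J_def by blast
    ultimately show "\<exists>!B. B \<in> T \<and> x \<in> half_open_cone B (J B)" using uniq[OF e(1)] by simp
  next
    fix x B assume B: "B \<in> T" and x: "x \<in> half_open_cone B (B - J B)"
    obtain e where e: "0 < e"
      "\<forall>B\<in>T. (x + e *\<^sub>R (- \<xi>) \<in> nonneg_comb B) = (x \<in> half_open_cone B {b. representation B (- \<xi>) b < 0})"
      using eventually_happens'[OF nontriv ev[OF generic_uminus[OF \<xi>(2)], of x]] by blast
    then have "x + e *\<^sub>R (- \<xi>) \<in> nonneg_comb B" using B x Jc[OF B] by simp
    then have "x + e *\<^sub>R (- \<xi>) \<in> nonneg_comb A" using nonneg_comb_mono[OF assms(1)] B Tb bases_inD by blast
    then have "e *\<^sub>R \<xi> + (x + e *\<^sub>R (- \<xi>)) \<in> pos_comb A" using \<xi>(1) e(1) by (intro pos_comb_add_nonneg pos_comb_scale)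
    then show "x \<in> pos_comb A" by simp
  next
    fix x assume x: "x \<in> pos_comb A"
    obtain e0 where e0: "0 < e0" "\<And>t. \<bar>t\<bar> \<le> e0 \<Longrightarrow> x + t *\<^sub>R (- \<xi>) \<in> pos_comb A"
      using pos_comb_absorb[OF assms(1) x, of "- \<xi>"] assms(3) by auto
    have "\<forall>\<^sub>F e in at_right 0. e < e0" using e0(1) by (auto simp: eventually_at_right_field intro!: exI[of _ e0])
    with ev[OF generic_uminus[OF \<xi>(2)], of x]
    have ev2: "\<forall>\<^sub>F e in at_right 0. (generic A (x + e *\<^sub>R (- \<xi>)) \<and>
      (\<forall>B\<in>T. (x + e *\<^sub>R (- \<xi>) \<in> nonneg_comb B) = (x \<in> half_open_cone B {b. representation B (- \<xi>) b < 0})) \<and> 0 < e) \<and> e < e0"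
      by (rule eventually_conj)
    obtain e where e: "generic A (x + e *\<^sub>R (- \<xi>))" "0 < e" "e < e0"
      "\<forall>B\<in>T. (x + e *\<^sub>R (- \<xi>) \<in> nonneg_comb B) = (x \<in> half_open_cone B {b. representation B (- \<xi>) b < 0})"
      using eventually_happens'[OF nontriv ev2] by blast
    have "x + e *\<^sub>R (- \<xi>) \<in> nonneg_comb A" using e0(2)[of e] e(2,3) pos_comb_imp_nonneg by simp
    moreover have "(B \<in> T \<and> x + e *\<^sub>R (- \<xi>) \<in> nonneg_comb B) = (B \<in> T \<and> x \<in> half_open_cone B (B - J B))" for B
      using e(4) Jc[of B] by blast
    ultimately show "\<exists>!B. B \<in> T \<and> x \<in> half_open_cone B (B - J B)" using uniq[OF e(1)] by simp
  qed
qed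

section \<open>Hilbert series of half-open cones and boxes\<close>

definition graded_series :: "'a set \<Rightarrow> int fps" where
  "graded_series S = Abs_fps (\<lambda>k. int (card {x \<in> S. ht x = real k}))"

lemma finite_graded_piece:
  assumes "finite A" "\<And>a. a \<in> A \<Longrightarrow> ht a = 1"
  shows "finite {x \<in> L \<inter> nonneg_comb A. ht x = t}"
proof -
  have "bounded {x \<in> nonneg_comb A. ht x = t}"
  proof (rule boundedI)
    fix x assume "x \<in> {x \<in> nonneg_comb A. ht x = t}"
    then obtain c where c: "\<And>a. a \<in> A \<Longrightarrow> 0 \<le> c a" "x = lincomb c A" and t: "ht x = t"
      unfolding nonneg_comb_def by blast
    have "sum c A = t" using t assms(2) unfolding c(2) by simp
    then have ct: "c a \<le> t" if "a \<in> A" for a using member_le_sum[OF that _ assms(1), of c] c(1) by auto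
    have "norm x \<le> (\<Sum>a\<in>A. norm (c a *\<^sub>R a))" unfolding c(2) by (rule norm_sum)
    also have "\<dots> \<le> (\<Sum>a\<in>A. t * norm a)" using c(1) ct by (intro sum_mono) (auto intro: mult_right_mono)
    finally show "norm x \<le> (\<Sum>a\<in>A. t * norm a)" .
  qed
  then have "finite (L \<inter> {x \<in> nonneg_comb A. ht x = t})" by (rule finite_L_bounded)
  then show ?thesis by (rule finite_subset[rotated]) auto
qed

text \<open>For \<open>K \<subseteq> B\<close>, the coordinates in \<open>K\<close> are confined to
  a unit interval, [0,1) off \<open>J\<close> and (0,1] on \<open>J\<close>. The set
  \<open>K\<close> interpolates between the half-open cone, for \<open>K = {}\<close>, and the
  fundamental parallelepiped, for \<open>K = B\<close>.\<close>

definition half_open_box :: "'a set \<Rightarrow> 'a set \<Rightarrow> 'a set \<Rightarrow> 'a set" where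
  "half_open_box B J K =
    {x \<in> L \<inter> half_open_cone B J. \<forall>b\<in>K. representation B x b < 1 \<or> (b \<in> J \<and> representation B x b = 1)}"

text \<open>Confining one more coordinate b removes exactly the translate by b of the set before
  confinement; since b has height 1, the series is multiplied by \<open>1 - fps_X\<close>.\<close>

lemma half_open_box_series:
  assumes "vector_basis B" "B \<subseteq> L" "\<And>b. b \<in> B \<Longrightarrow> ht b = 1" "K \<subseteq> B"
  shows "graded_series (half_open_box B J K) = (1 - fps_X) ^ card K * graded_series (L \<inter> half_open_cone B J)"
proof -
  interpret vector_basis B by (rule assms(1))
  let ?S = "half_open_box B J"
  have htx: "ht x = (\<Sum>b\<in>B. representation B x b)" for x
  proof -
    have "ht (\<Sum>b\<in>B. representation B x b *\<^sub>R b) = (\<Sum>b\<in>B. representation B x b)" using assms(3) by simp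
    then show ?thesis by (simp add: rep_sum)
  qed
  have fin: "finite {x \<in> ?S K. ht x = t}" for K t
    by (rule finite_subset[OF _ finite_graded_piece[OF finite_B assms(3), of t]])
       (auto simp: half_open_box_def half_open_cone_def nonneg_comb_iff)
  have step: "graded_series (?S (insert b K)) = (1 - fps_X) * graded_series (?S K)" if b: "b \<in> B" "b \<notin> K" for b K
  proof (rule fps_ext)
    fix k
    let ?P = "\<lambda>K t. {x \<in> ?S K. ht x = t}"
    have split: "?P K t = ?P (insert b K) t \<union> (\<lambda>x. x + b) ` ?P K (t - 1)" for t
    proof (intro subset_antisym subsetI)
      fix x assume x: "x \<in> ?P K t"
      show "x \<in> ?P (insert b K) t \<union> (\<lambda>x. x + b) ` ?P K (t - 1)"
      proof (cases "x \<in> ?S (insert b K)")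
        case True then show ?thesis using x by simp
      next
        case False
        then have r: "\<not> representation B x b < 1" "b \<in> J \<Longrightarrow> representation B x b \<noteq> 1" using x by (auto simp: half_open_box_def)
        have "x - b \<in> ?S K" using x r b assms(2) unfolding half_open_box_def half_open_cone_def
          by (force simp: rep_diff rep_basis intro: diff_L)
        moreover have "ht (x - b) = t - 1" using x assms(3)[OF b(1)] by simp
        ultimately have "x - b \<in> ?P K (t - 1)" by simp
        then have "(x - b) + b \<in> (\<lambda>x. x + b) ` ?P K (t - 1)" by (rule imageI)
        then show ?thesis by simp
      qed
    next
      fix x assume "x \<in> ?P (insert b K) t \<union> (\<lambda>x. x + b) ` ?P K (t - 1)"
      then show "x \<in> ?P K t"
      proof
        assume "x \<in> (\<lambda>x. x + b) ` ?P K (t - 1)"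
        then obtain y where y: "x = y + b" "y \<in> ?P K (t - 1)" by blast
        have "b \<in> L" using b assms(2) by blast
        moreover have "0 \<le> representation B x b' \<and> (b' \<in> J \<longrightarrow> 0 < representation B x b')" if "b' \<in> B" for b'
          using y that b by (force simp: half_open_box_def half_open_cone_def rep_add rep_basis)
        moreover have "representation B x b' = representation B y b'" if "b' \<in> K" for b'
          using y that b by (auto simp: rep_add rep_basis)
        ultimately show ?thesis using y assms(3)[OF b(1)] by (simp add: half_open_box_def half_open_cone_def add_L)
      qed (auto simp: half_open_box_def)
    qed
    have disj: "?P (insert b K) t \<inter> (\<lambda>x. x + b) ` ?P K (t - 1) = {}" for t
    proof -
      have False if "y \<in> ?S K" "y + b \<in> ?S (insert b K)" for y
      proof -
        have "representation B y b < 0 \<or> (b \<in> J \<and> representation B y b = 0)"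
          using that(2) b by (simp add: half_open_box_def rep_add rep_basis)
        moreover have "0 \<le> representation B y b \<and> (b \<in> J \<longrightarrow> 0 < representation B y b)"
          using that(1) b by (simp add: half_open_box_def half_open_cone_def)
        ultimately show False by auto
      qed
      then show ?thesis by blast
    qed
    have cd: "card (?P K t) = card (?P (insert b K) t) + card (?P K (t - 1))" for t
      by (subst split, subst card_Un_disjoint) (use fin disj in \<open>auto simp: card_image inj_on_def\<close>)
    \<comment> \<open>Covers the constant coefficient, where the translate would come from height
      -1.\<close>
    have neg: "?P K t = {}" if "t < 0" for t
    proof -
      have "0 \<le> ht x" if "x \<in> ?S K" for x
        unfolding htx using that by (intro sum_nonneg) (auto simp: half_open_box_def half_open_cone_def)
      then show ?thesis using \<open>t < 0\<close> by force
    qed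
    show "graded_series (?S (insert b K)) $ k = ((1 - fps_X) * graded_series (?S K)) $ k"
    proof (cases k)
      case 0
      then show ?thesis using cd[of 0] neg[of "-1"] by (simp add: graded_series_def left_diff_distrib)
    next
      case (Suc m)
      then show ?thesis using cd[of "real k"] by (simp add: graded_series_def left_diff_distrib)
    qed
  qed
  have "finite K" using assms(4) finite_B finite_subset by blast
  then have "graded_series (?S K) = (1 - fps_X) ^ card K * graded_series (?S {})" using assms(4)
  proof (induction K rule: finite_induct)
    case (insert b K)
    then show ?case using step[of b K] by (simp add: mult.assoc)
  qed simp
  moreover have "?S {} = L \<inter> half_open_cone B J" by (auto simp: half_open_box_def)
  ultimately show ?thesis by simp
qed

text \<open>Subtraction from \<open>\<Sum>b\<in>B. b\<close> turns each coordinate s into 1 - s,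
  which exchanges [0,1) with (0,1], that is, \<open>J\<close> with its complement.\<close>

lemma half_open_box_duality:
  assumes "vector_basis B" "B \<subseteq> L" "\<And>b. b \<in> B \<Longrightarrow> ht b = 1"
  shows "card {x \<in> half_open_box B (B - J) B. ht x = real DIM('a) - t} = card {x \<in> half_open_box B J B. ht x = t}"
    and "t > real DIM('a) \<Longrightarrow> {x \<in> half_open_box B J B. ht x = t} = {}"
proof -
  interpret vector_basis B by (rule assms(1))
  have cB: "card B = DIM('a)" by (rule independent_spanning_card[OF indep spanning])
  have sB: "(\<Sum>b\<in>B. b) \<in> L" using assms(2) by (intro sum_L) auto
  have htB: "ht (\<Sum>b\<in>B. b) = real DIM('a)" using assms(3) cB by simp
  have rB: "representation B (\<Sum>b\<in>B. b) b = 1" if "b \<in> B" for b using that by (intro rep_unique) auto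
  have flip: "(\<Sum>b\<in>B. b) - x \<in> half_open_box B (B - J) B" if "x \<in> half_open_box B J B" for x J
  proof -
    have "x \<in> L" using that by (simp add: half_open_box_def)
    then have "(\<Sum>b\<in>B. b) - x \<in> L" using sB by (rule diff_L[rotated])
    moreover have "\<forall>b\<in>B. (0 \<le> representation B x b \<and> (b \<in> J \<longrightarrow> 0 < representation B x b)) \<and>
       (representation B x b < 1 \<or> (b \<in> J \<and> representation B x b = 1))"
      using that by (simp add: half_open_box_def half_open_cone_def)
    ultimately show ?thesis unfolding half_open_box_def half_open_cone_def
      by (simp add: rep_diff rB) (metis diff_ge_0_iff_ge diff_gt_0_iff_gt less_eq_real_def)
  qed
  have inv: "half_open_box B (B - (B - J)) B = half_open_box B J B" by (auto simp: half_open_box_def half_open_cone_def)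
  show "card {x \<in> half_open_box B (B - J) B. ht x = real DIM('a) - t} = card {x \<in> half_open_box B J B. ht x = t}"
  proof (rule bij_betw_same_card[OF bij_betw_byWitness[of _ "\<lambda>x. (\<Sum>b\<in>B. b) - x" "\<lambda>x. (\<Sum>b\<in>B. b) - x"]])
    show "(\<lambda>x. (\<Sum>b\<in>B. b) - x) ` {x \<in> half_open_box B (B - J) B. ht x = real DIM('a) - t} \<subseteq> {x \<in> half_open_box B J B. ht x = t}"
    proof (rule image_subsetI)
      fix x assume "x \<in> {x \<in> half_open_box B (B - J) B. ht x = real DIM('a) - t}"
      then have x: "x \<in> half_open_box B (B - J) B" "ht x = real DIM('a) - t" by blast+
      have "(\<Sum>b\<in>B. b) - x \<in> half_open_box B (B - (B - J)) B" by (rule flip[OF x(1)])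
      moreover have "ht ((\<Sum>b\<in>B. b) - x) = t" using x(2) htB by (simp only: ht_simps(2))
      ultimately show "(\<Sum>b\<in>B. b) - x \<in> {x \<in> half_open_box B J B. ht x = t}" unfolding inv by blast
    qed
    show "(\<lambda>x. (\<Sum>b\<in>B. b) - x) ` {x \<in> half_open_box B J B. ht x = t} \<subseteq> {x \<in> half_open_box B (B - J) B. ht x = real DIM('a) - t}"
    proof (rule image_subsetI)
      fix x assume "x \<in> {x \<in> half_open_box B J B. ht x = t}"
      then have x: "x \<in> half_open_box B J B" "ht x = t" by blast+
      have "ht ((\<Sum>b\<in>B. b) - x) = real DIM('a) - t" using htB x(2) by (simp only: ht_simps(2))
      then show "(\<Sum>b\<in>B. b) - x \<in> {x \<in> half_open_box B (B - J) B. ht x = real DIM('a) - t}"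
        using flip[OF x(1)] by blast
    qed
  qed auto
  show "{x \<in> half_open_box B J B. ht x = t} = {}" if "t > real DIM('a)"
  proof -
    have "ht x \<le> real DIM('a)" if "x \<in> half_open_box B J B" for x
    proof -
      have "ht x = ht (\<Sum>b\<in>B. representation B x b *\<^sub>R b)" by (simp add: rep_sum)
      also have "\<dots> = (\<Sum>b\<in>B. representation B x b)" using assms(3) by simp
      also have "\<dots> \<le> (\<Sum>b\<in>B. 1)" using that by (intro sum_mono) (force simp: half_open_box_def)
      finally show ?thesis using cB by simp
    qed
    then show ?thesis using that by force
  qed
qed

text \<open>The number h j counts the lattice points of height j in all half-open boxes of the
  decomposition, and the boxes for the interior are their reflections. For the cone over a polytope
  this is Ehrhart's theorem with Ehrhart-Macdonald reciprocity.\<close>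

theorem series_reciprocity:
  assumes "finite A" "A \<subseteq> L" "\<And>a. a \<in> A \<Longrightarrow> ht a = 1" "span A = UNIV"
  obtains h :: "nat \<Rightarrow> int" where
    "\<forall>j>DIM('a). h j = 0"
    "(1 - fps_X) ^ DIM('a) * graded_series (L \<inter> nonneg_comb A) = Abs_fps h"
    "(1 - fps_X) ^ DIM('a) * graded_series (L \<inter> pos_comb A) = Abs_fps (\<lambda>j. if j \<le> DIM('a) then h (DIM('a) - j) else 0)"
proof -
  obtain T J where T: "T \<subseteq> bases_in A"
    "\<And>x B. B \<in> T \<Longrightarrow> x \<in> half_open_cone B (J B) \<Longrightarrow> x \<in> nonneg_comb A"
    "\<And>x. x \<in> nonneg_comb A \<Longrightarrow> \<exists>!B. B \<in> T \<and> x \<in> half_open_cone B (J B)"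
    "\<And>x B. B \<in> T \<Longrightarrow> x \<in> half_open_cone B (B - J B) \<Longrightarrow> x \<in> pos_comb A"
    "\<And>x. x \<in> pos_comb A \<Longrightarrow> \<exists>!B. B \<in> T \<and> x \<in> half_open_cone B (B - J B)"
    using half_open_decomposition[OF assms(1,3,4)] by blast
  have "finite (bases_in A)" unfolding bases_in_def using assms(1) by simp
  then have fT: "finite T" using T(1) finite_subset by blast
  have TB: "vector_basis B" "B \<subseteq> L" "\<And>b. b \<in> B \<Longrightarrow> ht b = 1" if "B \<in> T" for B
    using that T(1) bases_inD assms(2,3) by blast+
  \<comment> \<open>Covers both decompositions: C is the cone with I = J, or the interior with I B =
    B - J B.\<close>
  have series: "(1 - fps_X) ^ DIM('a) * graded_series (L \<inter> C) = (\<Sum>B\<in>T. graded_series (half_open_box B (I B) B))"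
    if C: "C \<subseteq> nonneg_comb A" "\<And>x B. B \<in> T \<Longrightarrow> x \<in> half_open_cone B (I B) \<Longrightarrow> x \<in> C"
      "\<And>x. x \<in> C \<Longrightarrow> \<exists>!B. B \<in> T \<and> x \<in> half_open_cone B (I B)" for C I
  proof -
    have "graded_series (L \<inter> C) = (\<Sum>B\<in>T. graded_series (L \<inter> half_open_cone B (I B)))"
    proof (rule fps_ext)
      fix k
      have "{x \<in> L \<inter> C. ht x = real k} = (\<Union>B\<in>T. {x \<in> L \<inter> half_open_cone B (I B). ht x = real k})"
      proof (intro subset_antisym subsetI)
        fix x assume x: "x \<in> {x \<in> L \<inter> C. ht x = real k}"
        then obtain B where "B \<in> T" "x \<in> half_open_cone B (I B)" using C(3)[of x] by auto
        then show "x \<in> (\<Union>B\<in>T. {x \<in> L \<inter> half_open_cone B (I B). ht x = real k})" using x by auto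
      qed (use C(2) in auto)
      moreover have "card (\<Union>B\<in>T. {x \<in> L \<inter> half_open_cone B (I B). ht x = real k}) =
          (\<Sum>B\<in>T. card {x \<in> L \<inter> half_open_cone B (I B). ht x = real k})"
      proof (rule card_UN_disjoint[OF fT])
        show "\<forall>B\<in>T. finite {x \<in> L \<inter> half_open_cone B (I B). ht x = real k}"
          using C(1,2) by (intro ballI finite_subset[OF _ finite_graded_piece[OF assms(1,3), of "real k"]]) auto
        show "\<forall>B\<in>T. \<forall>B'\<in>T. B \<noteq> B' \<longrightarrow> {x \<in> L \<inter> half_open_cone B (I B). ht x = real k} \<inter>
            {x \<in> L \<inter> half_open_cone B' (I B'). ht x = real k} = {}"
        proof (intro ballI impI, rule ccontr)
          fix B B' assume B: "B \<in> T" "B' \<in> T" "B \<noteq> B'" and "{x \<in> L \<inter> half_open_cone B (I B). ht x = real k} \<inter>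
            {x \<in> L \<inter> half_open_cone B' (I B'). ht x = real k} \<noteq> {}"
          then obtain x where x: "x \<in> half_open_cone B (I B)" "x \<in> half_open_cone B' (I B')" by blast
          have "x \<in> C" by (rule C(2)[OF B(1) x(1)])
          then have "\<exists>!B. B \<in> T \<and> x \<in> half_open_cone B (I B)" by (rule C(3))
          then show False using B x by auto
        qed
      qed
      ultimately show "graded_series (L \<inter> C) $ k = (\<Sum>B\<in>T. graded_series (L \<inter> half_open_cone B (I B))) $ k"
        by (simp add: graded_series_def fps_sum_nth)
    qed
    moreover have "(1 - fps_X) ^ DIM('a) * graded_series (L \<inter> half_open_cone B (I B)) = graded_series (half_open_box B (I B) B)" if B: "B \<in> T" for B
    proof -
      interpret vector_basis B by (rule TB(1)[OF B])
      show ?thesis using half_open_box_series[OF TB[OF B] subset_refl, of "I B"]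
        independent_spanning_card[OF indep spanning] by simp
    qed
    ultimately show ?thesis by (simp add: sum_distrib_left)
  qed
  define h where "h j = (\<Sum>B\<in>T. int (card {x \<in> half_open_box B (J B) B. ht x = real j}))" for j
  show ?thesis
  proof (rule that[of h])
    show "\<forall>j>DIM('a). h j = 0"
      unfolding h_def
    proof (intro allI impI sum.neutral ballI)
      fix j B assume that: "DIM('a) < j" and B: "B \<in> T"
      show "int (card {x \<in> half_open_box B (J B) B. ht x = real j}) = 0"
        by (subst half_open_box_duality(2)[OF TB[OF B]]) (use that in auto)
    qed
    show "(1 - fps_X) ^ DIM('a) * graded_series (L \<inter> nonneg_comb A) = Abs_fps h"
      by (subst series[OF subset_refl T(2,3)]) (auto simp: fps_eq_iff fps_sum_nth graded_series_def h_def)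
    show "(1 - fps_X) ^ DIM('a) * graded_series (L \<inter> pos_comb A) = Abs_fps (\<lambda>j. if j \<le> DIM('a) then h (DIM('a) - j) else 0)"
    proof (subst series[OF _ T(4,5)])
      show "pos_comb A \<subseteq> nonneg_comb A" using pos_comb_imp_nonneg by blast
      have cnt: "int (card {x \<in> half_open_box B (B - J B) B. ht x = real j}) =
          (if j \<le> DIM('a) then int (card {x \<in> half_open_box B (J B) B. ht x = real (DIM('a) - j)}) else 0)" if B: "B \<in> T" for B j
      proof (cases "j \<le> DIM('a)")
        case True
        then have "real DIM('a) - real (DIM('a) - j) = real j" by (simp add: of_nat_diff)
        then show ?thesis using half_open_box_duality(1)[OF TB[OF B], of "J B" "real (DIM('a) - j)"] True
          by simp
      next
        case False
        then show ?thesis by (subst half_open_box_duality(2)[OF TB[OF B]]) auto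
      qed
      have "(\<Sum>B\<in>T. int (card {x \<in> half_open_box B (B - J B) B. ht x = real j})) = (if j \<le> DIM('a) then h (DIM('a) - j) else 0)" for j
        unfolding h_def by (subst sum.cong[OF refl cnt]) auto
      then show "(\<Sum>B\<in>T. graded_series (half_open_box B (B - J B) B)) = Abs_fps (\<lambda>j. if j \<le> DIM('a) then h (DIM('a) - j) else 0)"
        by (simp add: fps_eq_iff fps_sum_nth graded_series_def)
    qed auto
  qed
qed

end

section \<open>Volume as a limit of lattice point counts\<close>

lemma finite_lattice_points_bounded:
  fixes S :: "(real ^ 'n) set"
  assumes "bounded S" shows "finite (lattice_points \<inter> S)"
proof -
  obtain R where R: "\<And>x. x \<in> S \<Longrightarrow> norm x \<le> R" using assms unfolding bounded_iff by blast
  let ?F = "(\<lambda>f. \<chi> i. of_int (f i)) ` (PiE (UNIV :: 'n set) (\<lambda>_. {-\<lceil>R\<rceil>..\<lceil>R\<rceil>}))"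
  have "x \<in> ?F" if x: "x \<in> lattice_points" "x \<in> S" for x
  proof -
    have xi: "x $ i = of_int \<lfloor>x $ i\<rfloor>" for i using x(1) unfolding lattice_points_def by simp
    have "\<lfloor>x $ i\<rfloor> \<in> {-\<lceil>R\<rceil>..\<lceil>R\<rceil>}" for i
    proof -
      have "\<bar>x $ i\<bar> \<le> R" using component_le_norm_cart[of x i] R[OF x(2)] by linarith
      then have "x $ i \<le> of_int \<lceil>R\<rceil>" "- of_int \<lceil>R\<rceil> \<le> x $ i" using le_of_int_ceiling[of R] by linarith+
      then show ?thesis using xi[of i] by (metis atLeastAtMost_iff of_int_le_iff of_int_minus)
    qed
    moreover have "x = (\<chi> i. of_int \<lfloor>x $ i\<rfloor>)" using xi by (simp add: vec_eq_iff)
    ultimately show ?thesis by (intro image_eqI[of _ _ "\<lambda>i. \<lfloor>x $ i\<rfloor>"]) auto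
  qed
  then have "lattice_points \<inter> S \<subseteq> ?F" by blast
  moreover have "finite ?F" by (intro finite_imageI finite_PiE) auto
  ultimately show ?thesis by (rule finite_subset)
qed

text \<open>For k > 0, the cube of side 1/k with lower corner x/k. It is half-open so that every z
  lies in the cell of exactly one lattice point.\<close>

definition cell :: "real \<Rightarrow> real ^ 'n \<Rightarrow> (real ^ 'n) set" where
  "cell k x = {z. \<forall>i. x $ i \<le> k * z $ i \<and> k * z $ i < x $ i + 1}"

lemma cell_measurable: "cell k x \<in> sets borel"
proof -
  have "cell k x = (\<Inter>i. {z. x $ i \<le> k * z $ i} \<inter> {z. k * z $ i < x $ i + 1})" by (auto simp: cell_def)
  also have "\<dots> \<in> sets borel"
    by (intro sets.countable_INT'' sets.Int borel_closed borel_open closed_Collect_le open_Collect_less continuous_intros) auto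
  finally show ?thesis .
qed

lemma cell_lebesgue: "cell k x \<in> sets lebesgue"
  using cell_measurable[of k x] by (intro sets_completionI_sets) simp

lemma emeasure_cell:
  fixes x :: "real ^ 'n"
  assumes "k > 0" shows "emeasure lebesgue (cell k x) = ennreal ((1 / k) ^ CARD('n))"
proof -
  let ?l = "(1/k) *\<^sub>R x" and ?u = "(1/k) *\<^sub>R x + (\<chi> i. 1 / k)"
  have inner: "(?u - ?l) \<bullet> b = 1 / k" if "b \<in> Basis" for b
    using that by (auto simp: Basis_vec_def inner_axis)
  have le: "?l \<bullet> b \<le> ?u \<bullet> b" if "b \<in> Basis" for b
  proof -
    have "?u \<bullet> b - ?l \<bullet> b = 1 / k" using inner[OF that] by (simp only: inner_diff_left)
    moreover have "0 < 1 / k" using assms by simp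
    ultimately show ?thesis by linarith
  qed
  have "box ?l ?u \<subseteq> cell k x"
    using assms by (auto simp: cell_def mem_box_cart field_simps less_imp_le)
  moreover have "cell k x \<subseteq> cbox ?l ?u"
    using assms by (auto simp: cell_def mem_box_cart field_simps less_imp_le)
  moreover have "emeasure lborel (box ?l ?u) = ennreal ((1 / k) ^ CARD('n))"
    using le inner by (subst emeasure_lborel_box) auto
  moreover have "emeasure lborel (cbox ?l ?u) = ennreal ((1 / k) ^ CARD('n))"
    using le inner by (subst emeasure_lborel_cbox) auto
  moreover have "emeasure lborel (box ?l ?u) \<le> emeasure lborel (cell k x)"
    by (rule emeasure_mono) (use \<open>box ?l ?u \<subseteq> cell k x\<close> cell_measurable in auto)
  moreover have "emeasure lborel (cell k x) \<le> emeasure lborel (cbox ?l ?u)"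
    by (rule emeasure_mono) (use \<open>cell k x \<subseteq> cbox ?l ?u\<close> in auto)
  ultimately have "emeasure lborel (cell k x) = ennreal ((1 / k) ^ CARD('n))" by simp
  then show ?thesis using cell_measurable[of k x] by (simp add: emeasure_completion)
qed

text \<open>Each cell has volume k^-n, so the scaled count is the integral of \<open>f k\<close>,
  and \<open>f k z\<close> tells whether z, rounded down to the grid of mesh 1/k, lies in
  \<open>P\<close>. Off the frontier, a null set by convexity, this tends to the indicator of
  \<open>P\<close>, and dominated convergence applies.\<close>

lemma lattice_count_limit:
  fixes P :: "(real ^ 'n) set"
  assumes "convex P" "bounded P"
  shows "(\<lambda>k. real (card (dilate k P \<inter> lattice_points)) / real k ^ CARD('n)) \<longlonglongrightarrow> measure lebesgue P"
proof -
  let ?n = "CARD('n)"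
  define D where "D k = dilate k P \<inter> lattice_points" for k
  define \<phi> where "\<phi> k z = (\<chi> i. real_of_int \<lfloor>real k * z $ i\<rfloor> / real k)" for k and z :: "real ^ 'n"
  define f where "f k z = (\<Sum>x\<in>D k. indicator (cell (real k) x) z :: real)" for k z
  have bD: "bounded (dilate k P)" for k unfolding dilate_def using assms(2) by (rule bounded_scaling)
  have finD: "finite (D k)" for k unfolding D_def using finite_lattice_points_bounded[OF bD] by (simp add: Int_commute)
  have f_eq: "f k z = indicator P (\<phi> k z)" if k: "k > 0" for k z
  proof -
    define w where "w = (\<chi> i. real_of_int \<lfloor>real k * z $ i\<rfloor>)"
    have "indicator (cell (real k) x) z = (if x = w then 1 else 0 :: real)" if "x \<in> D k" for x
    proof -
      have "(x $ i \<le> real k * z $ i \<and> real k * z $ i < x $ i + 1) \<longleftrightarrow> x $ i = w $ i" for i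
      proof -
        obtain m where m: "x $ i = of_int m" using \<open>x \<in> D k\<close> unfolding D_def lattice_points_def by (auto elim: Ints_cases)
        have "\<lfloor>real k * z $ i\<rfloor> = m \<longleftrightarrow> of_int m \<le> real k * z $ i \<and> real k * z $ i < of_int m + 1" by (rule floor_eq_iff)
        then show ?thesis unfolding m w_def by auto
      qed
      then have "z \<in> cell (real k) x \<longleftrightarrow> x = w" unfolding cell_def vec_eq_iff by simp
      then show ?thesis by (simp add: indicator_def)
    qed
    then have "f k z = (\<Sum>x\<in>D k. if x = w then 1 else 0)" unfolding f_def by (intro sum.cong) auto
    also have "\<dots> = (if w \<in> D k then 1 else 0)" using finD by simp
    also have "w \<in> D k \<longleftrightarrow> \<phi> k z \<in> P"
    proof -
      have "\<phi> k z = (1 / real k) *\<^sub>R w" by (simp add: \<phi>_def w_def vec_eq_iff)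
      moreover have "w \<in> lattice_points" by (simp add: w_def lattice_points_def)
      moreover have "w \<in> dilate k P \<longleftrightarrow> (1 / real k) *\<^sub>R w \<in> P"
      proof
        assume "w \<in> dilate k P" then show "(1 / real k) *\<^sub>R w \<in> P" using k by (auto simp: dilate_def)
      next
        assume "(1 / real k) *\<^sub>R w \<in> P"
        then show "w \<in> dilate k P" unfolding dilate_def using k by (intro image_eqI[of _ _ "(1 / real k) *\<^sub>R w"]) auto
      qed
      ultimately show ?thesis by (simp add: D_def)
    qed
    finally show ?thesis by (simp add: indicator_def)
  qed
  have \<phi>_near: "norm (\<phi> k z - z) \<le> real ?n / real k" if k: "k > 0" for k z
  proof -
    have "\<bar>(\<phi> k z - z) $ i\<bar> \<le> 1 / real k" for i
    proof -
      have "\<bar>real_of_int \<lfloor>real k * z $ i\<rfloor> - real k * z $ i\<bar> \<le> 1" by linarith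
      then have "\<bar>real_of_int \<lfloor>real k * z $ i\<rfloor> - real k * z $ i\<bar> / real k \<le> 1 / real k" by (rule divide_right_mono) simp
      also have "\<bar>real_of_int \<lfloor>real k * z $ i\<rfloor> - real k * z $ i\<bar> / real k = \<bar>(\<phi> k z - z) $ i\<bar>"
        using k by (simp add: \<phi>_def abs_divide[symmetric] field_simps)
      finally show ?thesis .
    qed
    then have "(\<Sum>i\<in>UNIV. \<bar>(\<phi> k z - z) $ i\<bar>) \<le> (\<Sum>i\<in>(UNIV::'n set). 1 / real k)" by (intro sum_mono) auto
    then show ?thesis using norm_le_l1_cart[of "\<phi> k z - z"] by simp
  qed
  have \<phi>_lim: "(\<lambda>k. \<phi> (Suc k) z) \<longlonglongrightarrow> z" for z
  proof (rule Lim_transform_bound[where g = "\<lambda>k. real ?n / real (Suc k)", THEN LIM_zero_cancel[of "\<lambda>k. \<phi> (Suc k) z" z]])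
    show "\<forall>\<^sub>F k in sequentially. norm (\<phi> (Suc k) z - z) \<le> norm (real ?n / real (Suc k))"
      using \<phi>_near by (intro always_eventually allI) (auto simp del: of_nat_Suc)
    show "(\<lambda>k. real ?n / real (Suc k)) \<longlonglongrightarrow> 0"
      using LIMSEQ_Suc[OF lim_const_over_n[of "real ?n"]] by simp
  qed
  obtain R where R: "\<And>x. x \<in> P \<Longrightarrow> norm x \<le> R" using assms(2) unfolding bounded_iff by blast
  have Pm: "P \<in> lmeasurable" using assms by (rule measurable_convex)
  have lim: "(\<lambda>k. \<integral>z. f (Suc k) z \<partial>lebesgue) \<longlonglongrightarrow> (\<integral>z. indicator P z \<partial>lebesgue)"
  proof (rule integral_dominated_convergence[where w = "indicator (cball 0 (R + real ?n))"])
    show "indicator P \<in> borel_measurable lebesgue" using Pm by auto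
    show "f (Suc k) \<in> borel_measurable lebesgue" for k
      unfolding f_def by (intro borel_measurable_sum borel_measurable_indicator cell_lebesgue)
    show "integrable lebesgue (indicator (cball 0 (R + real ?n) :: (real ^ 'n) set) :: _ \<Rightarrow> real)"
      using lmeasurable_cball by (simp only: lmeasurable_iff_integrable[symmetric])
    show "AE z in lebesgue. (\<lambda>k. f (Suc k) z) \<longlonglongrightarrow> indicator P z"
    proof (rule AE_I')
      show "frontier P \<in> null_sets lebesgue"
        using negligible_convex_frontier[OF assms(1)] negligible_iff_null_sets by blast
      show "{z \<in> space lebesgue. \<not> (\<lambda>k. f (Suc k) z) \<longlonglongrightarrow> indicator P z} \<subseteq> frontier P"
      proof (clarify, rule ccontr)
        fix z assume nl: "\<not> (\<lambda>k. f (Suc k) z) \<longlonglongrightarrow> indicator P z" and nf: "z \<notin> frontier P"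
        have "\<forall>\<^sub>F k in sequentially. f (Suc k) z = indicator P z"
        proof (cases "z \<in> interior P")
          case True
          have "\<forall>\<^sub>F k in sequentially. \<phi> (Suc k) z \<in> interior P"
            by (rule topological_tendstoD[OF \<phi>_lim open_interior True])
          then show ?thesis using True interior_subset[of P]
            by (elim eventually_mono) (auto simp: f_eq indicator_def)
        next
          case False
          then have zc: "z \<in> - closure P" using nf by (simp add: frontier_def)
          have "\<forall>\<^sub>F k in sequentially. \<phi> (Suc k) z \<in> - closure P"
            by (rule topological_tendstoD[OF \<phi>_lim _ zc]) auto
          then show ?thesis using zc closure_subset[of P]
            by (elim eventually_mono) (auto simp: f_eq indicator_def)
        qed
        then have "(\<lambda>k. f (Suc k) z) \<longlonglongrightarrow> indicator P z" by (rule tendsto_eventually)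
        with nl show False by blast
      qed
    qed
    \<comment> \<open>Rounding moves z by at most n/k, hence by at most n, which explains the radius
      of the dominating ball.\<close>
    show "AE z in lebesgue. norm (f (Suc k) z) \<le> indicator (cball 0 (R + real ?n)) z" for k
    proof (rule AE_I2)
      fix z :: "real ^ 'n"
      have "norm z \<le> R + real ?n" if "\<phi> (Suc k) z \<in> P"
      proof -
        have "norm (\<phi> (Suc k) z - z) \<le> real ?n / real (Suc k)" by (rule \<phi>_near) simp
        also have "\<dots> \<le> real ?n" by (simp add: divide_le_eq)
        finally show ?thesis using R[OF that] norm_triangle_ineq2[of z "\<phi> (Suc k) z"] by (simp add: norm_minus_commute)
      qed
      then show "norm (f (Suc k) z) \<le> indicator (cball 0 (R + real ?n)) z" by (auto simp: f_eq indicator_def)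
    qed
  qed
  have "(\<integral>z. f (Suc k) z \<partial>lebesgue) = real (card (D (Suc k))) / real (Suc k) ^ ?n" for k
  proof -
    have cellm: "cell (real (Suc k)) x \<in> sets lebesgue" for x :: "real ^ 'n" by (rule cell_lebesgue)
    have em: "emeasure lebesgue (cell (real (Suc k)) x) = ennreal ((1 / real (Suc k)) ^ ?n)" for x :: "real ^ 'n"
      by (rule emeasure_cell) simp
    have "(\<integral>z. f (Suc k) z \<partial>lebesgue) = (\<Sum>x\<in>D (Suc k). \<integral>z. indicator (cell (real (Suc k)) x) z \<partial>lebesgue)"
      unfolding f_def using cellm em
      by (intro Bochner_Integration.integral_sum integrable_real_indicator) (auto simp del: of_nat_Suc)
    also have "\<dots> = (\<Sum>x\<in>D (Suc k). (1 / real (Suc k)) ^ ?n)"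
      using cellm em by (intro sum.cong) (auto simp: measure_def simp del: of_nat_Suc)
    finally show ?thesis by (simp add: power_divide del: of_nat_Suc)
  qed
  moreover have "(\<integral>z. indicator P z \<partial>lebesgue) = measure lebesgue P" using Pm by simp
  ultimately have "(\<lambda>k. real (card (D (Suc k))) / real (Suc k) ^ ?n) \<longlonglongrightarrow> measure lebesgue P" using lim by simp
  then show ?thesis unfolding D_def by (rule LIMSEQ_imp_Suc)
qed

section \<open>From h-star to the volume\<close>

lemma binomial_series_inverse:
  "(1 - fps_X) ^ (n + 1) * Abs_fps (\<lambda>k. int ((k + n) choose n)) = 1"
proof (induction n)
  case 0
  show ?case
  proof (rule fps_ext)
    fix k show "((1 - fps_X) ^ (0 + 1) * Abs_fps (\<lambda>k. int ((k + 0) choose 0))) $ k = (1 :: int fps) $ k"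
      by (cases k) (auto simp: left_diff_distrib)
  qed
next
  case (Suc n)
  have "(1 - fps_X) * Abs_fps (\<lambda>k. int ((k + Suc n) choose Suc n)) = Abs_fps (\<lambda>k. int ((k + n) choose n))"
  proof (rule fps_ext)
    fix k show "((1 - fps_X) * Abs_fps (\<lambda>k. int ((k + Suc n) choose Suc n))) $ k = Abs_fps (\<lambda>k. int ((k + n) choose n)) $ k"
      by (cases k) (auto simp: left_diff_distrib)
  qed
  note step = this
  have "(1 - fps_X) ^ (Suc n + 1) * Abs_fps (\<lambda>k. int ((k + Suc n) choose Suc n)) =
      (1 - fps_X) ^ (n + 1) * ((1 - fps_X) * Abs_fps (\<lambda>k. int ((k + Suc n) choose Suc n)))"
    by (simp only: add_Suc power_Suc mult.assoc mult.left_commute)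
  then show ?case by (simp only: step Suc)
qed

lemma binomial_asymptotics:
  "(\<lambda>k. real ((k - j + n) choose n) / real k ^ n) \<longlonglongrightarrow> 1 / fact n"
proof -
  have eq: "\<forall>\<^sub>F k in sequentially. (\<Prod>i = 0..<n. (1 + (real n - real j - real i) / real k) / real (n - i)) =
      real ((k - j + n) choose n) / real k ^ n"
    using eventually_gt_at_top[of j]
  proof eventually_elim
    case (elim k)
    have "real ((k - j + n) choose n) = (\<Prod>i = 0..<n. real (k - j + n - i) / real (n - i))"
      by (rule binomial_altdef_of_nat) simp
    also have "\<dots> = (\<Prod>i = 0..<n. real k * ((1 + (real n - real j - real i) / real k) / real (n - i)))"
      using elim by (intro prod.cong) (auto simp: of_nat_diff field_simps)
    also have "\<dots> = real k ^ n * (\<Prod>i = 0..<n. (1 + (real n - real j - real i) / real k) / real (n - i))"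
      by (simp only: prod.distrib) simp
    finally show ?case using elim by simp
  qed
  have "(\<lambda>k. \<Prod>i = 0..<n. (1 + (real n - real j - real i) / real k) / real (n - i)) \<longlonglongrightarrow>
      (\<Prod>i = 0..<n. (1 + 0) / real (n - i))"
    by (intro tendsto_prod tendsto_divide tendsto_add tendsto_const lim_const_over_n) auto
  then have "(\<lambda>k. real ((k - j + n) choose n) / real k ^ n) \<longlonglongrightarrow> (\<Prod>i = 0..<n. (1 + 0) / real (n - i))"
    by (rule Lim_transform_eventually[OF _ eq])
  moreover have "(\<Prod>i = 0..<n. (1 + 0) / real (n - i)) = 1 / fact n"
    by (simp add: prod_dividef fact_prod_rev)
  ultimately show ?thesis by simp
qed

text \<open>Division by (1-t)^(n+1) writes the k-th count as the sum of
  \<open>h j * ((k - j + n) choose n)\<close>. Each binomial coefficient is asymptotic to k^n / n!,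
  so the volume is the sum of h over n!.\<close>

lemma normalized_volume_eq_sum_hstar:
  fixes P :: "(real ^ 'n) set" and h :: "nat \<Rightarrow> int"
  assumes "convex P" "bounded P" "hstar_series P = Abs_fps h" "\<And>j. j > d \<Longrightarrow> h j = 0"
  shows "normalized_volume P = of_int (\<Sum>j\<le>d. h j)"
proof -
  let ?n = "CARD('n)"
  let ?E = "\<lambda>k. card (dilate k P \<inter> lattice_points)"
  have "ehrhart_series P = ((1 - fps_X) ^ (?n + 1) * Abs_fps (\<lambda>k. int ((k + ?n) choose ?n))) * ehrhart_series P"
    by (simp only: binomial_series_inverse mult_1)
  also have "\<dots> = hstar_series P * Abs_fps (\<lambda>k. int ((k + ?n) choose ?n))" unfolding hstar_series_def by (simp only: ac_simps)
  finally have E: "ehrhart_series P = Abs_fps h * Abs_fps (\<lambda>k. int ((k + ?n) choose ?n))" using assms(3) by simp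
  have Ek: "real (?E k) = (\<Sum>j\<le>d. of_int (h j) * real ((k - j + ?n) choose ?n))" if "k \<ge> d" for k
  proof -
    have "int (?E k) = ehrhart_series P $ k" by (simp add: ehrhart_series_def)
    also have "\<dots> = (\<Sum>j=0..k. h j * int ((k - j + ?n) choose ?n))" unfolding E fps_mult_nth by simp
    also have "\<dots> = (\<Sum>j\<le>d. h j * int ((k - j + ?n) choose ?n))"
      using that assms(4) by (intro sum.mono_neutral_right) auto
    finally have "real_of_int (int (?E k)) = real_of_int (\<Sum>j\<le>d. h j * int ((k - j + ?n) choose ?n))" by simp
    then show ?thesis by simp
  qed
  have "(\<lambda>k. \<Sum>j\<le>d. of_int (h j) * (real ((k - j + ?n) choose ?n) / real k ^ ?n)) \<longlonglongrightarrow> (\<Sum>j\<le>d. of_int (h j) * (1 / fact ?n))"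
    by (intro tendsto_sum tendsto_mult tendsto_const binomial_asymptotics)
  moreover have "\<forall>\<^sub>F k in sequentially. (\<Sum>j\<le>d. of_int (h j) * (real ((k - j + ?n) choose ?n) / real k ^ ?n)) = real (?E k) / real k ^ ?n"
    using eventually_ge_at_top[of d] by eventually_elim (simp add: Ek sum_divide_distrib)
  ultimately have "(\<lambda>k. real (?E k) / real k ^ ?n) \<longlonglongrightarrow> (\<Sum>j\<le>d. of_int (h j) * (1 / fact ?n))"
    by (rule Lim_transform_eventually)
  then have "measure lebesgue P = (\<Sum>j\<le>d. of_int (h j) * (1 / fact ?n))"
    using lattice_count_limit[OF assms(1,2)] LIMSEQ_unique by blast
  then show ?thesis unfolding normalized_volume_def by (simp add: sum_distrib_left[symmetric] sum_divide_distrib[symmetric])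
qed

section \<open>Lattice polytopes and their cones\<close>

definition lifted_lattice :: "((real ^ 'n) \<times> real) set" where
  "lifted_lattice = lattice_points \<times> \<int>"

definition lift :: "(real ^ 'n) set \<Rightarrow> ((real ^ 'n) \<times> real) set" where
  "lift A = (\<lambda>v. (v, 1)) ` A"

lemma lattice_points_closed:
  "0 \<in> lattice_points" "x \<in> lattice_points \<Longrightarrow> y \<in> lattice_points \<Longrightarrow> x + y \<in> lattice_points"
  "x \<in> lattice_points \<Longrightarrow> - x \<in> lattice_points" "c \<in> \<int> \<Longrightarrow> x \<in> lattice_points \<Longrightarrow> c *\<^sub>R x \<in> lattice_points"
  by (auto simp: lattice_points_def)

lemma lattice_points_diff: "x \<in> lattice_points \<Longrightarrow> y \<in> lattice_points \<Longrightarrow> x - y \<in> lattice_points"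
  by (auto simp: lattice_points_def)

lemma lattice_points_inner: "x \<in> lattice_points \<Longrightarrow> y \<in> lattice_points \<Longrightarrow> x \<bullet> y \<in> \<int>"
  by (auto simp: lattice_points_def inner_vec_def intro!: Ints_mult)

interpretation lifted: graded_lattice lifted_lattice snd
proof
  fix S :: "((real ^ 'n) \<times> real) set" assume b: "bounded S"
  have "finite (lattice_points \<inter> fst ` S)" using bounded_fst[OF b] by (rule finite_lattice_points_bounded)
  moreover have "finite (\<int> \<inter> snd ` S)"
  proof -
    obtain R where "\<And>x. x \<in> snd ` S \<Longrightarrow> norm x \<le> R" using bounded_snd[OF b] unfolding bounded_iff by blast
    then have "\<int> \<inter> snd ` S \<subseteq> {x \<in> \<int>. \<bar>x\<bar> \<le> R}" by auto
    then show ?thesis using finite_abs_int_segment[of R] finite_subset by blast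
  qed
  ultimately have "finite ((lattice_points \<inter> fst ` S) \<times> (\<int> \<inter> snd ` S))" by (rule finite_cartesian_product)
  then show "finite (lifted_lattice \<inter> S)" by (rule finite_subset[rotated]) (force simp: lifted_lattice_def)
qed (auto simp: lifted_lattice_def lattice_points_closed zero_prod_def intro: linear_snd)

abbreviation cone_series :: "(real ^ 'n) set \<Rightarrow> int fps" where
  "cone_series A \<equiv> lifted.graded_series (lifted_lattice \<inter> nonneg_comb (lift A))"

abbreviation interior_series :: "(real ^ 'n) set \<Rightarrow> int fps" where
  "interior_series A \<equiv> lifted.graded_series (lifted_lattice \<inter> pos_comb (lift A))"

lemma DIM_lifted: "DIM((real ^ 'n) \<times> real) = CARD('n) + 1"
  by simp

lemma snd_lift: "a \<in> lift A \<Longrightarrow> snd a = 1" by (auto simp: lift_def)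

lemma finite_lift: "finite A \<Longrightarrow> finite (lift A)" by (simp add: lift_def)

lemma lift_mono: "A \<subseteq> B \<Longrightarrow> lift A \<subseteq> lift B" by (auto simp: lift_def)

lemma lift_subset_iff: "lift A \<subseteq> lift B \<longleftrightarrow> A \<subseteq> B" by (auto simp: lift_def)

lemma lift_lattice: "A \<subseteq> lattice_points \<Longrightarrow> lift A \<subseteq> lifted_lattice"
  by (auto simp: lift_def lifted_lattice_def)

lemma snd_nonneg_comb_lift: "x \<in> nonneg_comb (lift A) \<Longrightarrow> 0 \<le> snd x"
  using lifted.ht_nonneg_comb[of "lift A" x] snd_lift[of _ A] by blast

lemma nonneg_comb_lift_zero: "finite A \<Longrightarrow> x \<in> nonneg_comb (lift A) \<Longrightarrow> snd x = 0 \<Longrightarrow> x = 0"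
  using lifted.ht_0_nonneg_comb[of "lift A" x] snd_lift[of _ A] finite_lift[of A] by blast

lemma sum_lift: "lincomb c (lift A) = (\<Sum>v\<in>A. c (v, 1) *\<^sub>R v, \<Sum>v\<in>A. c (v, 1))"
proof -
  have "lincomb c (lift A) = (\<Sum>v\<in>A. c (v, 1) *\<^sub>R (v, 1))"
    unfolding lift_def by (subst sum.reindex) (auto simp: inj_on_def)
  then show ?thesis by (simp add: prod_eq_iff fst_sum snd_sum)
qed

section \<open>Slices of the cone: dilates, interiors and counts\<close>

lemma nonneg_comb_lift_iff:
  assumes "finite A" "0 < t"
  shows "(y, t) \<in> nonneg_comb (lift A) \<longleftrightarrow> (1 / t) *\<^sub>R y \<in> convex hull A"
proof
  assume "(y, t) \<in> nonneg_comb (lift A)"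
  then obtain c where c: "\<And>a. a \<in> lift A \<Longrightarrow> 0 \<le> c a" "(y, t) = lincomb c (lift A)"
    unfolding nonneg_comb_def by blast
  have "y = (\<Sum>v\<in>A. c (v, 1) *\<^sub>R v)" "t = (\<Sum>v\<in>A. c (v, 1))" using c(2) unfolding sum_lift by auto
  moreover have "\<forall>v\<in>A. 0 \<le> c (v, 1)" using c(1) by (auto simp: lift_def)
  ultimately show "(1 / t) *\<^sub>R y \<in> convex hull A" unfolding convex_hull_finite[OF assms(1)] using assms(2)
    by (auto intro!: exI[of _ "\<lambda>v. c (v, 1) / t"] simp: scaleR_sum_right sum_divide_distrib[symmetric])
next
  assume "(1 / t) *\<^sub>R y \<in> convex hull A"
  then obtain c where c: "\<forall>v\<in>A. 0 \<le> c v" "sum c A = 1" "lincomb c A = (1 / t) *\<^sub>R y"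
    unfolding convex_hull_finite[OF assms(1)] by blast
  have "y = t *\<^sub>R ((1 / t) *\<^sub>R y)" using assms(2) by simp
  then have "y = (\<Sum>v\<in>A. (t * c v) *\<^sub>R v)" unfolding c(3)[symmetric] by (simp add: scaleR_sum_right)
  moreover have "t = (\<Sum>v\<in>A. t * c v)" using c(2) by (simp add: sum_distrib_left[symmetric])
  ultimately have "(y, t) = (\<Sum>a\<in>lift A. (t * c (fst a)) *\<^sub>R a)" by (simp add: sum_lift)
  moreover have "0 \<le> t * c (fst a)" if "a \<in> lift A" for a using c(1) assms(2) that by (auto simp: lift_def)
  ultimately show "(y, t) \<in> nonneg_comb (lift A)" by (rule nonneg_combI[rotated])
qed

lemma dilate_0: "P \<noteq> {} \<Longrightarrow> dilate 0 P = {0}"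
  by (simp add: dilate_def image_constant_conv)

text \<open>Nonemptiness matters at \<open>k = 0\<close>: the cone always contains 0, whereas a
  dilate of the empty set is empty.\<close>

lemma nonneg_comb_lift_dilate:
  assumes "finite A" "A \<noteq> {}"
  shows "(y, real k) \<in> nonneg_comb (lift A) \<longleftrightarrow> y \<in> dilate k (convex hull A)"
proof (cases "k = 0")
  case True
  have "y = 0" if "(y, 0) \<in> nonneg_comb (lift A)"
    using nonneg_comb_lift_zero[OF assms(1) that] by (simp add: zero_prod_def)
  moreover have "dilate 0 (convex hull A) = {0}" using assms(2) by (simp add: dilate_0)
  moreover have "(0, 0) \<in> nonneg_comb (lift A)" using zero_in_nonneg_comb[of "lift A"] by (simp add: zero_prod_def)
  ultimately show ?thesis using True by auto
next
  case False
  then have "y \<in> dilate k (convex hull A) \<longleftrightarrow> (1 / real k) *\<^sub>R y \<in> convex hull A"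
    by (auto simp: dilate_def intro!: image_eqI[of _ _ "(1 / real k) *\<^sub>R y"])
  then show ?thesis using nonneg_comb_lift_iff[OF assms(1), of "real k" y] False by simp
qed

lemma span_lift_iff:
  fixes A :: "(real ^ 'n) set"
  assumes "finite A"
  shows "span (lift A) = UNIV \<longleftrightarrow> affine hull A = UNIV"
proof
  assume sp: "span (lift A) = UNIV"
  show "affine hull A = UNIV"
  proof (rule set_eqI, simp)
    fix y :: "real ^ 'n"
    have "(y, 1) \<in> span (lift A)" using sp by simp
    then obtain c where "(y, 1) = lincomb c (lift A)" using span_finite[OF finite_lift[OF assms]] by auto
    then have "y = (\<Sum>v\<in>A. c (v, 1) *\<^sub>R v)" "(\<Sum>v\<in>A. c (v, 1)) = 1" unfolding sum_lift by auto
    then show "y \<in> affine hull A" unfolding affine_hull_finite[OF assms] by auto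
  qed
next
  assume af: "affine hull A = UNIV"
  have 1: "(y, 1) \<in> span (lift A)" for y
  proof -
    obtain c where "sum c A = 1" "lincomb c A = y" using af unfolding affine_hull_finite[OF assms] by blast
    then have "(y, 1) = (\<Sum>a\<in>lift A. c (fst a) *\<^sub>R a)" by (simp add: sum_lift)
    also have "\<dots> \<in> span (lift A)" by (intro span_sum span_scale span_base)
    finally show ?thesis .
  qed
  have "(y, t) \<in> span (lift A)" for y t
  proof -
    have "(y, t) = t *\<^sub>R (0, 1) + ((y, 1) - (0, 1))" by simp
    also have "\<dots> \<in> span (lift A)" by (intro span_add span_diff span_scale 1)
    finally show ?thesis .
  qed
  then show "span (lift A) = UNIV" by auto
qed

lemma full_lattice_polytope_iff:
  fixes A :: "(real ^ 'n) set"
  assumes "finite A" "A \<subseteq> lattice_points"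
  shows "full_lattice_polytope (convex hull A) \<longleftrightarrow> span (lift A) = UNIV"
proof -
  have "lattice_polytope (convex hull A)" unfolding lattice_polytope_def using assms by blast
  moreover have "aff_dim (convex hull A) = int CARD('n) \<longleftrightarrow> affine hull A = UNIV"
    using aff_dim_eq_full[of A] by (simp add: aff_dim_convex_hull)
  ultimately show ?thesis unfolding full_lattice_polytope_def span_lift_iff[OF assms(1)] by blast
qed

lemma interior_dilate:
  assumes "0 < r" shows "interior (dilate r P) = dilate r (interior P)"
  unfolding dilate_def using assms
  by (intro interior_injective_linear_image) (auto simp: inj_on_def linear_scaleR)

text \<open>From an interior m one can move a little further away from the barycentre of
  \<open>A\<close> scaled by r. Then \<open>(m, real r)\<close> is a positive mixture of the point
  reached and of the sum of all generators, so every generator gets positive weight. The converse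
  uses that relative interior is interior in full dimension.\<close>

lemma pos_comb_lift_interior:
  fixes A :: "(real ^ 'n) set"
  assumes "finite A" "span (lift A) = UNIV" "0 < r"
  shows "m \<in> interior (dilate r (convex hull A)) \<longleftrightarrow> (m, real r) \<in> pos_comb (lift A)"
proof
  assume m: "m \<in> interior (dilate r (convex hull A))"
  have A0: "A \<noteq> {}" using m by (auto simp: dilate_def)
  define s where "s = (\<Sum>v\<in>A. v)"
  define N where "N = real (card A)"
  have N: "N > 0" using A0 assms(1) by (simp add: N_def card_gt_0_iff)
  define v where "v = m - (real r / N) *\<^sub>R s"
  obtain e where e: "e > 0" "ball m e \<subseteq> dilate r (convex hull A)" using m mem_interior by blast
  define d where "d = e / (2 * (norm v + 1))"
  have d: "d > 0" using e(1) by (simp add: d_def add_nonneg_pos)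
  have "norm (d *\<^sub>R v) < e"
  proof -
    have "norm (d *\<^sub>R v) = e * (norm v / (2 * (norm v + 1)))" using e(1) by (simp add: d_def abs_of_pos)
    also have "\<dots> < e * 1"
    proof (rule mult_strict_left_mono[OF _ e(1)])
      have "x / (2 * (x + 1)) < 1" if "0 \<le> x" for x :: real using that by (simp add: divide_less_eq)
      then show "norm v / (2 * (norm v + 1)) < 1" using norm_ge_zero by blast
    qed
    finally show ?thesis by simp
  qed
  then have "m + d *\<^sub>R v \<in> ball m e" by (simp add: dist_norm)
  then have "(m + d *\<^sub>R v, real r) \<in> nonneg_comb (lift A)"
    using e(2) nonneg_comb_lift_dilate[OF assms(1) A0] by blast
  moreover have "(s, N) \<in> pos_comb (lift A)"
    using sum_in_pos_comb[of "lift A"] sum_lift[of "\<lambda>_. 1" A] by (simp add: s_def N_def)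
  ultimately have "(1 / (1 + d)) *\<^sub>R ((d * (real r / N)) *\<^sub>R (s, N) + (m + d *\<^sub>R v, real r)) \<in> pos_comb (lift A)"
    using d N assms(3) by (intro pos_comb_scale pos_comb_add_nonneg) auto
  moreover have "(d * (real r / N)) *\<^sub>R (s, N) + (m + d *\<^sub>R v, real r) = (1 + d) *\<^sub>R (m, real r)"
    using N by (simp add: v_def algebra_simps)
  ultimately show "(m, real r) \<in> pos_comb (lift A)" using d by simp
next
  assume "(m, real r) \<in> pos_comb (lift A)"
  then obtain c where c: "\<And>a. a \<in> lift A \<Longrightarrow> 0 < c a" "(m, real r) = lincomb c (lift A)"
    unfolding pos_comb_def by blast
  have m: "m = (\<Sum>v\<in>A. c (v, 1) *\<^sub>R v)" "real r = (\<Sum>v\<in>A. c (v, 1))" using c(2) unfolding sum_lift by auto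
  have "(1 / real r) *\<^sub>R m \<in> {y. \<exists>u. (\<forall>x\<in>A. 0 < u x) \<and> sum u A = 1 \<and> lincomb u A = y}"
    using c(1) assms(3) m(2)[symmetric]
    by (auto simp: m(1) lift_def scaleR_sum_right sum_divide_distrib[symmetric] intro!: exI[of _ "\<lambda>v. c (v, 1) / real r"])
  then have "(1 / real r) *\<^sub>R m \<in> rel_interior (convex hull A)"
    using explicit_subset_rel_interior_convex_hull_minimal[OF assms(1)] by blast
  moreover have "affine hull (convex hull A) = UNIV"
    using assms(2) span_lift_iff[OF assms(1)] by (simp add: affine_hull_convex_hull)
  ultimately have "(1 / real r) *\<^sub>R m \<in> interior (convex hull A)" by (simp add: rel_interior_interior)
  then show "m \<in> interior (dilate r (convex hull A))" unfolding interior_dilate[OF assms(3)]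
    unfolding dilate_def using assms(3) by (intro image_eqI[of _ _ "(1 / real r) *\<^sub>R m"]) auto
qed

lemma ehrhart_series_lift:
  assumes "finite A" "A \<noteq> {}"
  shows "ehrhart_series (convex hull A) = cone_series A"
proof (rule fps_ext)
  fix k
  have "{x \<in> lifted_lattice \<inter> nonneg_comb (lift A). snd x = real k} =
      (\<lambda>y. (y, real k)) ` (dilate k (convex hull A) \<inter> lattice_points)"
    using nonneg_comb_lift_dilate[OF assms, of _ k] by (auto simp: lifted_lattice_def)
  then have "card {x \<in> lifted_lattice \<inter> nonneg_comb (lift A). snd x = real k} = card (dilate k (convex hull A) \<inter> lattice_points)"
    by (simp add: card_image inj_on_def)
  then show "ehrhart_series (convex hull A) $ k = cone_series A $ k"
    by (simp add: ehrhart_series_def lifted.graded_series_def)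
qed

lemma one_minus_fps_X_power_nth: "((1 - fps_X) ^ m) $ 0 = (1 :: int)" "((1 - fps_X) ^ m) $ 1 = - int m"
proof -
  show 0: "((1 - fps_X) ^ m) $ 0 = (1 :: int)" for m by (induction m) auto
  show "((1 - fps_X) ^ m) $ 1 = - int m" by (induction m) (auto simp: fps_mult_nth_1 0[simplified])
qed

lemma hstar_reciprocity:
  fixes A :: "(real ^ 'n) set"
  assumes "finite A" "A \<subseteq> lattice_points" "span (lift A) = UNIV"
  obtains h :: "nat \<Rightarrow> int" where
    "\<forall>j>CARD('n) + 1. h j = 0"
    "hstar_series (convex hull A) = Abs_fps h"
    "(1 - fps_X) ^ (CARD('n) + 1) * cone_series A = Abs_fps h"
    "(1 - fps_X) ^ (CARD('n) + 1) * interior_series A =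
       Abs_fps (\<lambda>j. if j \<le> CARD('n) + 1 then h (CARD('n) + 1 - j) else 0)"
    "h 0 = 1"
    "h 1 = int (card (convex hull A \<inter> lattice_points)) - int (CARD('n) + 1)"
proof -
  have A0: "A \<noteq> {}"
  proof
    assume "A = {}"
    then have "(0, 1) \<in> span ({} :: ((real ^ 'n) \<times> real) set)" using assms(3) by (simp add: lift_def)
    then show False by (simp add: zero_prod_def)
  qed
  obtain h where h: "\<forall>j>DIM((real ^ 'n) \<times> real). h j = 0"
    "(1 - fps_X) ^ DIM((real ^ 'n) \<times> real) * cone_series A = Abs_fps h"
    "(1 - fps_X) ^ DIM((real ^ 'n) \<times> real) * interior_series A =
      Abs_fps (\<lambda>j. if j \<le> DIM((real ^ 'n) \<times> real) then h (DIM((real ^ 'n) \<times> real) - j) else 0)"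
    using lifted.series_reciprocity[OF finite_lift[OF assms(1)] lift_lattice[OF assms(2)] snd_lift assms(3)] .
  note h' = h[unfolded DIM_lifted]
  have hs: "hstar_series (convex hull A) = Abs_fps h" unfolding hstar_series_def ehrhart_series_lift[OF assms(1) A0] by (rule h'(2))
  have E0: "ehrhart_series (convex hull A) $ 0 = 1"
  proof -
    have "dilate 0 (convex hull A) = {0}" using A0 by (simp add: dilate_0)
    then show ?thesis by (simp add: ehrhart_series_def lattice_points_closed(1))
  qed
  have "h 0 = hstar_series (convex hull A) $ 0" by (simp add: hs)
  then have h0: "h 0 = 1" unfolding hstar_series_def by (simp only: fps_mult_nth_0 E0 one_minus_fps_X_power_nth mult_1)
  have "h 1 = hstar_series (convex hull A) $ 1" by (simp add: hs)
  also have "\<dots> = ehrhart_series (convex hull A) $ 1 - int (CARD('n) + 1)"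
    unfolding hstar_series_def by (simp only: fps_mult_nth_1 E0 one_minus_fps_X_power_nth) simp
  also have "ehrhart_series (convex hull A) $ 1 = int (card (convex hull A \<inter> lattice_points))"
    by (simp add: ehrhart_series_def dilate_def)
  finally show ?thesis by (intro that[OF h'(1) hs h'(2,3) h0])
qed

section \<open>The dual polytope and its vertices\<close>

lemma dual_polytope_iff:
  "y \<in> dual_polytope ((\<lambda>x. x - m) ` dilate r (convex hull A)) \<longleftrightarrow> (\<forall>a\<in>A. (real r *\<^sub>R a - m) \<bullet> y \<ge> -1)"
proof
  assume "y \<in> dual_polytope ((\<lambda>x. x - m) ` dilate r (convex hull A))"
  then show "\<forall>a\<in>A. (real r *\<^sub>R a - m) \<bullet> y \<ge> -1"
    unfolding dual_polytope_def dilate_def using hull_inc[of _ A convex] by blast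
next
  assume y: "\<forall>a\<in>A. (real r *\<^sub>R a - m) \<bullet> y \<ge> -1"
  have "A \<subseteq> {x. (real r *\<^sub>R y) \<bullet> x \<ge> m \<bullet> y - 1}"
    using y by (auto simp: inner_diff_left inner_commute algebra_simps)
  then have "convex hull A \<subseteq> {x. (real r *\<^sub>R y) \<bullet> x \<ge> m \<bullet> y - 1}"
    by (rule hull_minimal) (rule convex_halfspace_ge)
  then have "(real r *\<^sub>R x - m) \<bullet> y \<ge> -1" if "x \<in> convex hull A" for x
    using that by (force simp: inner_diff_left inner_commute algebra_simps)
  then show "y \<in> dual_polytope ((\<lambda>x. x - m) ` dilate r (convex hull A))"
    unfolding dual_polytope_def dilate_def by auto
qed

lemma extreme_point_no_direction:
  assumes "y extreme_point_of S" "y + v \<in> S" "y - v \<in> S" shows "v = 0"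
proof (rule ccontr)
  assume "v \<noteq> 0"
  then have "2 *\<^sub>R v \<noteq> 0" by simp
  then have "y + v \<noteq> y - v" by (simp add: scaleR_2 eq_diff_eq add.assoc)
  moreover have "midpoint (y + v) (y - v) = y" by (simp add: midpoint_def flip: scaleR_2)
  ultimately have "y \<in> open_segment (y + v) (y - v)" using midpoint_in_open_segment[of "y + v" "y - v"] by simp
  then show False using assms unfolding extreme_point_of_def by blast
qed

text \<open>The inequalities active at a vertex have full rank: a direction orthogonal to all of
  them could be followed both ways inside the dual polytope, as the inactive ones leave
  room.\<close>

lemma dual_extreme_point_direction:
  assumes "finite A" "y extreme_point_of dual_polytope ((\<lambda>x. x - m) ` dilate r (convex hull A))"
    and active: "\<And>a. a \<in> A \<Longrightarrow> (real r *\<^sub>R a - m) \<bullet> y = -1 \<Longrightarrow> (real r *\<^sub>R a - m) \<bullet> v = 0"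
  shows "v = 0"
proof -
  let ?f = "\<lambda>a. real r *\<^sub>R a - m"
  have ge: "?f a \<bullet> y \<ge> -1" if "a \<in> A" for a
    using assms(2) that unfolding extreme_point_of_def dual_polytope_iff by blast
  define F where "F = {a \<in> A. ?f a \<bullet> y \<noteq> -1}"
  have "0 < ?f a \<bullet> y + 1" if "a \<in> F" for a using ge that by (force simp: F_def)
  moreover have "finite F" using assms(1) by (simp add: F_def)
  ultimately obtain e where e: "e > 0" "\<forall>a\<in>F. \<forall>t. \<bar>t\<bar> \<le> e \<longrightarrow> 0 < (?f a \<bullet> y + 1) + t * (?f a \<bullet> v)"
    using finite_uniform_bound[of F "\<lambda>a. ?f a \<bullet> y + 1" "\<lambda>a. ?f a \<bullet> v"] by blast
  have mem: "y + t *\<^sub>R v \<in> dual_polytope ((\<lambda>x. x - m) ` dilate r (convex hull A))" if t: "\<bar>t\<bar> \<le> e" for t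
    unfolding dual_polytope_iff
  proof
    fix a assume a: "a \<in> A"
    show "-1 \<le> ?f a \<bullet> (y + t *\<^sub>R v)"
    proof (cases "a \<in> F")
      case True
      then have "0 < (?f a \<bullet> y + 1) + t * (?f a \<bullet> v)" using e(2) t by blast
      then show ?thesis by (simp add: inner_add_right)
    next
      case False
      then show ?thesis using active[OF a] a by (simp add: F_def inner_add_right)
    qed
  qed
  have "e *\<^sub>R v = 0"
    using mem[of e] mem[of "- e"] e(1) by (intro extreme_point_no_direction[OF assms(2)]) auto
  then show ?thesis using e(1) by simp
qed

text \<open>The homogenised inequality belonging to y. For r > 0 it is the linear form with value 1
  at \<open>(m, real r)\<close> that is nonnegative on the cone exactly when y is in the dual of the
  translated dilate.\<close>

definition polar_functional :: "real ^ 'n \<Rightarrow> nat \<Rightarrow> real ^ 'n \<Rightarrow> (real ^ 'n) \<times> real \<Rightarrow> real" where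
  "polar_functional m r y z = fst z \<bullet> y + snd z * ((1 - m \<bullet> y) / real r)"

lemma linear_polar_functional: "linear (polar_functional m r y)"
  by (rule linearI) (simp_all add: polar_functional_def inner_add_left algebra_simps add_divide_distrib diff_divide_distrib)

lemmas polar_functional_lin = linear_add[OF linear_polar_functional] linear_diff[OF linear_polar_functional]
  linear_cmul[OF linear_polar_functional] linear_sum[OF linear_polar_functional]

lemma polar_functional_center: "0 < r \<Longrightarrow> polar_functional m r y (m, real r) = 1"
  by (simp add: polar_functional_def)

lemma polar_functional_lift: "0 < r \<Longrightarrow> polar_functional m r y (a, 1) = ((real r *\<^sub>R a - m) \<bullet> y + 1) / real r"
  by (simp add: polar_functional_def inner_diff_left field_simps)

lemma polar_functional_nonneg:
  assumes "0 < r" "\<forall>a\<in>A. (real r *\<^sub>R a - m) \<bullet> y \<ge> -1" "b \<in> lift A"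
  shows "0 \<le> polar_functional m r y b"
proof -
  obtain a where a: "b = (a, 1)" "a \<in> A" using assms(3) by (auto simp: lift_def)
  have "(real r *\<^sub>R a - m) \<bullet> y \<ge> -1" using assms(2) a(2) by blast
  then show ?thesis unfolding a(1) polar_functional_lift[OF assms(1)] by (intro divide_nonneg_nonneg) linarith+
qed

lemma bounded_image_polytope: "finite A \<Longrightarrow> compact ((\<lambda>x. x - m) ` dilate r (convex hull A))"
  unfolding dilate_def
  by (intro compact_continuous_image continuous_intros finite_imp_compact_convex_hull)

lemma convex_image_polytope: "convex ((\<lambda>x. x - m) ` dilate r (convex hull A))"
  unfolding dilate_def by (intro convex_translation_subtract convex_scaling convex_convex_hull)

lemma bipolar:
  fixes D :: "'a::euclidean_space set"
  assumes "convex D" "closed D" "0 \<in> D" "\<And>y. (\<forall>d\<in>D. d \<bullet> y \<ge> -1) \<Longrightarrow> x \<bullet> y \<ge> -1"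
  shows "x \<in> D"
proof (rule ccontr)
  assume "x \<notin> D"
  then obtain a b where ab: "a \<bullet> x < b" "\<And>d. d \<in> D \<Longrightarrow> a \<bullet> d > b"
    using separating_hyperplane_closed_point[OF assms(1,2)] by blast
  have b: "b < 0" using ab(2)[OF assms(3)] by simp
  define y where "y = (1 / - b) *\<^sub>R a"
  have "d \<bullet> y \<ge> -1" if "d \<in> D" for d
    using ab(2)[OF that] b by (simp add: y_def inner_commute field_simps)
  then have "x \<bullet> y \<ge> -1" using assms(4) by blast
  then show False using ab(1) b by (simp add: y_def inner_commute field_simps)
qed

text \<open>Vertices w of the dual give the facet forms of the cone. As w is a lattice point and
  some generator lies on its facet, the form is integral on the lattice; being positive on the
  interior, it is at least 1 at x, and it is exactly 1 at \<open>(m, real r)\<close>. All facet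
  forms are thus nonnegative at the difference, which by bipolarity lies in the cone.\<close>

lemma gorenstein_shift:
  fixes A :: "(real ^ 'n) set"
  assumes "finite A" "A \<subseteq> lattice_points" "reflexive_wrt (dilate r (convex hull A)) m" "0 < r"
    and x: "x \<in> lifted_lattice" "x \<in> pos_comb (lift A)"
    and u: "(m, real r) \<in> pos_comb (lift A)"
  shows "x - (m, real r) \<in> nonneg_comb (lift A)"
proof -
  define D where "D = (\<lambda>x. x - m) ` dilate r (convex hull A)"
  have cD: "compact D" "convex D"
    unfolding D_def by (rule bounded_image_polytope[OF assms(1)], rule convex_image_polytope)
  have r: "reflexive D" and mL: "m \<in> lattice_points" using assms(3) unfolding reflexive_wrt_def D_def by blast+
  obtain W where W: "finite W" "W \<subseteq> lattice_points" "dual_polytope D = convex hull W"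
    using r unfolding reflexive_def lattice_polytope_def by blast
  define W0 where "W0 = {w. w extreme_point_of (dual_polytope D)}"
  have W0W: "W0 \<subseteq> W" unfolding W0_def W(3) using extreme_point_of_convex_hull by blast
  have hullW0: "dual_polytope D = convex hull W0" unfolding W0_def W(3) by (rule Krein_Milman_polytope[OF W(1)])
  have 0: "0 \<in> dual_polytope D" by (simp add: dual_polytope_def)
  have 0: "0 \<in> convex hull W0" using 0 hullW0 by simp
  have D0: "0 \<in> D" using r interior_subset unfolding reflexive_def by blast
  have bip: "p \<in> D" if p: "\<And>w. w \<in> W0 \<Longrightarrow> p \<bullet> w \<ge> -1" for p
  proof (rule bipolar[OF cD(2) compact_imp_closed[OF cD(1)] D0])
    fix y assume "\<forall>d\<in>D. d \<bullet> y \<ge> -1"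
    then have "y \<in> convex hull W0" unfolding hullW0[symmetric] dual_polytope_def by blast
    moreover have "convex hull W0 \<subseteq> {y. p \<bullet> y \<ge> -1}" using p by (intro hull_minimal convex_halfspace_ge) auto
    ultimately show "p \<bullet> y \<ge> -1" by blast
  qed
  let ?l = "polar_functional m r"
  have pos: "?l w (x - (m, real r)) \<ge> 0" if w: "w \<in> W0" for w
  proof -
    have ext: "w extreme_point_of dual_polytope D" using w by (simp add: W0_def)
    then have ge: "\<forall>a\<in>A. (real r *\<^sub>R a - m) \<bullet> w \<ge> -1"
      unfolding extreme_point_of_def D_def dual_polytope_iff by blast
    \<comment> \<open>If no inequality were active at w, every direction would be free there; any
      nonzero vector gives the contradiction.\<close>
    have "\<exists>a\<in>A. (real r *\<^sub>R a - m) \<bullet> w = -1"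
    proof (rule ccontr)
      assume "\<not> ?thesis"
      then have "(axis undefined 1 :: real ^ 'n) = 0"
        by (intro dual_extreme_point_direction[OF assms(1) ext[unfolded D_def]]) blast
      then show False by (simp add: axis_eq_0_iff)
    qed
    then obtain a0 where a0: "a0 \<in> A" "(real r *\<^sub>R a0 - m) \<bullet> w = -1" by blast
    \<comment> \<open>The generator a0 on the facet shows that the height coefficient, defined
      through a division by r, is an integer.\<close>
    have slope: "(1 - m \<bullet> w) / real r = - (a0 \<bullet> w)" using a0(2) assms(4) by (simp add: inner_diff_left field_simps)
    have wL: "w \<in> lattice_points" using w W0W W(2) by blast
    have "?l w x \<in> \<int>"
    proof -
      have "fst x \<bullet> w \<in> \<int>" "a0 \<bullet> w \<in> \<int>" "snd x \<in> \<int>"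
        using x(1) wL a0(1) assms(2) by (auto simp: lifted_lattice_def intro: lattice_points_inner)
      then show ?thesis unfolding polar_functional_def slope by auto
    qed
    moreover have "?l w x > 0"
    proof -
      have la: "?l w a \<ge> 0" if "a \<in> lift A" for a by (rule polar_functional_nonneg[OF assms(4) ge that])
      obtain c where c: "\<And>a. a \<in> lift A \<Longrightarrow> 0 < c a" "(m, real r) = lincomb c (lift A)" using u unfolding pos_comb_def by blast
      obtain d where d: "\<And>a. a \<in> lift A \<Longrightarrow> 0 < d a" "x = lincomb d (lift A)" using x(2) unfolding pos_comb_def by blast
      have "(\<Sum>a\<in>lift A. c a * ?l w a) = 1"
        using polar_functional_center[OF assms(4), of m w] unfolding c(2) polar_functional_lin real_scaleR_def .
      then obtain a1 where a1: "a1 \<in> lift A" "?l w a1 > 0" using la by (metis (no_types, lifting) mult_zero_right order_le_less sum.neutral zero_neq_one)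
      have "0 < (\<Sum>a\<in>lift A. d a * ?l w a)"
        by (rule sum_pos2[where f = "\<lambda>a. d a * ?l w a", OF finite_lift[OF assms(1)] a1(1) mult_pos_pos[OF d(1)[OF a1(1)] a1(2)]],
            rule mult_nonneg_nonneg[OF less_imp_le[OF d(1)] la])
      then show ?thesis unfolding d(2) polar_functional_lin real_scaleR_def .
    qed
    ultimately have "?l w x \<ge> 1" by (auto elim!: Ints_cases)
    then show ?thesis by (simp only: polar_functional_lin polar_functional_center[OF assms(4)])
  qed
  obtain y k where yk: "x - (m, real r) = (y, k)" by force
  have ge: "y \<bullet> w + k * ((1 - m \<bullet> w) / real r) \<ge> 0" if "w \<in> W0" for w
    using pos[OF that] unfolding yk polar_functional_def by simp
  \<comment> \<open>The inequalities extend from the vertices to the whole dual, hence to the dual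
    point 0, whose form is the height divided by r.\<close>
  have k0: "k \<ge> 0"
  proof -
    have "W0 \<subseteq> {w. (y - (k / real r) *\<^sub>R m) \<bullet> w \<ge> - (k / real r)}"
      using ge by (auto simp: inner_diff_left diff_divide_distrib algebra_simps)
    then have "convex hull W0 \<subseteq> {w. (y - (k / real r) *\<^sub>R m) \<bullet> w \<ge> - (k / real r)}"
      by (rule hull_minimal) (rule convex_halfspace_ge)
    then have "k / real r \<ge> 0" using 0 by auto
    then show ?thesis using assms(4) by (simp add: zero_le_divide_iff)
  qed
  show ?thesis
  proof (cases "k = 0")
    \<comment> \<open>Height 0 cannot be rescaled to height r; instead y is a recession direction of
      the bounded set D, hence 0.\<close>
    case True
    obtain R where R: "\<And>d. d \<in> D \<Longrightarrow> norm d \<le> R" using compact_imp_bounded[OF cD(1)] unfolding bounded_iff by blast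
    have "t *\<^sub>R y \<in> D" if "t \<ge> 0" for t
    proof (rule bip)
      fix w assume "w \<in> W0"
      then have "0 \<le> t * (y \<bullet> w)" using ge[of w] True that by simp
      then show "t *\<^sub>R y \<bullet> w \<ge> -1" by simp
    qed
    then have tb: "t * norm y \<le> R" if "t \<ge> 0" for t using R[of "t *\<^sub>R y"] that by simp
    have "y = 0"
    proof (rule ccontr)
      assume "y \<noteq> 0"
      then have ny: "norm y > 0" by simp
      have "0 \<le> R" using tb[of 0] by simp
      then have "(R + 1) / norm y * norm y \<le> R" using ny by (intro tb) simp
      then show False using ny by simp
    qed
    then show ?thesis using yk True by (simp add: zero_prod_def[symmetric])
  next
    case False
    then have k: "k > 0" using k0 by simp
    have "(real r / k) *\<^sub>R y - m \<in> D"
    proof (rule bip)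
      fix w assume "w \<in> W0"
      then have "y \<bullet> w + k * ((1 - m \<bullet> w) / real r) \<ge> 0" by (rule ge)
      then have "(real r / k) * (y \<bullet> w + k * ((1 - m \<bullet> w) / real r)) \<ge> 0" using k by (intro mult_nonneg_nonneg) auto
      moreover have "(real r / k) * (y \<bullet> w + k * ((1 - m \<bullet> w) / real r)) = (real r / k) * (y \<bullet> w) + (1 - m \<bullet> w)"
        using k assms(4) by (simp add: field_simps)
      ultimately show "-1 \<le> ((real r / k) *\<^sub>R y - m) \<bullet> w" by (simp add: inner_diff_left)
    qed
    then obtain p where p: "p \<in> convex hull A" "(real r / k) *\<^sub>R y = real r *\<^sub>R p" unfolding D_def dilate_def by auto
    have "(1 / k) *\<^sub>R y = (1 / real r) *\<^sub>R ((real r / k) *\<^sub>R y)" using assms(4) by simp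
    also have "\<dots> = p" unfolding p(2) using assms(4) by simp
    finally show ?thesis using p(1) nonneg_comb_lift_iff[OF assms(1) k] yk by simp
  qed
qed

text \<open>A converse to \<open>gorenstein_shift\<close>. If the form of a dual vertex were not
  integral at a lattice point, subtracting a multiple of \<open>(m, real r)\<close> would leave a
  value strictly between 0 and 1. A large multiple of the generators on the facet moves the point
  into the interior without changing this value, and \<open>shift\<close> then makes the value minus
  1 nonnegative.\<close>

lemma gorenstein_of_indexI:
  fixes A :: "(real ^ 'n) set"
  assumes "finite A" "A \<subseteq> lattice_points" "span (lift A) = UNIV" "0 < r" "m \<in> lattice_points"
    and u: "(m, real r) \<in> pos_comb (lift A)"
    and shift: "\<And>x. x \<in> lifted_lattice \<Longrightarrow> x \<in> pos_comb (lift A) \<Longrightarrow> x - (m, real r) \<in> nonneg_comb (lift A)"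
  shows "gorenstein_of_index (convex hull A) r"
proof -
  define D where "D = (\<lambda>x. x - m) ` dilate r (convex hull A)"
  have m: "m \<in> interior (dilate r (convex hull A))" using u pos_comb_lift_interior[OF assms(1,3,4)] by blast
  have "D = convex hull ((\<lambda>x. real r *\<^sub>R x - m) ` A)"
    using convex_hull_affinity[of "- m" "real r" A] by (simp add: D_def dilate_def image_image)
  moreover have "real r *\<^sub>R x - m \<in> lattice_points" if "x \<in> A" for x
    using that assms(2,5) by (intro lattice_points_diff lattice_points_closed(4)) auto
  ultimately have "lattice_polytope D" unfolding lattice_polytope_def using assms(1)
    by (intro exI[of _ "(\<lambda>x. real r *\<^sub>R x - m) ` A"]) auto
  moreover have D0: "0 \<in> interior D" unfolding D_def interior_translation_subtract using m by force
  moreover have "aff_dim D = int CARD('n)" using aff_dim_nonempty_interior[of D] D0 by force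
  moreover have "lattice_polytope (dual_polytope D)"
  proof -
    have dual: "dual_polytope D = (\<Inter>a\<in>A. {y. (real r *\<^sub>R a - m) \<bullet> y \<ge> -1})"
      unfolding D_def using dual_polytope_iff by blast
    have poly: "polyhedron (dual_polytope D)" unfolding dual using assms(1)
      by (intro polyhedron_Inter) (auto intro: polyhedron_halfspace_ge)
    have bdd: "bounded (dual_polytope D)"
    proof -
      obtain e where e: "e > 0" "ball 0 e \<subseteq> D" using D0 mem_interior by blast
      have "norm y \<le> 2 / e" if y: "y \<in> dual_polytope D" for y
      proof (cases "y = 0")
        case False
        then have ny: "norm y > 0" by simp
        have "(- (e / (2 * norm y))) *\<^sub>R y \<in> ball 0 e" using e(1) ny by simp
        then have "(- (e / (2 * norm y))) *\<^sub>R y \<bullet> y \<ge> -1" using y e(2) unfolding dual_polytope_def by blast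
        then have "e / (2 * norm y) * (norm y * norm y) \<le> 1" by (simp add: dot_square_norm power2_eq_square)
        then show ?thesis using e(1) ny by (simp add: field_simps)
      qed (use e in simp)
      then show ?thesis unfolding bounded_iff by blast
    qed
    define W where "W = {y. y extreme_point_of (dual_polytope D)}"
    have fW: "finite W" unfolding W_def by (rule finite_polyhedron_extreme_points[OF poly])
    have hull: "dual_polytope D = convex hull W" unfolding W_def
      using poly bdd by (intro Krein_Milman_Minkowski) (auto simp: compact_eq_bounded_closed polyhedron_imp_closed polyhedron_imp_convex)
    have "y \<in> lattice_points" if y: "y \<in> W" for y
    proof -
      have yd: "\<forall>a\<in>A. (real r *\<^sub>R a - m) \<bullet> y \<ge> -1"
      proof -
        have "y \<in> dual_polytope D" using y unfolding W_def extreme_point_of_def by blast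
        then show ?thesis unfolding D_def dual_polytope_iff .
      qed
      define F where "F = {a \<in> A. (real r *\<^sub>R a - m) \<bullet> y = -1}"
      have fF: "finite F" "F \<subseteq> A" using assms(1) by (auto simp: F_def)
      define u where "u = (m, real r)"
      define \<l> where "\<l> = polar_functional m r y"
      note \<l>_lin = polar_functional_lin[of m r y, folded \<l>_def]
      have \<l>u: "\<l> u = 1" unfolding \<l>_def u_def by (rule polar_functional_center[OF assms(4)])
      have \<l>a: "\<l> (a, 1) = ((real r *\<^sub>R a - m) \<bullet> y + 1) / real r" for a
        unfolding \<l>_def by (rule polar_functional_lift[OF assms(4)])
      have \<l>F: "\<l> s = 0" if "s \<in> span (lift F)" for s
      proof (rule linear_eq_0_on_span[OF linear_polar_functional[of m r y, folded \<l>_def] _ that])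
        fix b assume "b \<in> lift F"
        then obtain a where "b = (a, 1)" "a \<in> F" by (auto simp: lift_def)
        then show "\<l> b = 0" by (simp add: \<l>a F_def)
      qed
      have \<l>_nonneg: "\<l> z \<ge> 0" if "z \<in> nonneg_comb (lift A)" for z
        using that
      proof (rule nonneg_combE)
        fix c assume c: "\<And>a. a \<in> lift A \<Longrightarrow> 0 \<le> c a" "z = lincomb c (lift A)"
        have "\<l> z = (\<Sum>a\<in>lift A. c a * \<l> a)" unfolding c(2) \<l>_lin real_scaleR_def ..
        also have "\<dots> \<ge> 0" unfolding \<l>_def using c(1) polar_functional_nonneg[OF assms(4) yd]
          by (intro sum_nonneg mult_nonneg_nonneg)
        finally show ?thesis .
      qed
      \<comment> \<open>The space part of a vector orthogonal to u and to \<open>lift F\<close> is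
        orthogonal to all inequalities active at the vertex y, hence 0; orthogonality to u then
        kills the last component, since r > 0.\<close>
      have sp: "span (insert u (lift F)) = UNIV"
      proof (rule ccontr)
        assume "span (insert u (lift F)) \<noteq> UNIV"
        then obtain g where g: "g \<noteq> 0" "\<forall>x\<in>span (insert u (lift F)). g \<bullet> x = 0" using span_not_UNIV_orthogonal by blast
        obtain g1 g2 where g12: "g = (g1, g2)" by force
        have "g \<bullet> u = 0" using g(2) span_base[of u "insert u (lift F)"] by blast
        then have gu: "g1 \<bullet> m + g2 * real r = 0" by (simp add: g12 u_def)
        have gF: "g1 \<bullet> a + g2 = 0" if "a \<in> F" for a
        proof -
          have "(a, 1) \<in> insert u (lift F)" using that by (simp add: lift_def)
          then have "g \<bullet> (a, 1) = 0" using g(2) span_base by blast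
          then show ?thesis by (simp add: g12)
        qed
        have "g1 \<noteq> 0"
        proof
          assume "g1 = 0"
          then have "g2 = 0" using gu assms(4) by simp
          then show False using g(1) \<open>g1 = 0\<close> by (simp add: g12 zero_prod_def)
        qed
        have gF0: "(real r *\<^sub>R a - m) \<bullet> g1 = 0" if "a \<in> F" for a
        proof -
          have "(real r *\<^sub>R a - m) \<bullet> g1 = real r * (g1 \<bullet> a + g2) - (g1 \<bullet> m + g2 * real r)"
            by (simp add: inner_diff_left inner_commute algebra_simps)
          then show ?thesis using gF[OF that] gu by simp
        qed
        have "g1 = 0"
        proof (rule dual_extreme_point_direction[OF assms(1)])
          show "y extreme_point_of dual_polytope ((\<lambda>x. x - m) ` dilate r (convex hull A))" using y by (simp add: W_def D_def)
          show "(real r *\<^sub>R a - m) \<bullet> g1 = 0" if "a \<in> A" "(real r *\<^sub>R a - m) \<bullet> y = -1" for a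
            using gF0 that by (simp add: F_def)
        qed
        then show False using \<open>g1 \<noteq> 0\<close> by contradiction
      qed
      have "\<l> x \<in> \<int>" if x: "x \<in> lifted_lattice" for x
      proof (rule ccontr)
        assume nint: "\<l> x \<notin> \<int>"
        define x1 where "x1 = x - of_int \<lfloor>\<l> x\<rfloor> *\<^sub>R u"
        have x1L: "x1 \<in> lifted_lattice"
          using x assms(5) unfolding x1_def u_def lifted_lattice_def
          by (auto intro!: lattice_points_diff lattice_points_closed(4))
        have \<l>x1: "\<l> x1 = frac (\<l> x)" by (simp add: x1_def \<l>_lin \<l>u frac_def)
        have pos: "0 < \<l> x1" "\<l> x1 < 1" unfolding \<l>x1 using nint frac_lt_1 by (auto simp: frac_gt_0_iff)
        obtain c where c: "x1 - c *\<^sub>R u \<in> span (lift F)" using sp span_breakdown_eq[of x1 u "lift F"] by blast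
        define s where "s = x1 - c *\<^sub>R u"
        \<comment> \<open>The form vanishes on the span of the facet generators, so c is its value
          at x1 and in particular positive. This makes the point below interior.\<close>
        have "\<l> x1 - c = 0" using \<l>F[OF c] by (simp add: \<l>_lin \<l>u)
        then have c0: "c > 0" using pos by simp
        obtain e where e: "e > 0" "\<And>t. \<bar>t\<bar> \<le> e \<Longrightarrow> (\<Sum>a\<in>lift F. a) + t *\<^sub>R s \<in> pos_comb (lift F)"
          using pos_comb_absorb[OF finite_lift[OF fF(1)] sum_in_pos_comb, of s] c unfolding s_def by blast
        obtain N :: nat where N: "N > 0" "1 / real N < e" using e(1) by (metis nat_approx_posE zero_less_Suc)
        have "real N *\<^sub>R ((\<Sum>a\<in>lift F. a) + (1 / real N) *\<^sub>R s) \<in> nonneg_comb (lift F)"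
          using e(2)[of "1 / real N"] N by (intro nonneg_comb_scale pos_comb_imp_nonneg) auto
        then have "real N *\<^sub>R (\<Sum>a\<in>lift F. a) + s \<in> nonneg_comb (lift F)" using N by (simp add: scaleR_right_distrib)
        then have "real N *\<^sub>R (\<Sum>a\<in>lift F. a) + s \<in> nonneg_comb (lift A)"
          using nonneg_comb_mono[OF finite_lift[OF assms(1)] lift_mono[OF fF(2)]] by blast
        then have p: "c *\<^sub>R u + (real N *\<^sub>R (\<Sum>a\<in>lift F. a) + s) \<in> pos_comb (lift A)"
          using c0 u_def assms(6) by (intro pos_comb_add_nonneg pos_comb_scale) auto
        have e: "c *\<^sub>R u + (real N *\<^sub>R (\<Sum>a\<in>lift F. a) + s) = x1 + real N *\<^sub>R (\<Sum>a\<in>lift F. a)" by (simp add: s_def)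
        have l: "x1 + real N *\<^sub>R (\<Sum>a\<in>lift F. a) \<in> lifted_lattice"
        proof -
          have "real N *\<^sub>R (\<Sum>a\<in>lift F. a) = (\<Sum>i<N. \<Sum>a\<in>lift F. a)" by (simp add: sum_constant_scaleR)
          also have "\<dots> \<in> lifted_lattice" using fF(2) assms(2) by (intro lifted.sum_L) (auto simp: lift_def lifted_lattice_def)
          finally show ?thesis using x1L by (intro lifted.add_L)
        qed
        have "x1 + real N *\<^sub>R (\<Sum>a\<in>lift F. a) - u \<in> nonneg_comb (lift A)"
          unfolding u_def by (rule shift[OF l p[unfolded e]])
        then have "0 \<le> \<l> (x1 + real N *\<^sub>R (\<Sum>a\<in>lift F. a) - u)" by (rule \<l>_nonneg)
        also have "\<dots> = \<l> x1 - 1" using \<l>F[of "\<Sum>a\<in>lift F. a"] by (simp add: \<l>_lin \<l>u span_sum span_base)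
        finally show False using pos by simp
      qed
      \<comment> \<open>At a unit vector in height 0 the form returns a coordinate of y.\<close>
      then have "\<l> (axis i 1, 0) \<in> \<int>" for i by (auto simp: lifted_lattice_def lattice_points_def axis_def)
      then show ?thesis by (simp add: \<l>_def polar_functional_def lattice_points_def inner_axis')
    qed
    then show ?thesis unfolding lattice_polytope_def using fW hull by blast
  qed
  ultimately have "reflexive D" unfolding reflexive_def full_lattice_polytope_def by blast
  then have "reflexive_wrt (dilate r (convex hull A)) m" unfolding reflexive_wrt_def using assms(5) m D_def by blast
  then show ?thesis unfolding gorenstein_of_index_def
    using full_lattice_polytope_iff[OF assms(1,2)] assms(3,4) by auto
qed

section \<open>The Gorenstein property in terms of series\<close>

lemma pos_series_eq:
  fixes A :: "(real ^ 'n) set"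
  assumes "finite A" "A \<subseteq> lattice_points" "m \<in> lattice_points"
    and u: "(m, real r) \<in> pos_comb (lift A)"
    and shift: "\<And>x. x \<in> lifted_lattice \<Longrightarrow> x \<in> pos_comb (lift A) \<Longrightarrow> x - (m, real r) \<in> nonneg_comb (lift A)"
  shows "interior_series A =
    fps_X ^ r * cone_series A"
proof (rule fps_ext)
  fix k
  let ?u = "(m, real r)"
  have uL: "?u \<in> lifted_lattice" using assms(3) by (simp add: lifted_lattice_def)
  show "interior_series A $ k =
    (fps_X ^ r * cone_series A) $ k"
  proof (cases "k < r")
    case True
    have e: "{x \<in> lifted_lattice \<inter> pos_comb (lift A). snd x = real k} = {}"
    proof (rule ccontr)
      assume "\<not> ?thesis"
      then obtain x where x: "x \<in> lifted_lattice" "x \<in> pos_comb (lift A)" "snd x = real k" by blast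
      then have "0 \<le> snd (x - ?u)" by (intro snd_nonneg_comb_lift[of _ A] shift)
      then show False using x(3) True by simp
    qed
    show ?thesis unfolding lifted.graded_series_def fps_X_power_mult_nth fps_nth_Abs_fps e using True by simp
  next
    case False
    have "{x \<in> lifted_lattice \<inter> pos_comb (lift A). snd x = real k} =
      (\<lambda>x. x + ?u) ` {x \<in> lifted_lattice \<inter> nonneg_comb (lift A). snd x = real (k - r)}" (is "?L = ?f ` ?R")
    proof (intro subset_antisym subsetI)
      fix x assume x: "x \<in> ?L"
      then have "x - ?u \<in> ?R" using shift[of x] lifted.diff_L[OF _ uL] False by (auto simp: of_nat_diff)
      then have "(x - ?u) + ?u \<in> ?f ` ?R" by (rule imageI)
      then show "x \<in> ?f ` ?R" by simp
    next
      fix x assume "x \<in> ?f ` ?R"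
      then obtain y where y: "x = y + ?u" "y \<in> ?R" by blast
      have "?u + y \<in> pos_comb (lift A)" using y u by (intro pos_comb_add_nonneg) auto
      then show "x \<in> ?L" using y lifted.add_L[OF _ uL, of y] False by (auto simp: add.commute of_nat_diff)
    qed
    then have "card ?L = card ?R" by (simp add: card_image inj_on_def)
    then show ?thesis using False by (simp add: lifted.graded_series_def fps_X_power_mult_nth)
  qed
qed

text \<open>Interior lattice points for \<open>A\<close> are interior for \<open>B\<close>, so none
  lies below height r and only \<open>(m, real r)\<close> lies at height r. By reciprocity
  \<open>h 2 = 1\<close> and \<open>h j = 0\<close> for j > 2, so h-star is symmetric whatever
  \<open>h 1\<close> is, and the interior series is the cone series shifted by r. Translation by
  \<open>(m, real r)\<close> is then an injection between finite sets of equal size, which is the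
  shift property for \<open>A\<close>.\<close>

lemma gorenstein_degree_2_sub:
  fixes A B :: "(real ^ 'n) set"
  assumes "finite B" "A \<subseteq> B" "B \<subseteq> lattice_points" "span (lift A) = UNIV" "0 < r" "r + 1 = CARD('n)" "m \<in> lattice_points"
    and uA: "(m, real r) \<in> pos_comb (lift A)" and uB: "(m, real r) \<in> pos_comb (lift B)"
    and shift: "\<And>x. x \<in> lifted_lattice \<Longrightarrow> x \<in> pos_comb (lift B) \<Longrightarrow> x - (m, real r) \<in> nonneg_comb (lift B)"
  shows "gorenstein (convex hull A)" "has_degree (convex hull A) 2"
proof -
  let ?n = "CARD('n)" and ?u = "(m, real r)"
  have fA: "finite A" "A \<subseteq> lattice_points" using assms(1-3) finite_subset by blast+
  have uL: "?u \<in> lifted_lattice" using assms(7) by (simp add: lifted_lattice_def)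
  obtain h :: "nat \<Rightarrow> int" where h:
    "\<forall>j>?n + 1. h j = 0"
    "hstar_series (convex hull A) = Abs_fps h"
    "(1 - fps_X) ^ (?n + 1) * cone_series A = Abs_fps h"
    "(1 - fps_X) ^ (?n + 1) * interior_series A =
       Abs_fps (\<lambda>j. if j \<le> ?n + 1 then h (?n + 1 - j) else 0)"
    "h 0 = 1"
    "h 1 = int (card (convex hull A \<inter> lattice_points)) - int (?n + 1)"
    using hstar_reciprocity[OF fA assms(4)] .
  define I where "I = interior_series A"
  define E where "E = cone_series A"
  have posAB: "pos_comb (lift A) \<subseteq> pos_comb (lift B)"
    using pos_comb_mono_cross[OF finite_lift[OF assms(1)] lift_mono[OF assms(2)] uA uB] .
  have ht_ge: "snd x \<ge> real r" if "x \<in> lifted_lattice" "x \<in> pos_comb (lift B)" for x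
    using snd_nonneg_comb_lift[OF shift[OF that]] by simp
  have ht_eq: "x = ?u" if "x \<in> lifted_lattice" "x \<in> pos_comb (lift B)" "snd x = real r" for x
    using nonneg_comb_lift_zero[OF assms(1) shift[OF that(1,2)]] that(3) by simp
  have Ilow: "I $ k = 0" if "k < r" for k
  proof -
    have e: "{x \<in> lifted_lattice \<inter> pos_comb (lift A). snd x = real k} = {}" using ht_ge posAB that by fastforce
    show ?thesis unfolding I_def lifted.graded_series_def fps_nth_Abs_fps e by simp
  qed
  have Ir: "I $ r = 1"
  proof -
    have e: "{x \<in> lifted_lattice \<inter> pos_comb (lift A). snd x = real r} = {?u}" using ht_eq posAB uL uA by auto
    show ?thesis unfolding I_def lifted.graded_series_def fps_nth_Abs_fps e by simp
  qed
  have prod_low: "((1 - fps_X) ^ (?n + 1) * I) $ j = (if j = r then 1 else 0)" if "j \<le> r" for j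
  proof -
    have "((1 - fps_X) ^ (?n + 1) * I) $ j = (\<Sum>i=0..j. ((1 - fps_X) ^ (?n + 1)) $ i * I $ (j - i))" by (rule fps_mult_nth)
    also have "\<dots> = (\<Sum>i=0..j. if i = 0 then I $ j else 0)"
      using that Ilow by (intro sum.cong) (auto simp: one_minus_fps_X_power_nth(1)[simplified])
    also have "\<dots> = I $ j" by simp
    finally show ?thesis using that Ilow[of j] Ir by auto
  qed
  \<comment> \<open>As r + 1 = n, the indices n + 1 - j with j \<le> r are exactly 2, ..., n +
    1.\<close>
  have hr: "h (?n + 1 - j) = (if j = r then 1 else 0)" if "j \<le> r" for j
    using prod_low[OF that] that assms(6) h(4) unfolding I_def by simp
  have h2: "h 2 = 1" using hr[of r] assms(6) by (simp add: numeral_2_eq_2 Suc_diff_le flip: assms(6))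
  have hhigh: "h j = 0" if "j > 2" for j
  proof (cases "j > ?n + 1")
    case False
    then have "h (?n + 1 - (?n + 1 - j)) = 0" using that assms(6) by (subst hr) auto
    then show ?thesis using False by simp
  qed (use h(1) in blast)
  \<comment> \<open>Only the two ends carry information: at index r + 1 the linear coefficient is
    compared with itself.\<close>
  have pal: "(if j \<le> ?n + 1 then h (?n + 1 - j) else 0) = (if j < r then 0 else h (j - r))" for j
  proof -
    consider "j < r" | "j = r" | "j = r + 1" | "j = r + 2" | "j > r + 2" by linarith
    then show ?thesis
    proof cases
      case 1 then show ?thesis using hr[of j] assms(6) by simp
    next
      case 2 then show ?thesis using hr[of r] assms(6) h(5) by simp
    next
      case 3 then have "?n + 1 - j = 1" "j - r = 1" "j \<le> ?n + 1" "\<not> j < r" using assms(6) by linarith+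
      then show ?thesis by simp
    next
      case 4 then have "?n + 1 - j = 0" "j - r = 2" "j \<le> ?n + 1" "\<not> j < r" using assms(6) by linarith+
      then show ?thesis using h(5) h2 by simp
    next
      case 5 then show ?thesis using hhigh[of "j - r"] assms(6) by simp
    qed
  qed
  have "(1 - fps_X) ^ (?n + 1) * I = fps_X ^ r * ((1 - fps_X) ^ (?n + 1) * E)"
    unfolding I_def E_def h(3,4) by (rule fps_ext) (simp only: fps_nth_Abs_fps pal fps_X_power_mult_nth)
  then have "(1 - fps_X) ^ (?n + 1) * I = (1 - fps_X) ^ (?n + 1) * (fps_X ^ r * E)" by (simp only: mult.left_commute)
  moreover have "(1 - fps_X :: int fps) ^ (?n + 1) \<noteq> 0"
    using one_minus_fps_X_power_nth(1)[of "?n + 1"] by (metis fps_zero_nth zero_neq_one)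
  ultimately have IE: "I = fps_X ^ r * E" by simp
  have shiftA: "x - ?u \<in> nonneg_comb (lift A)" if x: "x \<in> lifted_lattice" "x \<in> pos_comb (lift A)" for x
  proof -
    have "snd x \<ge> real r" using ht_ge x posAB by blast
    moreover obtain i where i: "snd x = of_int i" using x(1) by (auto simp: lifted_lattice_def elim: Ints_cases)
    ultimately have "i \<ge> int r" by simp
    then obtain k where k: "i = int r + int k" using zle_iff_zadd by blast
    let ?R = "{x \<in> lifted_lattice \<inter> nonneg_comb (lift A). snd x = real k}"
    let ?S = "{x \<in> lifted_lattice \<inter> pos_comb (lift A). snd x = real (r + k)}"
    have "?S \<subseteq> {x \<in> lifted_lattice \<inter> nonneg_comb (lift A). snd x = real (r + k)}" using pos_comb_imp_nonneg by blast
    then have fS: "finite ?S" by (rule finite_subset) (rule lifted.finite_graded_piece[OF finite_lift[OF fA(1)] snd_lift], assumption)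
    have sub: "(\<lambda>x. x + ?u) ` ?R \<subseteq> ?S"
    proof (rule image_subsetI)
      fix y assume y: "y \<in> ?R"
      have "?u + y \<in> pos_comb (lift A)" using y uA by (intro pos_comb_add_nonneg) auto
      then show "y + ?u \<in> ?S" using y lifted.add_L[OF _ uL, of y] by (auto simp: add.commute)
    qed
    \<comment> \<open>Equal counts make the injective translation surjective, so x itself is a
      translate of a point of the cone.\<close>
    have "I $ (r + k) = E $ k" unfolding IE by (simp add: fps_X_power_mult_nth)
    then have "card ?S = card ?R" by (simp add: I_def E_def lifted.graded_series_def)
    also have "\<dots> = card ((\<lambda>x. x + ?u) ` ?R)" by (simp add: card_image inj_on_def)
    finally have "(\<lambda>x. x + ?u) ` ?R = ?S" using card_subset_eq[OF fS sub] by simp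
    moreover have "x \<in> ?S" using x i k by simp
    ultimately obtain y where "y \<in> ?R" "x = y + ?u" by blast
    then show ?thesis by simp
  qed
  show "gorenstein (convex hull A)" unfolding gorenstein_def
    using gorenstein_of_indexI[OF fA assms(4,5,7) uA shiftA] by blast
  have "fps_of_poly [:h 0, h 1, h 2:] = hstar_series (convex hull A)"
    unfolding h(2)
  proof (rule fps_ext)
    fix j
    consider "j = 0" | "j = 1" | "j = 2" | i where "j = Suc (Suc (Suc i))"
      by (metis One_nat_def numeral_2_eq_2 not0_implies_Suc)
    then show "fps_of_poly [:h 0, h 1, h 2:] $ j = Abs_fps h $ j"
    proof cases
      case 4
      then have "h j = 0" by (intro hhigh) simp
      then show ?thesis using 4 by simp
    qed (simp_all add: numeral_2_eq_2)
  qed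
  moreover have "degree [:h 0, h 1, h 2:] = 2" using h2 by simp
  ultimately show "has_degree (convex hull A) 2" unfolding has_degree_def by blast
qed

theorem theorem4p5:
  fixes P :: "(real ^ 'n) set"
  assumes "minimal_gorenstein_degree_2 P"
  shows "normalized_volume P \<le> 4"
proof -
  let ?n = "CARD('n)"
  have "gorenstein P" using assms unfolding minimal_gorenstein_degree_2_def by blast
  then obtain r m where full: "full_lattice_polytope P" and r1: "1 \<le> r" and refl: "reflexive_wrt (dilate r P) m"
    unfolding gorenstein_def gorenstein_of_index_def by blast
  have r: "0 < r" using r1 by simp
  obtain W where W: "finite W" "W \<subseteq> lattice_points" "P = convex hull W"
    using full unfolding full_lattice_polytope_def lattice_polytope_def by blast
  have bP: "bounded P" "convex P" using W by (auto simp: bounded_convex_hull finite_imp_bounded)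
  define Q where "Q = lattice_points \<inter> P"
  define V where "V = {v. v extreme_point_of P}"
  have fQ: "finite Q" unfolding Q_def by (rule finite_lattice_points_bounded[OF bP(1)])
  have QL: "Q \<subseteq> lattice_points" by (simp add: Q_def)
  have VW: "V \<subseteq> W" unfolding V_def W(3) using extreme_point_of_convex_hull by blast
  have PV: "P = convex hull V" unfolding V_def W(3) by (rule Krein_Milman_polytope[OF W(1)])
  have "W \<subseteq> Q" unfolding Q_def using W hull_subset[of W convex] by blast
  then have VQ: "V \<subseteq> Q" using VW by blast
  have fV: "finite V" using VQ fQ finite_subset by blast
  have PQ: "P = convex hull Q"
  proof
    show "P \<subseteq> convex hull Q" unfolding PV by (rule hull_mono[OF VQ])
    show "convex hull Q \<subseteq> P" using bP(2) by (intro hull_minimal) (auto simp: Q_def)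
  qed
  have spV: "span (lift V) = UNIV" using full full_lattice_polytope_iff[OF fV] VQ QL PV by auto
  have spQ: "span (lift Q) = UNIV" using full full_lattice_polytope_iff[OF fQ QL] PQ by auto
  define u where "u = (m, real r)"
  have mL: "m \<in> lattice_points" and mint: "m \<in> interior (dilate r P)" using refl unfolding reflexive_wrt_def by blast+
  have uQ: "(m, real r) \<in> pos_comb (lift Q)" using mint pos_comb_lift_interior[OF fQ spQ r] PQ by simp
  have uV: "(m, real r) \<in> pos_comb (lift V)" using mint pos_comb_lift_interior[OF fV spV r] PV by simp
  have shift: "x - (m, real r) \<in> nonneg_comb (lift Q)" if "x \<in> lifted_lattice" "x \<in> pos_comb (lift Q)" for x
    using gorenstein_shift[OF fQ QL _ r that uQ] refl PQ by simp
  obtain h :: "nat \<Rightarrow> int" where h: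
    "\<forall>j>?n + 1. h j = 0"
    "hstar_series (convex hull Q) = Abs_fps h"
    "(1 - fps_X) ^ (?n + 1) * cone_series Q = Abs_fps h"
    "(1 - fps_X) ^ (?n + 1) * interior_series Q =
       Abs_fps (\<lambda>j. if j \<le> ?n + 1 then h (?n + 1 - j) else 0)"
    "h 0 = 1"
    "h 1 = int (card (convex hull Q \<inter> lattice_points)) - int (?n + 1)"
    using hstar_reciprocity[OF fQ QL spQ] .
  obtain p :: "int poly" where p: "fps_of_poly p = hstar_series P" "degree p = 2"
    using assms unfolding minimal_gorenstein_degree_2_def has_degree_def by blast
  have hp: "h j = coeff p j" for j
  proof -
    have "Abs_fps h $ j = fps_of_poly p $ j" using p(1) h(2) PQ by simp
    then show ?thesis by simp
  qed
  have h2: "h 2 \<noteq> 0" using p(2) hp[of 2] by (metis degree_0 leading_coeff_0_iff zero_neq_numeral)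
  have hhigh: "h j = 0" if "j > 2" for j using hp p(2) that by (simp add: coeff_eq_0)
  have "Abs_fps (\<lambda>j. if j \<le> ?n + 1 then h (?n + 1 - j) else 0) = fps_X ^ r * Abs_fps h"
  proof -
    have "interior_series Q =
        fps_X ^ r * cone_series Q"
      by (rule pos_series_eq[OF fQ QL mL uQ]) (rule shift)
    then show ?thesis unfolding h(3)[symmetric] h(4)[symmetric] by (simp only: mult.left_commute)
  qed
  then have pal: "(if j \<le> ?n + 1 then h (?n + 1 - j) else 0) = (if j < r then 0 else h (j - r))" for j
    by (simp add: fps_eq_iff fps_X_power_mult_nth)
  \<comment> \<open>At index r + 2 the right side is the nonzero \<open>h 2\<close>, so r + 2 \<le>
    n + 1. At index n + 1 the left side is \<open>h 0 = 1\<close>, so \<open>h (n + 1 - r)\<close>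
    is nonzero and its index is at most 2.\<close>
  have rn: "r + 1 = ?n"
  proof -
    have "r + 2 \<le> ?n + 1" using pal[of "r + 2"] h2 by (auto split: if_splits)
    moreover have "h (?n + 1 - r) \<noteq> 0" using pal[of "?n + 1"] h(5) by (auto split: if_splits)
    then have "\<not> 2 < ?n + 1 - r" using hhigh by blast
    ultimately show ?thesis by linarith
  qed
  have h2': "h 2 = 1"
  proof -
    have "?n + 1 - r = 2" using rn by linarith
    then show ?thesis using pal[of r] h(5) rn by simp
  qed
  have "normalized_volume P = of_int (\<Sum>j\<le>2. h j)"
    using bP h(2) PQ hhigh by (intro normalized_volume_eq_sum_hstar) auto
  also have "(\<Sum>j\<le>2. h j) = h 0 + h 1 + h 2" by (simp add: numeral_2_eq_2)
  also have "\<dots> = int (card Q) - int ?n + 1"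
  proof -
    have "convex hull Q \<inter> lattice_points = Q" using PQ Q_def by blast
    then show ?thesis unfolding h(5,6) h2' by simp
  qed
  finally have vol: "normalized_volume P = real (card Q) - real ?n + 1" by simp
  have uL: "u \<in> lifted_lattice" using mL by (simp add: u_def lifted_lattice_def)
  interpret minimal_frame lifted_lattice snd "lift Q" "lift V" u
  proof
    show "finite (lift Q)" by (rule finite_lift[OF fQ])
    show "lift Q \<subseteq> lifted_lattice" by (rule lift_lattice[OF QL])
    show "snd q = 1" if "q \<in> lift Q" for q using that by (rule snd_lift)
    show "x \<in> lift Q" if x: "x \<in> lifted_lattice" "x \<in> nonneg_comb (lift Q)" "snd x = 1" for x
    proof -
      obtain y where y: "x = (y, 1)" using x(3) by (metis prod.collapse)
      have "y \<in> P" using nonneg_comb_lift_iff[OF fQ, of 1 y] x(2) y PQ by simp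
      then show ?thesis using x(1) y by (auto simp: lift_def Q_def lifted_lattice_def)
    qed
    show "u \<in> pos_comb (lift Q)" "u \<in> pos_comb (lift V)" using uQ uV by (simp_all add: u_def)
    show "u \<in> lifted_lattice" by (rule uL)
    show "snd u = real DIM((real ^ 'n) \<times> real) - 2" using rn by (simp add: u_def flip: rn)
    show "x - u \<in> nonneg_comb (lift Q)" if "x \<in> lifted_lattice" "x \<in> pos_comb (lift Q)" for x
      using shift that by (simp add: u_def)
    show "lift V \<subseteq> lift Q" by (rule lift_mono[OF VQ])
    show "span (lift V) = UNIV" by (rule spV)
    show "lift Q \<subseteq> nonneg_comb (lift V)"
    proof
      fix x assume "x \<in> lift Q"
      then obtain y where y: "y \<in> Q" "x = (y, 1)" by (auto simp: lift_def)
      then show "x \<in> nonneg_comb (lift V)" using nonneg_comb_lift_iff[OF fV, of 1 y] PV by (simp add: Q_def)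
    qed
    show "lift V \<subseteq> A" if A: "A \<subseteq> lift Q" "u \<in> pos_comb A" "span A = UNIV" for A
    proof -
      define B where "B = fst ` A"
      have AB: "A = lift B" using A(1) by (force simp: B_def lift_def)
      have BQ: "B \<subseteq> Q" using A(1) unfolding AB lift_subset_iff .
      have fB: "finite B" using BQ fQ finite_subset by blast
      have "gorenstein (convex hull B)" "has_degree (convex hull B) 2"
        using gorenstein_degree_2_sub[OF fQ BQ QL _ r rn mL _ uQ shift] A(2,3) unfolding AB u_def by blast+
      moreover have "full_lattice_polytope (convex hull B)" using full_lattice_polytope_iff[OF fB] A(3) BQ QL AB by auto
      moreover have "convex hull B \<subseteq> P" unfolding PQ by (rule hull_mono[OF BQ])
      ultimately have "convex hull B = P" using assms unfolding minimal_gorenstein_degree_2_def by blast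
      \<comment> \<open>Every extreme point of a convex hull belongs to the generating set.\<close>
      then have "V \<subseteq> B" unfolding V_def using extreme_point_of_convex_hull by blast
      then show ?thesis unfolding AB by (rule lift_mono)
    qed
  qed
  have "card (lift Q) = card Q" by (simp add: lift_def card_image inj_on_def)
  \<comment> \<open>The lifted space has dimension n + 1, so the frame bound \<open>DIM + 2\<close>
    is n + 3.\<close>
  then have "card Q \<le> ?n + 3" using card_Q_le by simp
  then show ?thesis using vol by linarith
qed

end
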